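(* Let $d\ge 1$ and let $c\in C_b(\mathbb{H}^d)$ be real-valued. For $\tau\ge 0$ and $\psi\in C_0(\mathbb{H}^d)$ put $$[S(\tau)\psi](z,s):=\int_{\mathbb{R}^{2d}}\psi\big(z+\sqrt{\tau}\,\zeta,\;s+\sqrt{\tau}\,z\cdot_\sigma\zeta\big)\,\mathrm{d}\mu_G(\zeta)+\tau\,c(z,s)\,\psi(z,s),\qquad (z,s)\in\mathbb{R}^{2d}\times\mathbb{R}.$$ Then for $u_0\in D(L)$ the classical solution in $C_0(\mathbb{H}^d)$ of the Cauchy problem $$\frac{\partial}{\partial t}u(t,x)=L_c u(t,x),\qquad u(0,x)=u_0(x),\qquad t\ge 0,\ x\in\mathbb{H}^d,$$ where $L_c=\frac{L}{2}+c$, is given by $$u(t,x)=\lim_{n\to\infty}\big(S(t/n)^n u_0\big)(x).$$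
   Context: The Heisenberg group is $\mathbb{H}^d=\mathbb{R}^{2d}\times\mathbb{R}$ with points $(z,s)=(x,y,s)$, $x,y\in\mathbb{R}^d$, $s\in\mathbb{R}$, and group law $(x,y,s)\cdot(x',y',s')=(x+x',y+y',s+s'+x'y-xy')$. (In the Cauchy problem $x$ denotes a generic point of $\mathbb{H}^d$.) For $z=(x,y)$ and $z'=(x',y')$ in $\mathbb{R}^{2d}$, $z\cdot_\sigma z':=x'y-xy'$ (Euclidean scalar products in $\mathbb{R}^d$). $C_0(\mathbb{H}^d)$ is the Banach space (sup norm) of continuous functions on $\mathbb{H}^d$ vanishing at infinity, $C_b(\mathbb{H}^d)$ the bounded continuous functions. $\mathrm{d}\mu_G(\zeta)=(2\pi)^{-d}e^{-|\zeta|^2/2}\,\mathrm{d}^{2d}\zeta$ is the standard Gaussian measure on $\mathbb{R}^{2d}$. Let $X_i=\partial_{x^i}+y^i\partial_s$, $Y_i=\partial_{y^i}-x^i\partial_s$, $i=1,\dots,d$, and $L_0=\sum_{i=1}^d(X_i^2+Y_i^2)$. Here $L:D(L)\subset C_0(\mathbb{H}^d)\to C_0(\mathbb{H}^d)$ is the operator such that $\frac{L}{2}$ is the generator of the Feller semigroup of horizontal Brownian motion on $\mathbb{H}^d$: the semigroup is $(V(t)f)(\xi)=\mathbb{E}[f(\xi\cdot W(t))]$, where $W(t)=(B^1(t),B^2(t),A(t))$, $B^1=(B^1_1,\dots,B^1_d)$ and $B^2=(B^2_1,\dots,B^2_d)$ are independent standard Brownian motions in $\mathbb{R}^d$ started at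 $0$ (giving the $x$- and $y$-components respectively), and $A(t)=\sum_{j=1}^d\int_0^t B_j^2(r)\,\mathrm{d}B_j^1(r)-B_j^1(r)\,\mathrm{d}B_j^2(r)$ (Itô integrals). $L$ coincides with $L_0$ on $C_c^\infty(\mathbb{H}^d)$, which is a core for $L$. $L_c=\frac{L}{2}+c$ has domain $D(L)$, where $c$ acts as a bounded multiplication operator; it generates a strongly continuous semigroup on $C_0(\mathbb{H}^d)$. For an operator $\Lambda:D(\Lambda)\subset\mathcal{B}\to\mathcal{B}$ on a Banach space $\mathcal{B}$, a classical solution of $u'(t)=\Lambda u(t)$, $u(0)=u_0$, is a function $u:[0,\infty)\to\mathcal{B}$ that is continuously differentiable in the norm of $\mathcal{B}$, takes values in $D(\Lambda)$, and satisfies the equation and the initial condition for all $t\ge 0$. Here $\mathcal{B}=C_0(\mathbb{H}^d)$ and $\Lambda=L_c$. $S(t/n)^n$ is the composition of $n$ copies of $S(t/n)$. *)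

theory Defs
  imports "HOL-Probability.Probability"
begin

section \<open>The Heisenberg group\<close>

type_synonym 'd heis = "((real^'d) \<times> (real^'d)) \<times> real"

definition sympl :: "(real^'d) \<times> (real^'d) \<Rightarrow> (real^'d) \<times> (real^'d) \<Rightarrow> real"
    (infixl "\<bullet>\<^sub>\<sigma>" 70) where
  "z \<bullet>\<^sub>\<sigma> z' = fst z' \<bullet> snd z - fst z \<bullet> snd z'"

definition hmult :: "'d::finite heis \<Rightarrow> 'd heis \<Rightarrow> 'd heis" (infixl "\<odot>" 70) where
  "\<xi> \<odot> \<eta> = (fst \<xi> + fst \<eta>, snd \<xi> + snd \<eta> + fst \<xi> \<bullet>\<^sub>\<sigma> fst \<eta>)"

lemma hmult_coords:
  "((x, y), s) \<odot> ((x', y'), s') = ((x + x', y + y'), s + s' + x' \<bullet> y - x \<bullet> y')"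
  by (simp add: hmult_def sympl_def)


section \<open>Function spaces and Cauchy problems\<close>

definition C0 :: "('a::real_normed_vector \<Rightarrow>\<^sub>C 'b::real_normed_vector) set" where
  "C0 = {f. (apply_bcontfun f \<longlongrightarrow> 0) at_infinity}"

definition bmult ::
    "('a::topological_space \<Rightarrow>\<^sub>C real) \<Rightarrow> ('a \<Rightarrow>\<^sub>C 'b::real_normed_vector) \<Rightarrow> ('a \<Rightarrow>\<^sub>C 'b)" where
  "bmult c f = Bcontfun (\<lambda>x. apply_bcontfun c x *\<^sub>R apply_bcontfun f x)"

lemma bmult_apply: "apply_bcontfun (bmult c f) x = apply_bcontfun c x *\<^sub>R apply_bcontfun f x"
proof -
  have "norm (apply_bcontfun c x *\<^sub>R apply_bcontfun f x) \<le> norm c * norm f" for x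
    using mult_mono[OF norm_bounded[of c x] norm_bounded[of f x]] by simp
  then have "(\<lambda>x. apply_bcontfun c x *\<^sub>R apply_bcontfun f x) \<in> bcontfun"
    by (intro bcontfun_normI continuous_intros) auto
  then show ?thesis
    by (simp add: bmult_def Bcontfun_inverse)
qed

definition generator_domain ::
    "'b::real_normed_vector set \<Rightarrow> (real \<Rightarrow> 'b \<Rightarrow> 'b) \<Rightarrow> 'b set" where
  "generator_domain B T = {f \<in> B. \<exists>g\<in>B. ((\<lambda>t. (T t f - f) /\<^sub>R t) \<longlongrightarrow> g) (at_right 0)}"

definition generator :: "(real \<Rightarrow> 'b \<Rightarrow> 'b) \<Rightarrow> 'b \<Rightarrow> 'b::real_normed_vector" where
  "generator T f = Lim (at_right 0) (\<lambda>t. (T t f - f) /\<^sub>R t)"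

definition classical_solution ::
    "'b::real_normed_vector set \<Rightarrow> ('b \<Rightarrow> 'b) \<Rightarrow> 'b \<Rightarrow> (real \<Rightarrow> 'b) \<Rightarrow> bool" where
  "classical_solution D \<Lambda> u0 u \<longleftrightarrow>
     u 0 = u0 \<and>
     (\<forall>t\<ge>0. u t \<in> D \<and> (u has_vector_derivative \<Lambda> (u t)) (at t within {0..})) \<and>
     continuous_on {0..} (\<lambda>t. \<Lambda> (u t))"


section \<open>Brownian motion and Ito integrals\<close>

definition std_gaussian :: "'e::euclidean_space measure" where
  "std_gaussian = density lborel
     (\<lambda>x. ennreal ((2 * pi) powr (- (DIM('e) / 2)) * exp (- (norm x)\<^sup>2 / 2)))"

lemma std_gaussian_phase_space:
  "(std_gaussian :: ((real^'d::finite) \<times> (real^'d)) measure) =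
     density lborel (\<lambda>\<zeta>. ennreal ((2 * pi) powr (- real CARD('d)) * exp (- (norm \<zeta>)\<^sup>2 / 2)))"
  by (simp add: std_gaussian_def)

definition generated_algebra ::
    "'w measure \<Rightarrow> (real \<Rightarrow> 'w \<Rightarrow> 'e::topological_space) \<Rightarrow> real set \<Rightarrow> 'w measure" where
  "generated_algebra M X I =
     sigma (space M) (\<Union>r\<in>I. {X r -` E \<inter> space M | E. E \<in> sets borel})"

definition standard_BM ::
    "'w measure \<Rightarrow> (real \<Rightarrow> 'w \<Rightarrow> 'e::euclidean_space) \<Rightarrow> bool" where
  "standard_BM M X \<longleftrightarrow>
     (\<forall>t\<ge>0. X t \<in> borel_measurable M) \<and>
     (AE \<omega> in M. X 0 \<omega> = 0 \<and> continuous_on {0..} (\<lambda>t. X t \<omega>)) \<and>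
     (\<forall>s\<ge>0. \<forall>t\<ge>s.
        prob_space.indep_set M (sets (generated_algebra M X {0..s}))
          {(\<lambda>\<omega>. X t \<omega> - X s \<omega>) -` E \<inter> space M | E. E \<in> sets borel} \<and>
        distr M borel (\<lambda>\<omega>. X t \<omega> - X s \<omega>) =
          distr std_gaussian borel (\<lambda>x. sqrt (t - s) *\<^sub>R x))"

text \<open>A simple process on \<open>(0, t]\<close> takes the value \<open>\<phi> i\<close> on \<open>(\<tau> i, \<tau> (i + 1)]\<close> for \<open>i < n\<close>.\<close>

definition simple_data ::
    "(real \<Rightarrow> 'w measure) \<Rightarrow> real \<Rightarrow> nat \<Rightarrow> (nat \<Rightarrow> real) \<Rightarrow> (nat \<Rightarrow> 'w \<Rightarrow> real) \<Rightarrow> bool" where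
  "simple_data F t n \<tau> \<phi> \<longleftrightarrow>
     \<tau> 0 = 0 \<and> \<tau> n = t \<and> (\<forall>i<n. \<tau> i \<le> \<tau> (Suc i)) \<and>
     (\<forall>i<n. \<phi> i \<in> borel_measurable (F (\<tau> i)) \<and> (\<exists>K. \<forall>\<omega>\<in>space (F (\<tau> i)). \<bar>\<phi> i \<omega>\<bar> \<le> K))"

definition simple_process ::
    "nat \<Rightarrow> (nat \<Rightarrow> real) \<Rightarrow> (nat \<Rightarrow> 'w \<Rightarrow> real) \<Rightarrow> real \<Rightarrow> 'w \<Rightarrow> real" where
  "simple_process n \<tau> \<phi> r \<omega> = (\<Sum>i<n. \<phi> i \<omega> * indicator {\<tau> i<..\<tau> (Suc i)} r)"

definition simple_integral ::
    "(real \<Rightarrow> 'w \<Rightarrow> real) \<Rightarrow> nat \<Rightarrow> (nat \<Rightarrow> real) \<Rightarrow> (nat \<Rightarrow> 'w \<Rightarrow> real) \<Rightarrow> 'w \<Rightarrow> real" where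
  "simple_integral X n \<tau> \<phi> \<omega> = (\<Sum>i<n. \<phi> i \<omega> * (X (\<tau> (Suc i)) \<omega> - X (\<tau> i) \<omega>))"

text \<open>
  \<open>has_ito_integral M F X H t J\<close>: the random variable \<open>J\<close> is (a version of) the integral of \<open>H\<close>
  with respect to the Brownian motion \<open>X\<close> over \<open>[0, t]\<close>, i.e. the \<open>L\<^sup>2\<close>-limit of the integrals
  of simple \<open>F\<close>-adapted processes approximating \<open>H\<close> in \<open>L\<^sup>2\<close>.
\<close>

definition has_ito_integral ::
    "'w measure \<Rightarrow> (real \<Rightarrow> 'w measure) \<Rightarrow> (real \<Rightarrow> 'w \<Rightarrow> real) \<Rightarrow> (real \<Rightarrow> 'w \<Rightarrow> real) \<Rightarrow>
     real \<Rightarrow> ('w \<Rightarrow> real) \<Rightarrow> bool" where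
  "has_ito_integral M F X H t J \<longleftrightarrow>
     J \<in> borel_measurable M \<and>
     (\<exists>n \<tau> \<phi>.
        (\<forall>k. simple_data F t (n k) (\<tau> k) (\<phi> k)) \<and>
        (\<lambda>k. \<integral>\<^sup>+\<omega>. (\<integral>\<^sup>+r\<in>{0..t}.
               ennreal ((simple_process (n k) (\<tau> k) (\<phi> k) r \<omega> - H r \<omega>)\<^sup>2) \<partial>lborel) \<partial>M)
          \<longlonglongrightarrow> 0 \<and>
        (\<lambda>k. \<integral>\<^sup>+\<omega>. ennreal ((simple_integral X (n k) (\<tau> k) (\<phi> k) \<omega> - J \<omega>)\<^sup>2) \<partial>M)
          \<longlonglongrightarrow> 0)"


section \<open>Horizontal Brownian motion and its generator\<close>

definition horizontal_BM ::
    "'w measure \<Rightarrow> (real \<Rightarrow> 'w \<Rightarrow> real^'d::finite) \<Rightarrow> (real \<Rightarrow> 'w \<Rightarrow> real^'d) \<Rightarrow>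
     (real \<Rightarrow> 'w \<Rightarrow> real) \<Rightarrow> bool" where
  "horizontal_BM M B1 B2 A \<longleftrightarrow>
     prob_space M \<and> standard_BM M B1 \<and> standard_BM M B2 \<and>
     prob_space.indep_set M
       (sets (generated_algebra M B1 {0..})) (sets (generated_algebra M B2 {0..})) \<and>
     (\<forall>t\<ge>0. A t \<in> borel_measurable M \<and>
       (let F = (\<lambda>s. generated_algebra M (\<lambda>r \<omega>. (B1 r \<omega>, B2 r \<omega>)) {0..s}) in
        \<exists>J1 J2.
          (\<forall>j. has_ito_integral M F (\<lambda>r \<omega>. B1 r \<omega> $ j) (\<lambda>r \<omega>. B2 r \<omega> $ j) t (J1 j)) \<and>
          (\<forall>j. has_ito_integral M F (\<lambda>r \<omega>. B2 r \<omega> $ j) (\<lambda>r \<omega>. B1 r \<omega> $ j) t (J2 j)) \<and>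
          (AE \<omega> in M. A t \<omega> = (\<Sum>j\<in>UNIV. J1 j \<omega> - J2 j \<omega>))))"

definition heis_process ::
    "(real \<Rightarrow> 'w \<Rightarrow> real^'d) \<Rightarrow> (real \<Rightarrow> 'w \<Rightarrow> real^'d) \<Rightarrow> (real \<Rightarrow> 'w \<Rightarrow> real) \<Rightarrow>
     real \<Rightarrow> 'w \<Rightarrow> 'd heis" where
  "heis_process B1 B2 A t \<omega> = ((B1 t \<omega>, B2 t \<omega>), A t \<omega>)"

text \<open>The use of \<open>Bcontfun\<close> is justified by \<open>heis_semigroup_apply\<close> below.\<close>

definition heis_semigroup ::
    "'w measure \<Rightarrow> (real \<Rightarrow> 'w \<Rightarrow> 'd::finite heis) \<Rightarrow> real \<Rightarrow>
     ('d heis \<Rightarrow>\<^sub>C 'k::euclidean_space) \<Rightarrow> ('d heis \<Rightarrow>\<^sub>C 'k)" where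
  "heis_semigroup M W t f = Bcontfun (\<lambda>\<xi>. \<integral>\<omega>. apply_bcontfun f (\<xi> \<odot> W t \<omega>) \<partial>M)"

lemma continuous_on_hmult [continuous_intros]:
  fixes f g :: "'a::topological_space \<Rightarrow> 'd::finite heis"
  assumes "continuous_on S f" "continuous_on S g"
  shows "continuous_on S (\<lambda>x. f x \<odot> g x)"
  unfolding hmult_def sympl_def by (intro continuous_intros assms)

lemma heis_semigroup_apply:
  fixes f :: "'d::finite heis \<Rightarrow>\<^sub>C 'k::euclidean_space"
  assumes "prob_space M" and W: "W t \<in> borel_measurable M"
  shows "apply_bcontfun (heis_semigroup M W t f) \<xi> = (\<integral>\<omega>. apply_bcontfun f (\<xi> \<odot> W t \<omega>) \<partial>M)"
proof -
  interpret prob_space M by fact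
  have f: "continuous_on UNIV (apply_bcontfun f)"
    by simp
  have nf: "norm (apply_bcontfun f x) \<le> norm f" for x
    by (rule norm_bounded)
  have meas: "(\<lambda>\<omega>. apply_bcontfun f (\<xi> \<odot> W t \<omega>)) \<in> borel_measurable M" for \<xi>
  proof -
    have "continuous_on UNIV (\<lambda>\<eta>. apply_bcontfun f (\<xi> \<odot> \<eta>))"
      by (intro continuous_on_compose2[OF f] continuous_intros) auto
    from measurable_compose[OF W borel_measurable_continuous_onI[OF this]] show ?thesis .
  qed
  have int: "integrable M (\<lambda>\<omega>. apply_bcontfun f (\<xi> \<odot> W t \<omega>))" for \<xi>
    by (rule integrable_const_bound[where B = "norm f"]) (use nf meas in auto)
  have "norm (\<integral>\<omega>. apply_bcontfun f (\<xi> \<odot> W t \<omega>) \<partial>M) \<le> norm f" for \<xi>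
  proof -
    have "norm (\<integral>\<omega>. apply_bcontfun f (\<xi> \<odot> W t \<omega>) \<partial>M)
        \<le> (\<integral>\<omega>. norm (apply_bcontfun f (\<xi> \<odot> W t \<omega>)) \<partial>M)"
      by (rule integral_norm_bound)
    also have "\<dots> \<le> (\<integral>\<omega>. norm f \<partial>M)"
      by (intro integral_mono integrable_norm int nf) auto
    finally show ?thesis by (simp add: prob_space)
  qed
  moreover have "continuous_on UNIV (\<lambda>\<xi>. \<integral>\<omega>. apply_bcontfun f (\<xi> \<odot> W t \<omega>) \<partial>M)"
    unfolding continuous_on_sequentially
  proof (intro allI ballI impI, elim conjE)
    fix X :: "nat \<Rightarrow> 'd heis" and a
    assume X: "X \<longlonglongrightarrow> a"
    have "(\<lambda>n. \<integral>\<omega>. apply_bcontfun f (X n \<odot> W t \<omega>) \<partial>M)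
        \<longlonglongrightarrow> (\<integral>\<omega>. apply_bcontfun f (a \<odot> W t \<omega>) \<partial>M)"
    proof (rule integral_dominated_convergence[where w = "\<lambda>_. norm f"])
      show "AE \<omega> in M. (\<lambda>n. apply_bcontfun f (X n \<odot> W t \<omega>))
          \<longlonglongrightarrow> apply_bcontfun f (a \<odot> W t \<omega>)"
      proof (rule AE_I2)
        fix \<omega>
        have "continuous_on UNIV (\<lambda>\<xi>. apply_bcontfun f (\<xi> \<odot> W t \<omega>))"
          by (intro continuous_on_compose2[OF f] continuous_intros) auto
        from continuous_on_tendsto_compose[OF this X]
        show "(\<lambda>n. apply_bcontfun f (X n \<odot> W t \<omega>))
            \<longlonglongrightarrow> apply_bcontfun f (a \<odot> W t \<omega>)"
          by simp
      qed
    qed (use meas nf in auto)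
    then show "((\<lambda>\<xi>. \<integral>\<omega>. apply_bcontfun f (\<xi> \<odot> W t \<omega>) \<partial>M) \<circ> X)
        \<longlonglongrightarrow> (\<integral>\<omega>. apply_bcontfun f (a \<odot> W t \<omega>) \<partial>M)"
      by (simp add: comp_def)
  qed
  ultimately have "(\<lambda>\<xi>. \<integral>\<omega>. apply_bcontfun f (\<xi> \<odot> W t \<omega>) \<partial>M) \<in> bcontfun"
    by (intro bcontfun_normI)
  then show ?thesis
    by (simp add: heis_semigroup_def Bcontfun_inverse)
qed

definition dom_L ::
    "'w measure \<Rightarrow> (real \<Rightarrow> 'w \<Rightarrow> 'd::finite heis) \<Rightarrow> ('d heis \<Rightarrow>\<^sub>C 'k::euclidean_space) set" where
  "dom_L M W = generator_domain C0 (heis_semigroup M W)"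

definition op_L ::
    "'w measure \<Rightarrow> (real \<Rightarrow> 'w \<Rightarrow> 'd::finite heis) \<Rightarrow>
     ('d heis \<Rightarrow>\<^sub>C 'k::euclidean_space) \<Rightarrow> ('d heis \<Rightarrow>\<^sub>C 'k)" where
  "op_L M W f = 2 *\<^sub>R generator (heis_semigroup M W) f"

definition op_Lc ::
    "'w measure \<Rightarrow> (real \<Rightarrow> 'w \<Rightarrow> 'd::finite heis) \<Rightarrow> ('d heis \<Rightarrow>\<^sub>C real) \<Rightarrow>
     ('d heis \<Rightarrow>\<^sub>C 'k::euclidean_space) \<Rightarrow> ('d heis \<Rightarrow>\<^sub>C 'k)" where
  "op_Lc M W c f = (1 / 2) *\<^sub>R op_L M W f + bmult c f"


section \<open>The approximating operators\<close>

definition S_op ::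
    "('d::finite heis \<Rightarrow> real) \<Rightarrow> real \<Rightarrow> ('d heis \<Rightarrow> 'k::euclidean_space) \<Rightarrow> ('d heis \<Rightarrow> 'k)" where
  "S_op c \<tau> \<psi> = (\<lambda>(z, s).
     (\<integral>\<zeta>. \<psi> (z + sqrt \<tau> *\<^sub>R \<zeta>, s + sqrt \<tau> * (z \<bullet>\<^sub>\<sigma> \<zeta>)) \<partial>std_gaussian)
     + (\<tau> * c (z, s)) *\<^sub>R \<psi> (z, s))"

end

theory Submission
  imports Defs
begin

text \<open>
  Let \<open>W(t) = (B(t), A(t))\<close> be horizontal Brownian motion, \<open>V(t)\<close> its semigroup and \<open>U(\<tau>)\<close> the
  Gaussian part of \<open>S(\<tau>) = U(\<tau>) + \<tau> c\<close>. The usual argument compares \<open>U(\<tau>) f - f\<close> with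
  \<open>\<tau> L f / 2\<close> on a core of \<open>L\<close> and invokes Chernoff's theorem. Here the powers of \<open>U\<close> are instead
  compared with \<open>V\<close> by realising both on one Brownian path.

  The operator \<open>U(\<tau>)\<close> averages over right translation by the horizontal Gaussian vector
  \<open>(\<surd>\<tau> \<zeta>, 0)\<close>, and this vector has the law of \<open>(B(r + \<tau>) - B(r), 0)\<close>. As the increments of \<open>B\<close> are
  independent, \<open>U(t/n)\<^sup>n f(\<xi>)\<close> is the expectation of \<open>f\<close> at \<open>\<xi>\<close> times the group product of the
  horizontal increments of one Brownian path along the uniform partition of \<open>[0, t]\<close>
  (\<open>gaussian_product_walk\<close>). By the group law that product is \<open>(B(t), A\<^sub>n)\<close>, where \<open>A\<^sub>n\<close> is exactly
  the left-endpoint Riemann sum of the Ito integral \<open>A(t)\<close>. So the product and \<open>W(t)\<close> live on the same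
  probability space and differ only in the central coordinate; the Ito isometry bounds the second
  moment of \<open>A(t) - A\<^sub>n\<close> by a constant times \<open>t\<close> times the mesh (\<open>ito_riemann_sum_error\<close>,
  \<open>area_error\<close>). A function in \<open>C\<^sub>0\<close> is uniformly continuous under right translation by small
  group elements (\<open>C0_quadratic_modulus\<close>), hence \<open>U(\<tau>)\<^sup>m f - V(m \<tau>) f\<close> tends to \<open>0\<close> in the sup norm as
  \<open>\<tau>\<close> tends to \<open>0\<close>, uniformly for \<open>m \<tau>\<close> in a bounded interval (\<open>gaussian_power_approximates\<close>). The
  same estimate for partitions with two different step sizes gives \<open>V(s + t) = V(s) V(t)\<close>, and with a
  single step it reduces strong continuity at \<open>0\<close> to that of \<open>U\<close>
  (\<open>gaussian_average_tendsto\<close>), so \<open>V\<close> is a contraction semigroup on \<open>C\<^sub>0\<close>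
  (\<open>heis_contraction_semigroup\<close>).

  The rest is semigroup theory for a bounded perturbation \<open>P\<close>, here multiplication by \<open>c\<close>. The
  perturbed semigroup is obtained from the integral equation
  \<open>u(t) = V(t) g + \<integral>\<^sub>0\<^sup>t V(t - r) P u(r) dr\<close>. Its generator is the generator of \<open>V\<close> plus \<open>P\<close>, so its
  orbits through the domain are classical solutions (\<open>perturbed_classical_solution\<close>), and a Gronwall
  argument with Dini derivatives shows that there are no others (\<open>classical_solution_unique\<close>).
  Finally \<open>(U(\<tau>) + \<tau> P)\<^sup>n u(0)\<close> and \<open>u(n \<tau>)\<close> both satisfy a discrete version of the integral
  equation, with \<open>U(\<tau>)\<^sup>m\<close> in the one and \<open>V(m \<tau>)\<close> in the other. These operators need only be compared at
  \<open>u(0)\<close> and on the compact set \<open>P u([0, t])\<close>, and the discrete Gronwall inequality concludes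
  (\<open>perturbed_product_formula\<close>).
\<close>

section \<open>Integrals, difference quotients and a differential inequality\<close>

text \<open>
  The Riemann sums of \<open>f\<close> over fine tagged divisions lie in \<open>B\<close> and converge to the integral. This keeps
  the Duhamel integrals of \<open>C\<^sub>0\<close>-valued functions inside \<open>C\<^sub>0\<close>.
\<close>

lemma integral_in_closed_subspace:
  fixes f :: "real \<Rightarrow> 'b::banach"
  assumes B: "closed B" "subspace B" and f: "f integrable_on {a..b}" and mem: "\<And>r. r \<in> {a..b} \<Longrightarrow> f r \<in> B"
  shows "integral {a..b} f \<in> B"
proof -
  have "\<exists>x\<in>B. dist x (integral {a..b} f) < e" if e: "e > 0" for e
  proof -
    have "(f has_integral integral {a..b} f) (cbox a b)"
      using integrable_integral[OF f] by simp
    from this[unfolded has_integral, rule_format, OF e]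
    obtain \<gamma> where g: "gauge \<gamma>" and gs: "\<And>\<D>. \<D> tagged_division_of cbox a b \<Longrightarrow> \<gamma> fine \<D> \<Longrightarrow>
        norm ((\<Sum>(x,k)\<in>\<D>. Henstock_Kurzweil_Integration.content k *\<^sub>R f x) - integral {a..b} f) < e"
      by metis
    obtain p where p: "p tagged_division_of cbox a b" "\<gamma> fine p"
      using fine_division_exists[OF g] by blast
    have "(\<Sum>(x,k)\<in>p. Henstock_Kurzweil_Integration.content k *\<^sub>R f x) \<in> B"
    proof (rule subspace_sum[OF B(2)], clarify)
      fix x k assume "(x,k) \<in> p"
      then have "x \<in> {a..b}" using tag_in_interval[OF p(1)] by simp
      then show "Henstock_Kurzweil_Integration.content k *\<^sub>R f x \<in> B" by (intro subspace_scale[OF B(2)] mem)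
    qed
    with gs[OF p] show ?thesis by (auto simp: dist_norm)
  qed
  then show ?thesis using B(1) closed_approachable by blast
qed

text \<open>
  With a fixed domain of integration, continuity of \<open>t \<mapsto> \<integral>\<^sub>0\<^sup>t F(t, r) dr\<close> becomes continuity of an
  integral in a parameter.
\<close>

lemma integral_rescale01:
  fixes f :: "real \<Rightarrow> 'b::banach"
  assumes "0 \<le> t" "continuous_on {0..t} f"
  shows "t *\<^sub>R integral {0..1} (\<lambda>\<theta>. f (t * \<theta>)) = integral {0..t} f"
proof (cases "t = 0")
  case False
  then have t: "t > 0" using assms by simp
  have "(f has_integral integral {0..t} f) (cbox 0 t)"
    using integrable_integral[OF integrable_continuous_real[OF assms(2)]] by (simp add: cbox_interval)
  from has_integral_affinity[OF this, of t 0] t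
  have "((\<lambda>x. f (t * x)) has_integral (1 / t) *\<^sub>R integral {0..t} f) ((\<lambda>x. x / t) ` {0..t})"
    by (simp add: cbox_interval divide_inverse_commute)
  moreover have "(\<lambda>x. x / t) ` {0..t} = {0..1}"
    using t by (simp add: image_divide_atLeastAtMost)
  ultimately have "integral {0..1} (\<lambda>x. f (t * x)) = (1 / t) *\<^sub>R integral {0..t} f"
    by (simp add: integral_unique)
  then show ?thesis using t by simp
qed simp

lemma exp_kernel_integral:
  fixes l t :: real
  assumes "l > 0" "t \<ge> 0"
  shows "(\<lambda>r. exp (- l * (t - r))) integrable_on {0..t}" "integral {0..t} (\<lambda>r. exp (- l * (t - r))) \<le> 1 / l"
proof -
  have "((\<lambda>r. exp (- l * (t - r))) has_integral (exp (- l * (t - t)) / l - exp (- l * (t - 0)) / l)) {0..t}"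
    by (rule fundamental_theorem_of_calculus[OF assms(2)])
      (use assms(1) in \<open>auto intro!: derivative_eq_intros simp: has_real_derivative_iff_has_vector_derivative[symmetric]\<close>)
  then show "(\<lambda>r. exp (- l * (t - r))) integrable_on {0..t}" "integral {0..t} (\<lambda>r. exp (- l * (t - r))) \<le> 1 / l"
    using assms by (auto simp: integral_unique divide_simps has_integral_integrable)
qed

text \<open>
  A Gronwall inequality in which the upper right Dini derivative of \<open>\<phi>\<close> replaces the derivative. For
  every \<open>e > 0\<close> the barrier \<open>b(s) = e exp((K + 1) s)\<close> lies above \<open>\<phi>\<close> at \<open>0\<close> and grows at least as fast as
  \<open>\<phi>\<close> may grow where the two touch, so \<open>\<phi>\<close> never crosses it.
\<close>

lemma nonpositive_if_Dini_bounded: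
  fixes \<phi> :: "real \<Rightarrow> real"
  assumes cont: "continuous_on {0..} \<phi>" and init: "\<phi> 0 \<le> 0" and K: "K \<ge> 0"
    and Dini: "\<And>t e. t \<ge> 0 \<Longrightarrow> e > 0 \<Longrightarrow> eventually (\<lambda>h. \<phi> (t + h) \<le> \<phi> t + h * (K * \<phi> t + e)) (at_right 0)"
    and t: "t \<ge> 0"
  shows "\<phi> t \<le> 0"
proof -
  have main: "\<phi> s \<le> e * exp ((K + 1) * s)" if e: "e > 0" and s: "s \<ge> 0" for e s
  proof -
    define b where "b = (\<lambda>s. e * exp ((K + 1) * s))"
    have b_step: "b s + h * (K * b s + e) \<le> b (s + h)" if "s \<ge> 0" "h \<ge> 0" for s h
    proof -
      have "1 + (K + 1) * h \<le> exp ((K + 1) * h)"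
        using exp_ge_add_one_self by blast
      moreover have "1 \<le> exp ((K + 1) * s)" using K that by simp
      ultimately have "exp ((K + 1) * s) * (1 + (K + 1) * h) \<le> exp ((K + 1) * s) * exp ((K + 1) * h)"
        "h * 1 \<le> h * exp ((K + 1) * s)"
        using that by (intro mult_left_mono; simp)+
      then have "exp ((K + 1) * s) + h * (K * exp ((K + 1) * s) + 1) \<le> exp ((K + 1) * (s + h))"
        by (simp add: algebra_simps exp_add[symmetric])
      from mult_left_mono[OF this, of e] e show ?thesis
        by (simp add: b_def algebra_simps)
    qed
    have bc: "continuous_on {0..} b" unfolding b_def by (intro continuous_intros)
    define S where "S = {r. 0 \<le> r \<and> (\<forall>q\<in>{0..r}. \<phi> q \<le> b q)}"
    have "s \<in> S"
    proof (rule ccontr)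
      assume ns: "s \<notin> S"
      have S0: "0 \<in> S" using init e by (auto simp: S_def b_def)
      have bdd: "r \<le> s" if "r \<in> S" for r
      proof (rule ccontr)
        assume "\<not> r \<le> s"
        with that s have "s \<in> S" by (auto simp: S_def)
        with ns show False by simp
      qed
      then have bdd': "bdd_above S" by (auto simp: bdd_above_def)
      define m where "m = Sup S"
      have m0: "0 \<le> m" unfolding m_def by (rule cSup_upper[OF S0 bdd'])
      have less: "\<phi> q \<le> b q" if "0 \<le> q" and qm: "q < m" for q
      proof -
        obtain r where "r \<in> S" "q < r" using qm S0 unfolding m_def
          by (metis less_cSup_iff bdd' empty_iff)
        then show ?thesis using that by (auto simp: S_def)
      qed
      have at_m: "\<phi> m \<le> b m"
      proof (cases "m = 0")
        case True then show ?thesis using S0 by (auto simp: S_def)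
      next
        case False
        then have "m > 0" using m0 by simp
        have lim: "((\<lambda>q. b q - \<phi> q) \<longlongrightarrow> b m - \<phi> m) (at m within {0..<m})"
          by (rule tendsto_within_subset[of _ _ _ "{0..}"])
            (use continuous_on_diff[OF bc cont] m0 in \<open>auto simp: continuous_on_def\<close>)
        have nontrivial: "at m within {0..<m} \<noteq> bot"
          using \<open>m > 0\<close> by (simp add: at_within_eq_bot_iff trivial_limit_within islimpt_approachable_real)
        have "0 \<le> b m - \<phi> m"
          by (rule tendsto_lowerbound[OF lim _ nontrivial]) (use less in \<open>auto simp: eventually_at_filter\<close>)
        then show ?thesis by simp
      qed
      from Dini[OF m0 e] obtain d where d: "d > 0" "\<And>h. 0 < h \<Longrightarrow> h < d \<Longrightarrow> \<phi> (m + h) \<le> \<phi> m + h * (K * \<phi> m + e)"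
        by (auto simp: eventually_at_right_field)
      have "\<phi> q \<le> b q" if "q \<in> {0..m + d/2}" for q
      proof (cases "q \<le> m")
        case True then show ?thesis using less at_m that by (cases "q = m") auto
      next
        case False
        define h where "h = q - m"
        have h: "0 < h" "h < d" using False that d(1) by (auto simp: h_def field_simps)
        have "\<phi> (m + h) \<le> \<phi> m + h * (K * \<phi> m + e)" by (rule d(2)[OF h])
        also have "\<dots> \<le> b m + h * (K * b m + e)"
          using at_m h K by (intro add_mono mult_left_mono) auto
        also have "\<dots> \<le> b (m + h)" using m0 h by (intro b_step) auto
        finally show ?thesis by (simp add: h_def)
      qed
      then have "m + d/2 \<in> S" using m0 d by (auto simp: S_def)
      then have "m + d/2 \<le> m" unfolding m_def by (rule cSup_upper[OF _ bdd'])
      then show False using d by simp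
    qed
    then show ?thesis using s by (auto simp: S_def b_def)
  qed
  show ?thesis
  proof (rule field_le_epsilon)
    fix e :: real assume "e > 0"
    then have "\<phi> t \<le> (e / exp ((K + 1) * t)) * exp ((K + 1) * t)" by (intro main t) simp
    then show "\<phi> t \<le> 0 + e" by simp
  qed
qed

lemma right_difference_quotient:
  assumes "(f has_vector_derivative D) (at t within {0..})" "t \<ge> 0"
  shows "((\<lambda>h. (f (t + h) - f t) /\<^sub>R h) \<longlongrightarrow> D) (at_right 0)"
proof -
  have "(f has_derivative (\<lambda>x. x *\<^sub>R D)) (at_right t)"
    using assms(1) unfolding has_vector_derivative_def
    by (rule has_derivative_subset) (use assms(2) in auto)
  then have "((\<lambda>y. ((f y - f t) - (y - t) *\<^sub>R D) /\<^sub>R norm (y - t)) \<longlongrightarrow> 0) (at_right t)"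
    by (simp add: has_derivative_def Lim_ident_at)
  then have "((\<lambda>h. ((f (t + h) - f t) - h *\<^sub>R D) /\<^sub>R \<bar>h\<bar>) \<longlongrightarrow> 0) (at_right 0)"
    by (subst (asm) filterlim_at_right_to_0) (simp add: add.commute)
  from tendsto_add[OF this tendsto_const[of D]]
  have "((\<lambda>h. ((f (t + h) - f t) - h *\<^sub>R D) /\<^sub>R \<bar>h\<bar> + D) \<longlongrightarrow> D) (at_right 0)"
    by simp
  moreover have "eventually (\<lambda>h. ((f (t + h) - f t) - h *\<^sub>R D) /\<^sub>R \<bar>h\<bar> + D = (f (t + h) - f t) /\<^sub>R h) (at_right 0)"
    using eventually_at_right_less[of 0] by eventually_elim (simp add: scaleR_diff_right)
  ultimately show ?thesis by (auto intro: Lim_transform_eventually)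
qed

section \<open>Contraction semigroups and their bounded perturbations\<close>

text \<open>
  The operators act on an ambient Banach space and the semigroup laws are required only on the closed
  subspace \<open>B\<close>: later \<open>B\<close> is \<open>C\<^sub>0\<close> inside the space of bounded continuous functions, where the
  averages are defined and contractive but not strongly continuous.
\<close>

locale contraction_semigroup =
  fixes B :: "'b::banach set" and T :: "real \<Rightarrow> 'b \<Rightarrow> 'b"
  assumes closed_B: "closed B" and subspace_B: "subspace B"
    and lin: "\<And>t. t \<ge> 0 \<Longrightarrow> linear (T t)"
    and contr: "\<And>t f. t \<ge> 0 \<Longrightarrow> norm (T t f) \<le> norm f"
    and inv: "\<And>t f. t \<ge> 0 \<Longrightarrow> f \<in> B \<Longrightarrow> T t f \<in> B"
    and zero: "\<And>f. f \<in> B \<Longrightarrow> T 0 f = f"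
    and add: "\<And>s t f. s \<ge> 0 \<Longrightarrow> t \<ge> 0 \<Longrightarrow> f \<in> B \<Longrightarrow> T (s + t) f = T s (T t f)"
    and cont0: "\<And>f. f \<in> B \<Longrightarrow> ((\<lambda>t. T t f) \<longlongrightarrow> f) (at_right 0)"
begin

lemma bounded_linear_T: "t \<ge> 0 \<Longrightarrow> bounded_linear (T t)"
  using contr by (intro bounded_linear.intro bounded_linear_axioms.intro lin) (auto intro!: exI[of _ 1])

lemma T_diff: "t \<ge> 0 \<Longrightarrow> T t (f - g) = T t f - T t g"
  using lin linear_diff by blast

text \<open>
  Factoring out the operator at the smaller time reduces continuity of an orbit, from both sides, to
  continuity at \<open>0\<close>.
\<close>

lemma T_increment_bound:
  assumes "s \<ge> 0" "t \<ge> 0" "f \<in> B"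
  shows "norm (T s f - T t f) \<le> norm (T \<bar>s - t\<bar> f - f)"
proof -
  have *: "norm (T s f - T t f) \<le> norm (T (s - t) f - f)" if "t \<le> s" "0 \<le> t" for s t
  proof -
    have "T s f - T t f = T t (T (s - t) f - f)"
      using add[of t "s - t" f] that assms by (simp add: T_diff)
    then show ?thesis using contr that by simp
  qed
  show ?thesis
    using *[of s t] *[of t s] assms by (cases "t \<le> s") (auto simp: norm_minus_commute abs_if)
qed

lemma continuous_on_T: "continuous_on ({0..} \<times> B) (\<lambda>(t, f). T t f)"
  unfolding continuous_on_iff
proof (clarsimp)
  fix t e :: real and f assume *: "0 \<le> t" "f \<in> B" "0 < e"
  have "eventually (\<lambda>h. dist (T h f) f < e / 2) (at_right 0)"
    using *(3) by (intro tendstoD[OF cont0[OF *(2)]]) simp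
  then obtain d where d: "d > 0" "\<And>h. 0 < h \<Longrightarrow> h < d \<Longrightarrow> dist (T h f) f < e / 2"
    by (auto simp: eventually_at_right_field)
  have "dist (T s g) (T t f) < e"
    if "0 \<le> s" "g \<in> B" "dist (s, g) (t, f) < min d (e / 2)" for s :: real and g
  proof -
    have s: "\<bar>s - t\<bar> < d" and g: "norm (g - f) < e / 2"
      using dist_fst_le[of "(s, g)" "(t, f)"] dist_snd_le[of "(s, g)" "(t, f)"] that(3)
      by (auto simp: dist_real_def dist_norm)
    have "norm (T s f - T t f) \<le> norm (T \<bar>s - t\<bar> f - f)"
      by (rule T_increment_bound) (use * that in auto)
    also have "\<dots> < e / 2"
      using d(2)[of "\<bar>s - t\<bar>"] s zero *(2,3) by (cases "s = t") (auto simp: dist_norm)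
    finally have "norm (T s f - T t f) < e / 2" .
    moreover have "norm (T s g - T s f) < e / 2"
      using contr[OF that(1), of "g - f"] g by (simp add: T_diff that)
    ultimately show ?thesis
      unfolding dist_norm using norm_triangle_ineq[of "T s g - T s f" "T s f - T t f"] by simp
  qed
  then show "\<exists>d>0. \<forall>s\<in>{0..}. \<forall>g\<in>B. dist (s, g) (t, f) < d \<longrightarrow> dist (T s g) (T t f) < e"
    using d(1) *(3) by (intro exI[of _ "min d (e / 2)"]) auto
qed

lemma continuous_on_T_compose:
  assumes "continuous_on X s" "continuous_on X g" "\<And>x. x \<in> X \<Longrightarrow> 0 \<le> s x" "\<And>x. x \<in> X \<Longrightarrow> g x \<in> B"
  shows "continuous_on X (\<lambda>x. T (s x) (g x))"
  using continuous_on_compose2[OF continuous_on_T continuous_on_Pair[OF assms(1,2)]] assms(3,4)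
  by auto

end

locale perturbed_semigroup = contraction_semigroup B T
  for B :: "'b::banach set" and T +
  fixes P :: "'b \<Rightarrow> 'b" and K :: real
  assumes lin_P: "linear P" and K_pos: "K > 0" and bound_P: "\<And>f. norm (P f) \<le> K * norm f"
    and inv_P: "\<And>f. f \<in> B \<Longrightarrow> P f \<in> B"
begin

lemma bounded_linear_P: "bounded_linear P"
  using bound_P by (intro bounded_linear.intro bounded_linear_axioms.intro lin_P) (auto intro!: exI[of _ K] simp: mult.commute)

lemmas continuous_on_P [continuous_intros] = bounded_linear.continuous_on[OF bounded_linear_P]

abbreviation duhamel :: "(real \<Rightarrow> 'b) \<Rightarrow> real \<Rightarrow> 'b" where
  "duhamel u t \<equiv> integral {0..t} (\<lambda>r. T (t - r) (P (u r)))"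

text \<open>
  A continuous solution of the integral equation, restricted to growth \<open>exp(2 K t)\<close>. With that weight
  the integral operator halves norms (\<open>duhamel_bound\<close>), so existence and uniqueness hold on the whole
  half line at once.
\<close>

definition mild :: "'b \<Rightarrow> (real \<Rightarrow> 'b) \<Rightarrow> bool" where
  "mild g u \<longleftrightarrow> continuous_on {0..} u \<and> (\<forall>t\<ge>0. u t \<in> B) \<and>
     (\<exists>C. \<forall>t\<ge>0. norm (u t) \<le> C * exp (2 * K * t)) \<and>
     (\<forall>t\<ge>0. u t = T t g + duhamel u t)"

lemma mild_integrand_continuous:
  assumes "continuous_on {0..} u" "\<And>r. r \<ge> 0 \<Longrightarrow> u r \<in> B"
  shows "continuous_on {0..t} (\<lambda>r. T (t - r) (P (u r)))"
  by (rule continuous_on_T_compose)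
    (auto intro!: continuous_intros continuous_on_subset[OF assms(1)] inv_P assms(2))

lemma duhamel_bound:
  assumes "continuous_on {0..} u" "\<And>r. r \<ge> 0 \<Longrightarrow> u r \<in> B" "\<And>r. r \<ge> 0 \<Longrightarrow> norm (u r) \<le> C * exp (2 * K * r)"
    and t: "t \<ge> 0"
  shows "norm (duhamel u t) \<le> C / 2 * exp (2 * K * t)"
proof -
  have C: "C \<ge> 0" using assms(3)[of 0] norm_ge_zero[of "u 0"] by (simp del: norm_ge_zero)
  have int: "(\<lambda>r. K * C * exp (2 * K * t) * exp (- (2 * K) * (t - r))) integrable_on {0..t}"
    using integrable_cmul[OF exp_kernel_integral(1)[of "2 * K" t], of "K * C * exp (2 * K * t)"] K_pos t by simp
  have "norm (duhamel u t) \<le>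
      integral {0..t} (\<lambda>r. K * C * exp (2 * K * t) * exp (- (2 * K) * (t - r)))"
  proof (rule integral_norm_bound_integral[OF _ int])
    show "(\<lambda>r. T (t - r) (P (u r))) integrable_on {0..t}"
      by (intro integrable_continuous_real mild_integrand_continuous assms)
    fix r assume r: "r \<in> {0..t}"
    have "norm (T (t - r) (P (u r))) \<le> norm (P (u r))" using contr r by simp
    also have "\<dots> \<le> K * (C * exp (2 * K * r))"
      using bound_P[of "u r"] assms(3)[of r] r K_pos by (smt (verit) atLeastAtMost_iff mult_left_mono)
    also have "\<dots> = K * C * exp (2 * K * t) * exp (- (2 * K) * (t - r))"
      by (simp add: exp_add[symmetric] algebra_simps)
    finally show "norm (T (t - r) (P (u r))) \<le> K * C * exp (2 * K * t) * exp (- (2 * K) * (t - r))" .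
  qed
  also have "\<dots> = K * C * exp (2 * K * t) * integral {0..t} (\<lambda>r. exp (- (2 * K) * (t - r)))"
    by simp
  also have "\<dots> \<le> K * C * exp (2 * K * t) * (1 / (2 * K))"
    using exp_kernel_integral(2)[of "2 * K" t] K_pos t C by (intro mult_left_mono) auto
  also have "\<dots> = C / 2 * exp (2 * K * t)" using K_pos by simp
  finally show ?thesis .
qed

lemma mildD:
  assumes "mild g u"
  shows "continuous_on {0..} u" "t \<ge> 0 \<Longrightarrow> u t \<in> B"
  using assms unfolding mild_def by blast+

lemmas mild_in_B = mildD(2)

lemma mild_eq: "mild g u \<Longrightarrow> t \<ge> 0 \<Longrightarrow> u t = T t g + duhamel u t"
  unfolding mild_def by blast

text \<open>
  A bound with constant \<open>C\<close> improves to one with constant \<open>norm g + C / 2\<close>; the iteration converges to the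
  fixed point \<open>2 norm g\<close>, whatever constant it started from. Applied to differences this is uniqueness.
\<close>

lemma mild_bound:
  assumes "mild g u" "t \<ge> 0"
  shows "norm (u t) \<le> 2 * norm g * exp (2 * K * t)"
proof -
  obtain C where C: "\<And>t. t \<ge> 0 \<Longrightarrow> norm (u t) \<le> C * exp (2 * K * t)"
    using assms(1) unfolding mild_def by blast
  have iter: "\<forall>t\<ge>0. norm (u t) \<le> (2 * norm g + C / 2 ^ n) * exp (2 * K * t)" for n
  proof (induction n)
    case 0
    have "C * exp (2 * K * t) \<le> (2 * norm g + C) * exp (2 * K * t)" for t
      by (intro mult_right_mono) auto
    then show ?case using C order_trans by fastforce
  next
    case (Suc n)
    show ?case
    proof (intro allI impI)
      fix t :: real assume t: "t \<ge> 0"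
      have "norm (u t) \<le> norm (T t g) + norm (duhamel u t)"
        using mild_eq[OF assms(1) t] norm_triangle_ineq by metis
      also have "\<dots> \<le> norm g * exp (2 * K * t) + (2 * norm g + C / 2 ^ n) / 2 * exp (2 * K * t)"
      proof (intro add_mono duhamel_bound)
        have "norm (T t g) \<le> norm g * 1" using contr t by simp
        also have "\<dots> \<le> norm g * exp (2 * K * t)" using t K_pos by (intro mult_left_mono) auto
        finally show "norm (T t g) \<le> norm g * exp (2 * K * t)" .
      qed (use assms(1) Suc t in \<open>simp_all add: mildD\<close>)
      also have "\<dots> = (2 * norm g + C / 2 ^ Suc n) * exp (2 * K * t)"
        by (simp add: field_simps)
      finally show "norm (u t) \<le> (2 * norm g + C / 2 ^ Suc n) * exp (2 * K * t)" .
    qed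
  qed
  have "(\<lambda>n. C * (1 / 2) ^ n) \<longlonglongrightarrow> C * 0"
    by (intro tendsto_intros LIMSEQ_power_zero) auto
  then have "(\<lambda>n. (2 * norm g + C / 2 ^ n) * exp (2 * K * t)) \<longlonglongrightarrow> (2 * norm g + 0) * exp (2 * K * t)"
    by (intro tendsto_intros) (simp add: power_divide)
  then show ?thesis
    using iter assms(2) by (intro LIMSEQ_le_const[where X = "\<lambda>n. (2 * norm g + C / 2 ^ n) * exp (2 * K * t)"]) auto
qed

lemma mild_integrable:
  "mild g u \<Longrightarrow> (\<lambda>r. T (t - r) (P (u r))) integrable_on {0..t}"
  by (intro integrable_continuous_real mild_integrand_continuous) (auto simp: mildD)

lemma mild_lincomb:
  assumes "mild g u" "mild h v"
  shows "mild (a *\<^sub>R g + b *\<^sub>R h) (\<lambda>t. a *\<^sub>R u t + b *\<^sub>R v t)"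
  unfolding mild_def
proof (intro conjI allI impI)
  show "continuous_on {0..} (\<lambda>t. a *\<^sub>R u t + b *\<^sub>R v t)"
    using assms by (intro continuous_intros mildD)
  show "a *\<^sub>R u t + b *\<^sub>R v t \<in> B" if "t \<ge> 0" for t
    using assms that by (auto intro!: mildD subspace_add[OF subspace_B] subspace_scale[OF subspace_B])
  have "norm (a *\<^sub>R u t + b *\<^sub>R v t) \<le> (\<bar>a\<bar> * (2 * norm g) + \<bar>b\<bar> * (2 * norm h)) * exp (2 * K * t)" if "t \<ge> 0" for t
  proof -
    have "norm (a *\<^sub>R u t + b *\<^sub>R v t) \<le> \<bar>a\<bar> * norm (u t) + \<bar>b\<bar> * norm (v t)"
      using norm_triangle_ineq[of "a *\<^sub>R u t" "b *\<^sub>R v t"] by simp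
    also have "\<dots> \<le> \<bar>a\<bar> * (2 * norm g * exp (2 * K * t)) + \<bar>b\<bar> * (2 * norm h * exp (2 * K * t))"
      using that assms by (intro add_mono mult_left_mono mild_bound) auto
    finally show ?thesis by (simp add: algebra_simps)
  qed
  then show "\<exists>C. \<forall>t\<ge>0. norm (a *\<^sub>R u t + b *\<^sub>R v t) \<le> C * exp (2 * K * t)" by blast
  fix t :: real assume t: "t \<ge> 0"
  have "integral {0..t} (\<lambda>r. T (t - r) (P (a *\<^sub>R u r + b *\<^sub>R v r))) =
      integral {0..t} (\<lambda>r. a *\<^sub>R T (t - r) (P (u r)) + b *\<^sub>R T (t - r) (P (v r)))"
    by (intro integral_cong) (simp add: linear_add[OF lin_P] linear_scale[OF lin_P] linear_add[OF lin] linear_scale[OF lin])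
  also have "\<dots> = a *\<^sub>R duhamel u t + b *\<^sub>R duhamel v t"
    using assms by (subst integral_add) (auto intro!: integrable_cmul mild_integrable)
  finally show "a *\<^sub>R u t + b *\<^sub>R v t = T t (a *\<^sub>R g + b *\<^sub>R h) + integral {0..t} (\<lambda>r. T (t - r) (P (a *\<^sub>R u r + b *\<^sub>R v r)))"
    by (simp add: mild_eq[OF assms(1) t] mild_eq[OF assms(2) t] linear_add[OF lin[OF t]] linear_scale[OF lin[OF t]] algebra_simps)
qed

lemma mild_unique:
  assumes "mild g u" "mild g v" "t \<ge> 0"
  shows "u t = v t"
  using mild_bound[OF mild_lincomb[OF assms(1,2), of 1 "-1"] assms(3)] by simp

lemma mild_shift:
  assumes m: "mild g u" and h: "h \<ge> 0" and g: "g \<in> B"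
  shows "mild (u h) (\<lambda>t. u (t + h))"
  unfolding mild_def
proof (intro conjI allI impI)
  show "continuous_on {0..} (\<lambda>t. u (t + h))"
    by (rule continuous_on_compose2[OF mildD(1)[OF m]]) (use h in \<open>auto intro!: continuous_intros\<close>)
  show "u (t + h) \<in> B" if "t \<ge> 0" for t using mild_in_B[OF m] that h by simp
  have "norm (u (t + h)) \<le> (2 * norm g * exp (2 * K * h)) * exp (2 * K * t)" if "t \<ge> 0" for t
    using mild_bound[OF m, of "t + h"] that h by (simp add: exp_add[symmetric] algebra_simps)
  then show "\<exists>C. \<forall>t\<ge>0. norm (u (t + h)) \<le> C * exp (2 * K * t)" by blast
  fix t :: real assume t: "t \<ge> 0"
  let ?f = "\<lambda>r. T (t + h - r) (P (u r))"
  have "u (t + h) = T (t + h) g + integral {0..t + h} ?f"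
    using t h by (intro mild_eq[OF m]) auto
  also have "integral {0..t + h} ?f = integral {0..h} ?f + integral {h..t + h} ?f"
    using t h mild_integrable[OF m] by (intro Henstock_Kurzweil_Integration.integral_combine[symmetric]) auto
  also have "integral {0..h} ?f = integral {0..h} (T t \<circ> (\<lambda>r. T (h - r) (P (u r))))"
  proof (rule integral_cong)
    fix r assume "r \<in> {0..h}"
    then show "?f r = (T t \<circ> (\<lambda>r. T (h - r) (P (u r)))) r"
      using add[of t "h - r" "P (u r)"] t mild_in_B[OF m] inv_P by (simp add: add_diff_eq)
  qed
  also have "\<dots> = T t (duhamel u h)"
    by (rule integral_linear[OF mild_integrable[OF m] bounded_linear_T[OF t]])
  also have "integral {h..t + h} ?f = integral {0..t} (\<lambda>r. T (t - r) (P (u (r + h))))"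
    using integral_shift_Icc_real[of 0 t ?f h] by (simp add: add.commute o_def)
  also have "T (t + h) g = T t (T h g)" using add t h g by simp
  finally show "u (t + h) = T t (u h) + integral {0..t} (\<lambda>r. T (t - r) (P (u (r + h))))"
    by (simp add: mild_eq[OF m h] linear_add[OF lin[OF t]])
qed

text \<open>
  Banach's fixed point theorem for \<open>y(t) = exp(- 2 K t) u(t)\<close> among bounded continuous \<open>B\<close>-valued
  functions on the real line, with negative times clamped to \<open>0\<close>.
\<close>

lemma mild_exists:
  assumes g: "g \<in> B"
  shows "\<exists>u. mild g u"
proof -
  define l where "l = 2 * K"
  have l: "l > 0" using K_pos by (simp add: l_def)
  \<comment> \<open>Clamping extends functions on the half line to the real line, the domain of \<open>real \<Rightarrow>\<^sub>C 'b\<close>.\<close>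
  define cl where "cl = (\<lambda>t::real. max 0 t)"
  have cl: "cl t \<ge> 0" "t \<ge> 0 \<Longrightarrow> cl t = t" for t by (auto simp: cl_def)
  define w where "w = (\<lambda>(y :: real \<Rightarrow>\<^sub>C 'b) r. exp (l * r) *\<^sub>R apply_bcontfun y r)"
  define \<Phi> where "\<Phi> = (\<lambda>(y :: real \<Rightarrow>\<^sub>C 'b) t. exp (- l * cl t) *\<^sub>R (T (cl t) g +
      duhamel (w y) (cl t)))"
  define Y where "Y = {y :: real \<Rightarrow>\<^sub>C 'b. \<forall>t. apply_bcontfun y t \<in> B}"
  have Y_eq: "Y = PiC UNIV (\<lambda>_. B)" by (fastforce simp: Y_def mem_PiC_iff Pi_iff)
  have w_cont: "continuous_on X (w y)" for X y
    unfolding w_def by (intro continuous_intros) auto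
  have w_B: "w y r \<in> B" if "y \<in> Y" for y r
    using that by (auto simp: w_def Y_def intro: subspace_scale[OF subspace_B])
  have w_bound: "norm (w y r) \<le> norm y * exp (2 * K * r)" for y r
    using norm_bounded[of y r] by (simp add: w_def l_def mult.commute)
  have duh_cont: "continuous_on UNIV (\<lambda>t. duhamel (w y) (cl t))" if y: "y \<in> Y" for y
  proof -
    have eq: "duhamel (w y) (cl t) =
        cl t *\<^sub>R integral {0..1} (\<lambda>\<theta>. T (cl t - cl t * \<theta>) (P (w y (cl t * \<theta>))))" for t
      by (rule integral_rescale01[symmetric])
        (auto simp: cl intro!: continuous_on_T_compose continuous_intros w_cont w_B y inv_P)
    have "continuous_on (UNIV \<times> cbox (0::real) 1) (\<lambda>(t, \<theta>). T (cl t - cl t * \<theta>) (P (w y (cl t * \<theta>))))"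
      unfolding case_prod_beta cl_def
      by (intro continuous_on_T_compose continuous_on_P continuous_on_compose2[OF w_cont[of UNIV]] continuous_intros)
        (auto intro!: w_B y inv_P mult_left_le)
    from integral_continuous_on_param[OF this] show ?thesis
      unfolding eq by (auto simp: cl_def cbox_interval intro!: continuous_intros)
  qed
  have \<Phi>_cont: "continuous_on UNIV (\<Phi> y)" if y: "y \<in> Y" for y
    unfolding \<Phi>_def
    by (intro continuous_intros duh_cont y continuous_on_T_compose) (auto simp: cl_def g intro!: continuous_intros)
  have contraction: "norm (duhamel (w y) (cl t)) \<le> norm y / 2 * exp (l * cl t)"
    if "y \<in> Y" for y t
    using duhamel_bound[OF w_cont w_B w_bound cl(1), OF that] by (simp add: l_def)
  have \<Phi>_bound: "norm (\<Phi> y t) \<le> norm g + norm y / 2" if y: "y \<in> Y" for y t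
  proof -
    have "norm (T (cl t) g + duhamel (w y) (cl t)) \<le> norm g + norm y / 2 * exp (l * cl t)"
      using contraction[OF y, of t] contr[OF cl(1), of t g] norm_triangle_ineq by (smt (verit))
    also have "\<dots> \<le> (norm g + norm y / 2) * exp (l * cl t)"
    proof -
      have "1 \<le> exp (l * cl t)" using l cl by simp
      then have "norm g * 1 \<le> norm g * exp (l * cl t)" by (intro mult_left_mono) auto
      then show ?thesis by (simp add: algebra_simps)
    qed
    finally show ?thesis by (simp add: \<Phi>_def exp_minus divide_simps mult.commute)
  qed
  have \<Phi>_bcont: "\<Phi> y \<in> bcontfun" if "y \<in> Y" for y
    by (rule bcontfun_normI[OF \<Phi>_cont \<Phi>_bound]) (use that in auto)
  have app: "apply_bcontfun (Bcontfun (\<Phi> y)) = \<Phi> y" if "y \<in> Y" for y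
    using \<Phi>_bcont[OF that] by (rule Bcontfun_inverse)
  have \<Phi>_B: "\<Phi> y t \<in> B" if y: "y \<in> Y" for y t
    unfolding \<Phi>_def
  proof (intro subspace_scale[OF subspace_B] subspace_add[OF subspace_B] inv g cl
      integral_in_closed_subspace closed_B subspace_B)
    show "(\<lambda>r. T (cl t - r) (P (w y r))) integrable_on {0..cl t}"
      by (intro integrable_continuous_real mild_integrand_continuous w_cont w_B y)
  qed (auto intro: inv_P w_B y)
  have "\<exists>!y. y \<in> Y \<and> Bcontfun (\<Phi> y) = y"
  proof (rule Banach_fix)
    show "Topological_Spaces.complete Y" unfolding Y_eq complete_eq_closed by (rule closed_PiC) (rule closed_B)
    show "Y \<noteq> {}" using subspace_0[OF subspace_B] by (auto simp: Y_def intro!: exI[of _ 0])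
    show "(\<lambda>y. Bcontfun (\<Phi> y)) ` Y \<subseteq> Y"
      unfolding Y_def using \<Phi>_B app by (auto simp: Y_def)
    show "(0::real) \<le> 1/2" "(1/2::real) < 1" by auto
    fix y z assume yz: "y \<in> Y" "z \<in> Y"
    have yzY: "y - z \<in> Y" using yz by (auto simp: Y_def intro: subspace_diff[OF subspace_B])
    have "norm (\<Phi> y t - \<Phi> z t) \<le> norm (y - z) / 2" for t
    proof -
      have "duhamel (w y) (cl t) - duhamel (w z) (cl t) =
          integral {0..cl t} (\<lambda>r. T (cl t - r) (P (w y r)) - T (cl t - r) (P (w z r)))"
        by (intro integral_diff[symmetric] integrable_continuous_real mild_integrand_continuous w_cont w_B yz)
      also have "\<dots> = duhamel (w (y - z)) (cl t)"
        by (intro integral_cong) (simp add: w_def T_diff[symmetric] linear_diff[OF lin_P, symmetric] scaleR_diff_right)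
      finally have "\<Phi> y t - \<Phi> z t = exp (- l * cl t) *\<^sub>R duhamel (w (y - z)) (cl t)"
        unfolding \<Phi>_def by (simp add: scaleR_diff_right[symmetric])
      then show ?thesis
        using contraction[OF yzY, of t] by (simp add: exp_minus divide_simps mult.commute)
    qed
    then show "dist (Bcontfun (\<Phi> y)) (Bcontfun (\<Phi> z)) \<le> 1 / 2 * dist y z"
      by (intro dist_bound) (simp add: app yz dist_norm)
  qed
  then obtain y where y: "y \<in> Y" "Bcontfun (\<Phi> y) = y" by blast
  then have fixpoint: "apply_bcontfun y = \<Phi> y" using app by metis
  have "mild g (w y)"
    unfolding mild_def
  proof (intro conjI allI impI)
    show "\<exists>C. \<forall>t\<ge>0. norm (w y t) \<le> C * exp (2 * K * t)" using w_bound by blast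
    fix t :: real assume t: "t \<ge> 0"
    have "w y t = exp (l * t) *\<^sub>R \<Phi> y t" using fixpoint by (simp add: w_def)
    then show "w y t = T t g + integral {0..t} (\<lambda>r. T (t - r) (P (w y r)))"
      using t by (simp add: \<Phi>_def cl exp_minus)
  qed (use w_cont w_B y in auto)
  then show ?thesis by blast
qed


definition perturbed :: "real \<Rightarrow> 'b \<Rightarrow> 'b" where
  "perturbed t g = (SOME u. mild g u) t"

lemma mild_perturbed: "g \<in> B \<Longrightarrow> mild g (\<lambda>t. perturbed t g)"
  using someI_ex[OF mild_exists] by (simp add: perturbed_def)

lemma perturbed_in_B: "g \<in> B \<Longrightarrow> t \<ge> 0 \<Longrightarrow> perturbed t g \<in> B"
  using mild_in_B[OF mild_perturbed] by simp

lemma perturbed_bound: "g \<in> B \<Longrightarrow> t \<ge> 0 \<Longrightarrow> norm (perturbed t g) \<le> 2 * norm g * exp (2 * K * t)"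
  using mild_bound[OF mild_perturbed] by simp

lemma continuous_on_perturbed: "g \<in> B \<Longrightarrow> continuous_on {0..} (\<lambda>t. perturbed t g)"
  using mildD(1)[OF mild_perturbed] .

lemma perturbed_0: "g \<in> B \<Longrightarrow> perturbed 0 g = g"
  using mild_eq[OF mild_perturbed, of g 0] zero by simp

lemma perturbed_add:
  assumes "g \<in> B" "s \<ge> 0" "t \<ge> 0"
  shows "perturbed (s + t) g = perturbed s (perturbed t g)"
  using mild_unique[OF mild_shift[OF mild_perturbed] mild_perturbed[OF perturbed_in_B]] assms by simp

lemma perturbed_lincomb:
  assumes "g \<in> B" "h \<in> B" "t \<ge> 0"
  shows "perturbed t (a *\<^sub>R g + b *\<^sub>R h) = a *\<^sub>R perturbed t g + b *\<^sub>R perturbed t h"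
  using mild_unique[OF mild_perturbed mild_lincomb[OF mild_perturbed mild_perturbed]] assms
  by (simp add: subspace_add[OF subspace_B] subspace_scale[OF subspace_B])

text \<open>
  By the integral equation started at time \<open>t\<close>, the error is the integral over \<open>[0, \<tau>]\<close> of
  \<open>T(\<tau> - r) P u(t + r) - P u(t)\<close>, and \<open>(s, t) \<mapsto> T(s) P u(t)\<close> is uniformly continuous on compact sets.
  The uniformity in \<open>t\<close> is what the product formula uses.
\<close>

lemma perturbed_step:
  assumes g: "g \<in> B" and N: "N \<ge> 0" and e: "e > 0"
  shows "eventually (\<lambda>\<tau>. \<forall>t\<in>{0..N}.
    norm (perturbed (t + \<tau>) g - T \<tau> (perturbed t g) - \<tau> *\<^sub>R P (perturbed t g)) \<le> e * \<tau>) (at_right 0)"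
proof -
  define u where "u = (\<lambda>t. perturbed t g)"
  define Q where "Q = (\<lambda>(s, t). T s (P (u t)))"
  have m: "mild g u" unfolding u_def by (rule mild_perturbed[OF g])
  have "continuous_on ({0..1} \<times> {0..N + 1}) Q"
    unfolding Q_def case_prod_beta
    by (intro continuous_on_T_compose continuous_on_P continuous_on_compose2[OF mildD(1)[OF m]] continuous_intros)
      (auto intro!: inv_P mildD(2)[OF m])
  then have "uniformly_continuous_on ({0..1} \<times> {0..N + 1}) Q"
    by (rule compact_uniformly_continuous) (intro compact_Times compact_Icc)
  then obtain d where d: "d > 0" and dQ: "\<And>x y. x \<in> {0..1} \<times> {0..N + 1} \<Longrightarrow> y \<in> {0..1} \<times> {0..N + 1} \<Longrightarrow>
      dist y x < d \<Longrightarrow> dist (Q y) (Q x) < e"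
    using e unfolding uniformly_continuous_on_def by metis
  show ?thesis
    unfolding eventually_at_right_field
  proof (intro exI[of _ "min 1 (d / 2)"] conjI allI impI ballI)
    show "0 < min 1 (d / 2)" using d by simp
    fix \<tau> t :: real assume \<tau>: "0 < \<tau>" "\<tau> < min 1 (d / 2)" and t: "t \<in> {0..N}"
    have close: "norm (T (\<tau> - r) (P (u (r + t))) - P (u t)) \<le> e" if r: "r \<in> {0..\<tau>}" for r
    proof -
      have "dist (\<tau> - r, r + t) (0, t) \<le> \<bar>\<tau> - r\<bar> + \<bar>r\<bar>"
        using sqrt_sum_squares_le_sum_abs[of "\<tau> - r" r] by (simp add: dist_Pair_Pair dist_real_def)
      also have "\<dots> < d" using r \<tau> by auto
      finally have "dist (Q (\<tau> - r, r + t)) (Q (0, t)) < e"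
        using r \<tau> t by (intro dQ) auto
      then show ?thesis using t by (simp add: Q_def dist_norm zero inv_P mildD(2)[OF m])
    qed
    have m': "mild (u t) (\<lambda>s. u (s + t))" using mild_shift[OF m _ g] t by simp
    have int: "(\<lambda>r. T (\<tau> - r) (P (u (r + t)))) integrable_on {0..\<tau>}"
      by (rule mild_integrable[OF m'])
    have "u (t + \<tau>) - T \<tau> (u t) - \<tau> *\<^sub>R P (u t) =
        integral {0..\<tau>} (\<lambda>r. T (\<tau> - r) (P (u (r + t)))) - integral {0..\<tau>} (\<lambda>r. P (u t))"
      using mild_eq[OF m', of \<tau>] \<tau> by (simp add: add.commute)
    also have "\<dots> = integral {0..\<tau>} (\<lambda>r. T (\<tau> - r) (P (u (r + t))) - P (u t))"
      by (intro integral_diff[symmetric] int integrable_const_ivl)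
    also have "norm \<dots> \<le> integral {0..\<tau>} (\<lambda>r. e)"
      by (intro integral_norm_bound_integral integrable_diff int integrable_const_ivl close)
    finally show "norm (perturbed (t + \<tau>) g - T \<tau> (perturbed t g) - \<tau> *\<^sub>R P (perturbed t g)) \<le> e * \<tau>"
      using \<tau> by (simp add: u_def mult.commute)
  qed
qed

text \<open>
  Consequently both semigroups have the same generator domain and their generators differ by \<open>P\<close>.
\<close>

lemma perturbation_quotient:
  assumes g: "g \<in> B"
  shows "((\<lambda>h. (perturbed h g - g) /\<^sub>R h - (T h g - g) /\<^sub>R h) \<longlongrightarrow> P g) (at_right 0)"
  unfolding tendsto_iff
proof (intro allI impI)
  fix e :: real assume "e > 0"
  then have "e / 2 > 0" by simp
  from perturbed_step[OF g order_refl this]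
  show "eventually (\<lambda>h. dist ((perturbed h g - g) /\<^sub>R h - (T h g - g) /\<^sub>R h) (P g) < e) (at_right 0)"
    using eventually_at_right_less[of 0]
  proof eventually_elim
    case (elim h)
    have "(perturbed h g - g) /\<^sub>R h - (T h g - g) /\<^sub>R h - P g = (perturbed h g - T h g - h *\<^sub>R P g) /\<^sub>R h"
      using elim(2) by (simp add: scaleR_diff_right)
    also have "norm \<dots> \<le> e / 2"
      using elim by (simp add: perturbed_0 g divide_simps mult.commute)
    finally show ?case using \<open>e > 0\<close> by (simp add: dist_norm)
  qed
qed

lemma generator_eqI:
  assumes "((\<lambda>h. (T h f - f) /\<^sub>R h) \<longlongrightarrow> a) (at_right 0)"
  shows "generator T f = a"
  unfolding generator_def by (rule tendsto_Lim[OF _ assms]) simp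

lemma generator_domain_perturbedI:
  assumes f: "f \<in> B" and b: "b \<in> B" and lim: "((\<lambda>h. (perturbed h f - f) /\<^sub>R h) \<longlongrightarrow> b) (at_right 0)"
  shows "f \<in> generator_domain B T" "generator T f + P f = b"
proof -
  have *: "((\<lambda>h. (T h f - f) /\<^sub>R h) \<longlongrightarrow> b - P f) (at_right 0)"
    using tendsto_diff[OF lim perturbation_quotient[OF f]] by simp
  have "b - P f \<in> B" using f b by (intro subspace_diff[OF subspace_B] inv_P)
  then show "f \<in> generator_domain B T" using * f by (auto simp: generator_domain_def)
  show "generator T f + P f = b" using generator_eqI[OF *] by simp
qed

lemma generator_limit:
  assumes "f \<in> generator_domain B T"
  shows "f \<in> B" "generator T f \<in> B" "((\<lambda>h. (T h f - f) /\<^sub>R h) \<longlongrightarrow> generator T f) (at_right 0)"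
  using assms generator_eqI[of f] by (auto simp: generator_domain_def)

text \<open>
  For \<open>m = min s t\<close> and \<open>h = \<bar>s - t\<bar>\<close> the semigroup law turns the increment of the orbit between \<open>s\<close> and \<open>t\<close>
  into the image, under the operator at time \<open>m\<close>, of the increment over \<open>[0, h]\<close>. So left and right
  difference quotients are handled together.
\<close>

lemma perturbed_orbit_derivative:
  assumes f: "f \<in> B" and b: "b \<in> B" and lim: "((\<lambda>h. (perturbed h f - f) /\<^sub>R h) \<longlongrightarrow> b) (at_right 0)"
    and t: "t \<ge> 0"
  shows "((\<lambda>t. perturbed t f) has_vector_derivative perturbed t b) (at t within {0..})"
  unfolding has_vector_derivative_def has_derivative_within_alt
proof (intro conjI allI impI bounded_linear_scaleR_left)
  fix e :: real assume e: "e > 0"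
  define C where "C = 2 * exp (2 * K * (t + 1))"
  have C: "C > 0" by (simp add: C_def)
  have "eventually (\<lambda>h. dist ((perturbed h f - f) /\<^sub>R h) b < e / (2 * C)) (at_right 0)"
    using tendstoD[OF lim] e C by simp
  then obtain d1 where d1: "d1 > 0" "\<And>h. 0 < h \<Longrightarrow> h < d1 \<Longrightarrow> dist ((perturbed h f - f) /\<^sub>R h) b < e / (2 * C)"
    by (auto simp: eventually_at_right_field)
  have "e / 2 > 0" using e by simp
  then obtain d2 where d2: "d2 > 0" "\<And>s. s \<ge> 0 \<Longrightarrow> dist s t < d2 \<Longrightarrow> dist (perturbed s b) (perturbed t b) < e / 2"
    using continuous_on_perturbed[OF b] t unfolding continuous_on_iff by (metis atLeast_iff)
  show "\<exists>d>0. \<forall>s\<in>{0..}. norm (s - t) < d \<longrightarrow>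
      norm (perturbed s f - perturbed t f - (s - t) *\<^sub>R perturbed t b) \<le> e * norm (s - t)"
  proof (intro exI[of _ "min 1 (min d1 d2)"] conjI ballI impI)
    show "0 < min 1 (min d1 d2)" using d1 d2 by simp
    fix s :: real assume "s \<in> {0..}" and st: "norm (s - t) < min 1 (min d1 d2)"
    then have s: "s \<ge> 0" by simp
    define m h where "m = min s t" and "h = \<bar>s - t\<bar>"
    have m: "m \<ge> 0" "m \<le> t + 1" and h: "h \<ge> 0" "h < d1" using s t st by (auto simp: m_def h_def)
    define R where "R = perturbed h f - f - h *\<^sub>R b"
    have RB: "R \<in> B"
      unfolding R_def by (intro subspace_diff[OF subspace_B] subspace_scale[OF subspace_B] perturbed_in_B f b h)
    have R: "norm R \<le> e / (2 * C) * h"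
    proof (cases "h = 0")
      case False
      then have "h > 0" using h by simp
      have "R = h *\<^sub>R ((perturbed h f - f) /\<^sub>R h - b)" using \<open>h > 0\<close> by (simp add: R_def scaleR_diff_right)
      then have "norm R = h * norm ((perturbed h f - f) /\<^sub>R h - b)" using h by simp
      then show ?thesis
        using mult_left_mono[OF less_imp_le[OF d1(2)[OF \<open>h > 0\<close> h(2), unfolded dist_norm]], of h] h
        by (simp add: mult.commute)
    qed (simp add: R_def perturbed_0 f)
    have "perturbed (m + h) f = perturbed m (perturbed h f)" using perturbed_add f m h by simp
    also have "perturbed h f = f + (h *\<^sub>R b + R)" by (simp add: R_def)
    also have "perturbed m \<dots> = perturbed m f + h *\<^sub>R perturbed m b + perturbed m R"
    proof -
      have "h *\<^sub>R b + R \<in> B" using RB b by (intro subspace_add[OF subspace_B] subspace_scale[OF subspace_B])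
      then show ?thesis
        using perturbed_lincomb[OF f _ m(1), of "h *\<^sub>R b + R" 1 1] perturbed_lincomb[OF b RB m(1), of h 1] by simp
    qed
    finally have step: "perturbed (m + h) f - perturbed m f - h *\<^sub>R perturbed t b =
        h *\<^sub>R (perturbed m b - perturbed t b) + perturbed m R" by (simp add: scaleR_diff_right)
    have "norm (perturbed m R) \<le> 2 * norm R * exp (2 * K * m)" by (rule perturbed_bound[OF RB m(1)])
    also have "\<dots> \<le> 2 * norm R * exp (2 * K * (t + 1))" using m K_pos by (intro mult_left_mono) auto
    also have "\<dots> = C * norm R" by (simp add: C_def)
    also have "\<dots> \<le> C * (e / (2 * C) * h)" using R C by (intro mult_left_mono) auto
    also have "\<dots> = e / 2 * h" using C by simp
    finally have r1: "norm (perturbed m R) \<le> e / 2 * h" .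
    have "dist (perturbed m b) (perturbed t b) < e / 2"
    proof (rule d2(2)[OF m(1)])
      have "dist m t \<le> \<bar>s - t\<bar>" by (simp add: m_def dist_real_def min_def)
      also have "\<dots> < d2" using st by simp
      finally show "dist m t < d2" .
    qed
    then have r2: "norm (h *\<^sub>R (perturbed m b - perturbed t b)) \<le> e / 2 * h"
      using h mult_left_mono[of "norm (perturbed m b - perturbed t b)" "e / 2" h] by (simp add: dist_norm mult.commute)
    have "norm (perturbed (m + h) f - perturbed m f - h *\<^sub>R perturbed t b) \<le> e * h"
      unfolding step using norm_triangle_le[OF add_mono[OF r2 r1]] by simp
    moreover have "norm (perturbed s f - perturbed t f - (s - t) *\<^sub>R perturbed t b) =
        norm (perturbed (m + h) f - perturbed m f - h *\<^sub>R perturbed t b)"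
    proof (cases "t \<le> s")
      case True then show ?thesis by (simp add: m_def h_def min_def)
    next
      case False
      have "perturbed s f - perturbed t f - (s - t) *\<^sub>R perturbed t b =
        - (perturbed t f - perturbed s f - (t - s) *\<^sub>R perturbed t b)" by (simp add: algebra_simps)
      then have "norm (perturbed s f - perturbed t f - (s - t) *\<^sub>R perturbed t b) =
        norm (perturbed t f - perturbed s f - (t - s) *\<^sub>R perturbed t b)" by (metis norm_minus_cancel)
      then show ?thesis using False by (simp add: m_def h_def min_def)
    qed
    ultimately show "norm (perturbed s f - perturbed t f - (s - t) *\<^sub>R perturbed t b) \<le> e * norm (s - t)"
      by (simp add: h_def)
  qed
qed

abbreviation solves_cauchy_problem :: "'b \<Rightarrow> (real \<Rightarrow> 'b) \<Rightarrow> bool" where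
  "solves_cauchy_problem \<equiv> classical_solution (generator_domain B T) (\<lambda>f. generator T f + P f)"

theorem perturbed_classical_solution:
  assumes f: "f \<in> generator_domain B T"
  shows "solves_cauchy_problem f (\<lambda>t. perturbed t f)"
proof -
  define b where "b = generator T f + P f"
  note fB = generator_limit[OF f]
  have b: "b \<in> B" unfolding b_def by (intro subspace_add[OF subspace_B] fB inv_P)
  have lim: "((\<lambda>h. (perturbed h f - f) /\<^sub>R h) \<longlongrightarrow> b) (at_right 0)"
    using tendsto_add[OF fB(3) perturbation_quotient[OF fB(1)]] by (simp add: b_def)
  have *: "perturbed t f \<in> generator_domain B T" "generator T (perturbed t f) + P (perturbed t f) = perturbed t b"
    if t: "t \<ge> 0" for t
  proof -
    have "((\<lambda>h. (perturbed (t + h) f - perturbed t f) /\<^sub>R h) \<longlongrightarrow> perturbed t b) (at_right 0)"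
      by (rule right_difference_quotient[OF perturbed_orbit_derivative[OF fB(1) b lim t] t])
    moreover have "eventually (\<lambda>h. (perturbed (t + h) f - perturbed t f) /\<^sub>R h = (perturbed h (perturbed t f) - perturbed t f) /\<^sub>R h) (at_right 0)"
      using eventually_at_right_less[of 0] by eventually_elim (use perturbed_add[OF fB(1) _ t] in \<open>auto simp: add.commute\<close>)
    ultimately have "((\<lambda>h. (perturbed h (perturbed t f) - perturbed t f) /\<^sub>R h) \<longlongrightarrow> perturbed t b) (at_right 0)"
      by (rule Lim_transform_eventually)
    from generator_domain_perturbedI[OF _ _ this]
    show "perturbed t f \<in> generator_domain B T" "generator T (perturbed t f) + P (perturbed t f) = perturbed t b"
      using fB b t by (auto intro: perturbed_in_B)
  qed
  have "continuous_on {0..} (\<lambda>t. generator T (perturbed t f) + P (perturbed t f))"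
    using continuous_on_perturbed[OF b] *(2) by (subst continuous_on_cong[OF refl]) auto
  then show ?thesis
    unfolding classical_solution_def
    using * perturbed_0[OF fB(1)] perturbed_orbit_derivative[OF fB(1) b lim] by simp
qed


text \<open>
  Every classical solution satisfies \<open>v(t + h) = T(h) v(t) + h P v(t) + o(h)\<close>. As \<open>T(h)\<close> is a
  contraction, the norm of a difference \<open>w\<close> of two solutions grows at most at the rate \<open>K norm(w)\<close>, in the sense
  of right Dini derivatives, and it starts from \<open>0\<close>.
\<close>

theorem classical_solution_unique:
  assumes v: "solves_cauchy_problem f v"
    and w: "solves_cauchy_problem f w"
    and t: "t \<ge> 0"
  shows "v t = w t"
proof -
  have small: "((\<lambda>h. (v (t + h) - T h (v t)) /\<^sub>R h) \<longlongrightarrow> P (v t)) (at_right 0)"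
    if v: "solves_cauchy_problem f v" and t: "t \<ge> 0" for v t
  proof -
    have D: "v t \<in> generator_domain B T" using v t by (auto simp: classical_solution_def)
    have "(v has_vector_derivative generator T (v t) + P (v t)) (at t within {0..})"
      using v t by (auto simp: classical_solution_def)
    from tendsto_diff[OF right_difference_quotient[OF this t] generator_limit(3)[OF D]] show ?thesis
      by (simp add: scaleR_diff_right)
  qed
  define \<phi> where "\<phi> = (\<lambda>t. norm (v t - w t))"
  have cont: "continuous_on {0..} v" if "solves_cauchy_problem f v" for v
    using that unfolding classical_solution_def continuous_on_eq_continuous_within
    by (auto intro: has_vector_derivative_continuous)
  have "\<phi> t \<le> 0"
  proof (rule nonpositive_if_Dini_bounded[of \<phi> K])
    show "continuous_on {0..} \<phi>" unfolding \<phi>_def by (intro continuous_intros cont v w)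
    show "\<phi> 0 \<le> 0" using v w by (simp add: \<phi>_def classical_solution_def)
    fix t e :: real assume t: "t \<ge> 0" and e: "e > 0"
    have "((\<lambda>h. (v (t + h) - T h (v t)) /\<^sub>R h - (w (t + h) - T h (w t)) /\<^sub>R h) \<longlongrightarrow> P (v t) - P (w t)) (at_right 0)"
      by (intro tendsto_diff small v w t)
    from tendstoD[OF this e]
    show "eventually (\<lambda>h. \<phi> (t + h) \<le> \<phi> t + h * (K * \<phi> t + e)) (at_right 0)"
      using eventually_at_right_less[of 0]
    proof eventually_elim
      case (elim h)
      define r where "r = (v (t + h) - T h (v t)) /\<^sub>R h - (w (t + h) - T h (w t)) /\<^sub>R h - P (v t - w t)"
      have r: "norm r < e" using elim(1) by (simp add: r_def dist_norm linear_diff[OF lin_P])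
      have "v (t + h) - w (t + h) = T h (v t - w t) + h *\<^sub>R (P (v t - w t) + r)"
        using elim(2) by (simp add: r_def T_diff scaleR_diff_right)
      then have "\<phi> (t + h) \<le> norm (T h (v t - w t)) + norm (h *\<^sub>R (P (v t - w t) + r))"
        unfolding \<phi>_def by (metis norm_triangle_ineq)
      also have "\<dots> \<le> \<phi> t + h * (K * \<phi> t + e)"
      proof (rule add_mono)
        show "norm (T h (v t - w t)) \<le> \<phi> t" unfolding \<phi>_def using contr elim(2) by simp
        have "norm (P (v t - w t) + r) \<le> K * \<phi> t + e"
          unfolding \<phi>_def using norm_triangle_le[OF add_mono[OF bound_P less_imp_le[OF r]]] by simp
        then show "norm (h *\<^sub>R (P (v t - w t) + r)) \<le> h * (K * \<phi> t + e)"
          using elim(2) by (simp add: mult_left_mono)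
      qed
      finally show ?case .
    qed
  qed (use K_pos t in auto)
  then show ?thesis by (simp add: \<phi>_def)
qed

end

section \<open>A product formula for the perturbed semigroup\<close>

lemma discrete_gronwall:
  fixes e :: "nat \<Rightarrow> real"
  assumes "a \<ge> 0" "\<And>n. n \<le> N \<Longrightarrow> e n \<le> c + a * (\<Sum>j<n. e j)" "n \<le> N"
  shows "e n \<le> c * (1 + a) ^ n"
  using assms(3)
proof (induction n rule: less_induct)
  case (less n)
  have geom: "a * (\<Sum>j<n. (1 + a) ^ j) = (1 + a) ^ n - 1" for n
    by (induction n) (auto simp: algebra_simps)
  have "e n \<le> c + a * (\<Sum>j<n. e j)" using assms(2) less.prems .
  also have "\<dots> \<le> c + a * (\<Sum>j<n. c * (1 + a) ^ j)"
    using less assms(1) by (intro add_left_mono mult_left_mono sum_mono) auto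
  also have "\<dots> = c + c * (a * (\<Sum>j<n. (1 + a) ^ j))" by (simp add: sum_distrib_left mult_ac)
  also have "\<dots> = c * (1 + a) ^ n" by (simp add: geom algebra_simps)
  finally show ?case .
qed

lemma linear_funpow: "linear L \<Longrightarrow> linear (L ^^ m)" for L :: "'b::real_vector \<Rightarrow> 'b"
  by (induction m) (auto simp: linear_iff)

lemma discrete_duhamel:
  fixes x q :: "nat \<Rightarrow> 'b::real_vector"
  assumes "linear L" "\<And>j. x (Suc j) = L (x j) + q j"
  shows "x n = (L ^^ n) (x 0) + (\<Sum>j<n. (L ^^ (n - 1 - j)) (q j))"
proof (induction n)
  case (Suc n)
  have "L (\<Sum>j<n. (L ^^ (n - 1 - j)) (q j)) = (\<Sum>j<n. (L ^^ (n - j)) (q j))"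
    unfolding linear_sum[OF assms(1)]
  proof (rule sum.cong[OF refl])
    fix j assume "j \<in> {..<n}"
    then have "n - j = Suc (n - 1 - j)" by auto
    then show "L ((L ^^ (n - 1 - j)) (q j)) = (L ^^ (n - j)) (q j)" by simp
  qed
  then show ?case using assms Suc by (simp add: linear_add)
qed simp

context perturbed_semigroup
begin

text \<open>
  Put \<open>w j = (U(\<tau>) + \<tau> P)\<^sup>j f\<close> and \<open>u\<close> for the perturbed orbit of \<open>f\<close>. The sequence \<open>w\<close> solves the
  discrete Duhamel equation for \<open>U(\<tau>)\<close> with source \<open>\<tau> P (w j)\<close>. By \<open>perturbed_step\<close>, the values
  \<open>u(j \<tau>)\<close> solve that for \<open>T(\<tau>)\<close> with source \<open>\<tau> P (u(j \<tau>))\<close> up to \<open>o(\<tau>)\<close>. Subtracting leaves the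
  difference of the sources, controlled by Gronwall, and the differences \<open>U(\<tau>)\<^sup>m - T(m \<tau>)\<close> evaluated at
  \<open>f\<close> and at the points of the compact set \<open>P u([0, t])\<close>; on a compact set pointwise convergence of
  contractions is uniform.
\<close>

theorem perturbed_product_formula:
  fixes U :: "real \<Rightarrow> 'b \<Rightarrow> 'b"
  assumes U_lin: "\<And>\<tau>. \<tau> \<ge> 0 \<Longrightarrow> linear (U \<tau>)" and U_contr: "\<And>\<tau> g. \<tau> \<ge> 0 \<Longrightarrow> norm (U \<tau> g) \<le> norm g"
    and U_approx: "\<And>g N e. g \<in> B \<Longrightarrow> N \<ge> 0 \<Longrightarrow> e > 0 \<Longrightarrow>
      eventually (\<lambda>\<tau>. \<forall>m. real m * \<tau> \<le> N \<longrightarrow> norm ((U \<tau> ^^ m) g - T (real m * \<tau>) g) \<le> e) (at_right 0)"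
    and f: "f \<in> B" and t: "t > 0"
  shows "(\<lambda>n. ((\<lambda>h. U (t / real n) h + (t / real n) *\<^sub>R P h) ^^ n) f) \<longlonglongrightarrow> perturbed t f"
proof -
  define u where "u = (\<lambda>t. perturbed t f)"
  have uB: "u r \<in> B" if "r \<ge> 0" for r unfolding u_def by (rule perturbed_in_B[OF f that])
  have u_cont: "continuous_on {0..} u" unfolding u_def by (rule continuous_on_perturbed[OF f])
  have Um_lin: "linear (U \<tau> ^^ m)" if "\<tau> \<ge> 0" for \<tau> m using linear_funpow U_lin that .
  have Um_contr: "norm ((U \<tau> ^^ m) g) \<le> norm g" if "\<tau> \<ge> 0" for \<tau> m g
    by (induction m) (auto intro: order_trans[OF U_contr[OF that]])
  have T_pow: "(T \<tau> ^^ m) g = T (real m * \<tau>) g" if "\<tau> \<ge> 0" "g \<in> B" for \<tau> m g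
    by (induction m) (use that in \<open>auto simp: zero add[symmetric] algebra_simps\<close>)
  have Tm_lin: "linear (T \<tau> ^^ m)" if "\<tau> \<ge> 0" for \<tau> m using linear_funpow lin that .
  have Tm_contr: "norm ((T \<tau> ^^ m) g) \<le> norm g" if "\<tau> \<ge> 0" for \<tau> m g
    by (induction m) (auto intro: order_trans[OF contr[OF that]])
  have orbit: "eventually (\<lambda>\<tau>. \<forall>r\<in>{0..t}. \<forall>m. real m * \<tau> \<le> t \<longrightarrow>
      norm ((U \<tau> ^^ m) (P (u r)) - T (real m * \<tau>) (P (u r))) \<le> e) (at_right 0)" if e: "e > 0" for e
  proof -
    define G where "G = (\<lambda>r. P (u r)) ` {0..t}"
    have cG: "compact G"
      unfolding G_def by (intro compact_continuous_image continuous_on_P continuous_on_subset[OF u_cont]) auto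
    have "e / 3 > 0" using e by simp
    then obtain k where k: "k \<subseteq> G" "finite k" "G \<subseteq> (\<Union>x\<in>k. ball x (e / 3))"
      using compactE_image[OF cG, of G "\<lambda>x. ball x (e / 3)"] by (metis UN_I centre_in_ball open_ball subsetI)
    have kB: "k \<subseteq> B" using k(1) uB inv_P by (auto simp: G_def)
    have "eventually (\<lambda>\<tau>. \<forall>g\<in>k. \<forall>m. real m * \<tau> \<le> t \<longrightarrow> norm ((U \<tau> ^^ m) g - T (real m * \<tau>) g) \<le> e / 3) (at_right 0)"
      using kB t e by (intro eventually_ball_finite k(2) ballI U_approx) auto
    with eventually_at_right_less[of 0] show ?thesis
    proof eventually_elim
      case (elim \<tau>)
      show ?case
      proof (intro ballI allI impI)
        fix r m assume r: "r \<in> {0..t}" and m: "real m * \<tau> \<le> t"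
        have \<tau>: "\<tau> \<ge> 0" "real m * \<tau> \<ge> 0" using elim(1) by auto
        let ?h = "P (u r)"
        have "?h \<in> G" using r by (simp add: G_def)
        then obtain g where "g \<in> k" "?h \<in> ball g (e / 3)" using k(3) by blast
        then have g: "g \<in> k" "dist g ?h < e / 3" by simp_all
        have 1: "norm ((U \<tau> ^^ m) g - T (real m * \<tau>) g) \<le> e / 3" using elim(2) g m by blast
        have 2: "norm ((U \<tau> ^^ m) ?h - (U \<tau> ^^ m) g) \<le> e / 3"
          using Um_contr[OF \<tau>(1), of m "?h - g"] g by (simp add: linear_diff[OF Um_lin[OF \<tau>(1)]] dist_norm norm_minus_commute)
        have 3: "norm (T (real m * \<tau>) g - T (real m * \<tau>) ?h) \<le> e / 3"
          using contr[OF \<tau>(2), of "g - ?h"] g by (simp add: T_diff[OF \<tau>(2)] dist_norm)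
        have "(U \<tau> ^^ m) ?h - T (real m * \<tau>) ?h = ((U \<tau> ^^ m) ?h - (U \<tau> ^^ m) g) +
            ((U \<tau> ^^ m) g - T (real m * \<tau>) g) + (T (real m * \<tau>) g - T (real m * \<tau>) ?h)" by simp
        then show "norm ((U \<tau> ^^ m) ?h - T (real m * \<tau>) ?h) \<le> e"
          using norm_triangle_le[OF add_mono[OF norm_triangle_le[OF add_mono[OF 2 1]] 3]] by simp
      qed
    qed
  qed
  \<comment> \<open>One \<open>e\<close> comes from the initial value and \<open>2 e\<close> per unit of time from the sources; Gronwall supplies the exponential.\<close>
  have main: "eventually (\<lambda>\<tau>. \<forall>n. real n * \<tau> \<le> t \<longrightarrow>
      norm (((\<lambda>h. U \<tau> h + \<tau> *\<^sub>R P h) ^^ n) f - u (real n * \<tau>)) \<le> e * (1 + 2 * t) * exp (K * t)) (at_right 0)"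
    if e: "e > 0" for e
    using eventually_at_right_less[of 0] U_approx[OF f less_imp_le[OF t] e] orbit[OF e] perturbed_step[OF f less_imp_le[OF t] e]
  proof eventually_elim
    case (elim \<tau>)
    have \<tau>: "\<tau> \<ge> 0" using elim(1) by simp
    define w where "w = (\<lambda>j. ((\<lambda>h. U \<tau> h + \<tau> *\<^sub>R P h) ^^ j) f)"
    define d where "d = (\<lambda>j. u (real (Suc j) * \<tau>) - T \<tau> (u (real j * \<tau>)) - \<tau> *\<^sub>R P (u (real j * \<tau>)))"
    show ?case
    proof (intro allI impI)
      fix n assume n: "real n * \<tau> \<le> t"
      define E where "E = (\<lambda>j. norm (w j - u (real j * \<tau>)))"
      have step: "E k \<le> e * (1 + 2 * t) + \<tau> * K * (\<Sum>j<k. E j)" if k: "k \<le> n" for k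
      proof -
        have le: "real j * \<tau> \<le> t" if "j \<le> k" for j
          using that k \<tau> n mult_right_mono[of "real j" "real n" \<tau>] by simp
        have w_k: "w k = (U \<tau> ^^ k) f + (\<Sum>j<k. (U \<tau> ^^ (k - 1 - j)) (\<tau> *\<^sub>R P (w j)))"
          using discrete_duhamel[OF U_lin[OF \<tau>], of w "\<lambda>j. \<tau> *\<^sub>R P (w j)" k] by (simp add: w_def)
        have u_k: "u (real k * \<tau>) = (T \<tau> ^^ k) f + (\<Sum>j<k. (T \<tau> ^^ (k - 1 - j)) (\<tau> *\<^sub>R P (u (real j * \<tau>)) + d j))"
          using discrete_duhamel[OF lin[OF \<tau>], of "\<lambda>j. u (real j * \<tau>)" "\<lambda>j. \<tau> *\<^sub>R P (u (real j * \<tau>)) + d j" k]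
          by (simp add: d_def u_def perturbed_0[OF f])
        have split: "w k - u (real k * \<tau>) = ((U \<tau> ^^ k) f - (T \<tau> ^^ k) f) +
            (\<Sum>j<k. (U \<tau> ^^ (k - 1 - j)) (\<tau> *\<^sub>R P (w j)) - (T \<tau> ^^ (k - 1 - j)) (\<tau> *\<^sub>R P (u (real j * \<tau>)) + d j))"
          unfolding w_k u_k by (simp add: sum_subtractf)
        have term_bound: "norm ((U \<tau> ^^ (k - 1 - j)) (\<tau> *\<^sub>R P (w j)) - (T \<tau> ^^ (k - 1 - j)) (\<tau> *\<^sub>R P (u (real j * \<tau>)) + d j))
            \<le> \<tau> * K * E j + 2 * e * \<tau>" if j: "j < k" for j
        proof -
          let ?m = "k - 1 - j" and ?v = "u (real j * \<tau>)"
          have vB: "?v \<in> B" using \<tau> by (intro uB) simp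
          have 1: "norm ((U \<tau> ^^ ?m) (\<tau> *\<^sub>R P (w j - ?v))) \<le> \<tau> * K * E j"
            using order_trans[OF Um_contr[OF \<tau>]] bound_P[of "w j - ?v"] \<tau>
            by (simp add: E_def mult.assoc mult_left_mono)
          have "real j * \<tau> \<in> {0..t}" "real ?m * \<tau> \<le> t"
            using le[of j] le[of ?m] j \<tau> by auto
          then have "norm ((U \<tau> ^^ ?m) (P ?v) - T (real ?m * \<tau>) (P ?v)) \<le> e"
            using elim(3) by blast
          then have 2: "norm (\<tau> *\<^sub>R ((U \<tau> ^^ ?m) (P ?v) - (T \<tau> ^^ ?m) (P ?v))) \<le> e * \<tau>"
            using \<tau> mult_left_mono[OF _ \<tau>] unfolding T_pow[OF \<tau> inv_P[OF vB]]
            by (simp add: mult.commute[of e])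
          have "real (Suc j) * \<tau> = real j * \<tau> + \<tau>" by (simp add: algebra_simps)
          then have "norm (d j) \<le> e * \<tau>"
            using elim(4) le[of j] j \<tau> unfolding d_def u_def by auto
          then have 3: "norm ((T \<tau> ^^ ?m) (d j)) \<le> e * \<tau>" using Tm_contr[OF \<tau>] order_trans by blast
          have "(U \<tau> ^^ ?m) (\<tau> *\<^sub>R P (w j)) - (T \<tau> ^^ ?m) (\<tau> *\<^sub>R P ?v + d j) =
              (U \<tau> ^^ ?m) (\<tau> *\<^sub>R P (w j - ?v)) + \<tau> *\<^sub>R ((U \<tau> ^^ ?m) (P ?v) - (T \<tau> ^^ ?m) (P ?v)) - (T \<tau> ^^ ?m) (d j)"
            by (simp add: linear_diff[OF lin_P] linear_diff[OF Um_lin[OF \<tau>]] linear_scale[OF Um_lin[OF \<tau>]]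
                linear_add[OF Tm_lin[OF \<tau>]] linear_scale[OF Tm_lin[OF \<tau>]] scaleR_diff_right)
          also have "norm \<dots> \<le> (\<tau> * K * E j + e * \<tau>) + e * \<tau>"
            using 1 2 3 norm_triangle_le_diff norm_triangle_le by (meson add_mono order_trans norm_triangle_ineq4 norm_triangle_ineq)
          also have "\<dots> = \<tau> * K * E j + 2 * e * \<tau>" by simp
          finally show ?thesis .
        qed
        have "E k \<le> norm ((U \<tau> ^^ k) f - (T \<tau> ^^ k) f) + (\<Sum>j<k. \<tau> * K * E j + 2 * e * \<tau>)"
          unfolding E_def split by (intro order_trans[OF norm_triangle_ineq] add_left_mono sum_norm_le) (use term_bound in \<open>auto simp: E_def\<close>)
        also have "norm ((U \<tau> ^^ k) f - (T \<tau> ^^ k) f) \<le> e"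
          using elim(2) le[of k] by (simp add: T_pow[OF \<tau> f])
        also have "(\<Sum>j<k. \<tau> * K * E j + 2 * e * \<tau>) = \<tau> * K * (\<Sum>j<k. E j) + 2 * e * (real k * \<tau>)"
          by (simp add: sum.distrib sum_distrib_left)
        also have "2 * e * (real k * \<tau>) \<le> 2 * e * t" using le[of k] e by simp
        finally show ?thesis by (simp add: algebra_simps)
      qed
      have "E n \<le> e * (1 + 2 * t) * (1 + \<tau> * K) ^ n"
        by (rule discrete_gronwall[where N = n]) (use step \<tau> K_pos in auto)
      also have "(1 + \<tau> * K) ^ n \<le> exp (\<tau> * K) ^ n"
        using \<tau> K_pos by (intro power_mono) auto
      also have "exp (\<tau> * K) ^ n = exp (K * (real n * \<tau>))" by (simp add: exp_of_nat_mult[symmetric] mult_ac)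
      also have "\<dots> \<le> exp (K * t)" using n K_pos by simp
      finally show "norm (((\<lambda>h. U \<tau> h + \<tau> *\<^sub>R P h) ^^ n) f - u (real n * \<tau>)) \<le> e * (1 + 2 * t) * exp (K * t)"
        using e t by (simp add: E_def w_def mult_left_mono)
    qed
  qed
  show ?thesis
    unfolding tendsto_iff
  proof (intro allI impI)
    fix e :: real assume e: "e > 0"
    define e' where "e' = e / (2 * ((1 + 2 * t) * exp (K * t)))"
    have pos: "(1 + 2 * t) * exp (K * t) > 0" using t by simp
    have e': "e' > 0" using e pos by (simp add: e'_def)
    have ee: "e' * (1 + 2 * t) * exp (K * t) = e / 2" using pos by (simp add: e'_def field_simps)
    have "filterlim (\<lambda>n. t / real n) (at_right 0) sequentially"
      unfolding filterlim_at
      using t by (auto intro!: tendsto_divide_0[OF tendsto_const] filterlim_at_top_imp_at_infinity filterlim_real_sequentially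
          simp: eventually_sequentially intro: exI[of _ 1])
    from eventually_compose_filterlim[OF main[OF e'] this] eventually_gt_at_top[of 0]
    show "eventually (\<lambda>n. dist (((\<lambda>h. U (t / real n) h + (t / real n) *\<^sub>R P h) ^^ n) f) (perturbed t f) < e) sequentially"
    proof eventually_elim
      case (elim n)
      have n: "real n * (t / real n) = t" using elim(2) by simp
      have "norm (((\<lambda>h. U (t / real n) h + (t / real n) *\<^sub>R P h) ^^ n) f - u (real n * (t / real n))) \<le> e / 2"
        using elim(1)[unfolded ee, rule_format, OF eq_refl[OF n]] .
      then have "norm (((\<lambda>h. U (t / real n) h + (t / real n) *\<^sub>R P h) ^^ n) f - u t) \<le> e / 2"
        unfolding n .
      then show ?case using e by (simp add: dist_norm u_def)
    qed
  qed
qed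

end

section \<open>Averages over the Heisenberg group\<close>

instance bcontfun :: (metric_space, banach) banach ..

lemma norm_fst_le_norm: "norm (fst p) \<le> norm p" and norm_snd_le_norm: "norm (snd p) \<le> norm p"
  by (metis norm_fst_le norm_snd_le prod.collapse)+

lemma abs_sympl_le: "\<bar>z \<bullet>\<^sub>\<sigma> w\<bar> \<le> 2 * norm z * norm w" for z w :: "(real^'d::finite) \<times> (real^'d)"
proof -
  have "\<bar>fst w \<bullet> snd z\<bar> \<le> norm w * norm z" "\<bar>fst z \<bullet> snd w\<bar> \<le> norm z * norm w"
    using order_trans[OF Cauchy_Schwarz_ineq2[of "fst w" "snd z"] mult_mono[OF norm_fst_le_norm norm_snd_le_norm]]
      order_trans[OF Cauchy_Schwarz_ineq2[of "fst z" "snd w"] mult_mono[OF norm_fst_le_norm norm_snd_le_norm]]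
    by simp_all
  then show ?thesis by (simp add: sympl_def mult.commute)
qed

lemma sympl_add_left: "(z + z') \<bullet>\<^sub>\<sigma> w = z \<bullet>\<^sub>\<sigma> w + z' \<bullet>\<^sub>\<sigma> w"
  and sympl_add_right: "z \<bullet>\<^sub>\<sigma> (w + w') = z \<bullet>\<^sub>\<sigma> w + z \<bullet>\<^sub>\<sigma> w'"
  and sympl_minus_right: "z \<bullet>\<^sub>\<sigma> (- w) = - (z \<bullet>\<^sub>\<sigma> w)"
  and sympl_scaleR_right: "z \<bullet>\<^sub>\<sigma> (a *\<^sub>R w) = a * (z \<bullet>\<^sub>\<sigma> w)"
  and sympl_self: "z \<bullet>\<^sub>\<sigma> z = 0"
  by (simp_all add: sympl_def inner_simps inner_commute algebra_simps)

lemma sympl_zero [simp]: "0 \<bullet>\<^sub>\<sigma> w = 0" "z \<bullet>\<^sub>\<sigma> 0 = 0"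
  by (simp_all add: sympl_def)

lemma hmult_assoc: "\<xi> \<odot> \<eta> \<odot> \<zeta> = \<xi> \<odot> (\<eta> \<odot> \<zeta>)"
  by (simp add: hmult_def sympl_add_left sympl_add_right)

lemma hmult_zero [simp]: "\<xi> \<odot> 0 = \<xi>" "0 \<odot> \<xi> = \<xi>"
  by (simp_all add: hmult_def)

lemma hmult_inverse: "\<xi> \<odot> w \<odot> (- w) = \<xi>"
  by (simp add: hmult_def sympl_add_left sympl_minus_right sympl_self)

lemma norm_hmult_le: "norm (\<xi> \<odot> w) \<le> norm \<xi> + norm w + 2 * norm \<xi> * norm w"
proof -
  have "\<xi> \<odot> w = \<xi> + w + (0, fst \<xi> \<bullet>\<^sub>\<sigma> fst w)" by (simp add: hmult_def prod_eq_iff)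
  also have "norm \<dots> \<le> norm \<xi> + norm w + \<bar>fst \<xi> \<bullet>\<^sub>\<sigma> fst w\<bar>"
    using norm_triangle_ineq[of "\<xi> + w" "(0, fst \<xi> \<bullet>\<^sub>\<sigma> fst w)"] norm_triangle_ineq[of \<xi> w] by (simp add: norm_Pair)
  also have "\<bar>fst \<xi> \<bullet>\<^sub>\<sigma> fst w\<bar> \<le> 2 * norm (fst \<xi>) * norm (fst w)" by (rule abs_sympl_le)
  also have "\<dots> \<le> 2 * norm \<xi> * norm w"
    by (intro mult_mono mult_left_mono norm_fst_le_norm) auto
  finally show ?thesis by simp
qed

text \<open>
  On a compact ball this is uniform continuity of \<open>(\<xi>, w) \<mapsto> f(\<xi> \<odot> w)\<close>. Outside a larger ball
  translation by a small \<open>w\<close> cannot enter the region where \<open>f\<close> is large. Decay is essential: the Euclidean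
  distance of \<open>\<xi>\<close> and \<open>\<xi> \<odot> w\<close> is unbounded in \<open>\<xi>\<close>, so uniform continuity alone would not suffice.
\<close>

lemma C0_left_uniform:
  fixes f :: "'d::finite heis \<Rightarrow>\<^sub>C 'k::real_normed_vector"
  assumes f: "f \<in> C0" and e: "e > 0"
  obtains \<delta> where "\<delta> > 0" "\<And>\<xi> w. norm w < \<delta> \<Longrightarrow> norm (apply_bcontfun f (\<xi> \<odot> w) - apply_bcontfun f \<xi>) \<le> e"
proof -
  have "e / 2 > 0" using e by simp
  then have "eventually (\<lambda>x. norm (apply_bcontfun f x) < e / 2) at_infinity"
    using f tendstoD[of f 0 at_infinity "e / 2"] by (simp add: C0_def)
  then obtain R0 where R0: "\<And>x. norm x \<ge> R0 \<Longrightarrow> norm (apply_bcontfun f x) < e / 2"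
    by (auto simp: eventually_at_infinity)
  define R where "R = max R0 0"
  have R: "R \<ge> 0" "\<And>x. norm x \<ge> R \<Longrightarrow> norm (apply_bcontfun f x) < e / 2" using R0 by (auto simp: R_def)
  define R1 where "R1 = R + 1 + 2 * R"
  have "continuous_on (cball (0::'d heis) R1 \<times> cball 0 1) (\<lambda>p. apply_bcontfun f (fst p \<odot> snd p))"
    by (intro continuous_on_compose2[OF continuous_on_apply_bcontfun[of UNIV f]] continuous_intros) auto
  then have "uniformly_continuous_on (cball (0::'d heis) R1 \<times> cball 0 1) (\<lambda>p. apply_bcontfun f (fst p \<odot> snd p))"
    by (rule compact_uniformly_continuous) (intro compact_Times compact_cball)
  then obtain d where d: "d > 0" "\<And>p q. p \<in> cball 0 R1 \<times> cball 0 1 \<Longrightarrow> q \<in> cball 0 R1 \<times> cball 0 1 \<Longrightarrow>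
     dist q p < d \<Longrightarrow> dist (apply_bcontfun f (fst q \<odot> snd q)) (apply_bcontfun f (fst p \<odot> snd p)) < e"
    using e unfolding uniformly_continuous_on_def by metis
  show ?thesis
  proof (rule that[of "min d 1"])
    show "min d 1 > 0" using d by simp
    fix \<xi> w :: "'d heis" assume w: "norm w < min d 1"
    show "norm (apply_bcontfun f (\<xi> \<odot> w) - apply_bcontfun f \<xi>) \<le> e"
    proof (cases "norm \<xi> \<le> R1")
      case True
      have "dist (apply_bcontfun f (fst (\<xi>, w) \<odot> snd (\<xi>, w))) (apply_bcontfun f (fst (\<xi>, 0) \<odot> snd (\<xi>, 0))) < e"
        using d(2)[of "(\<xi>, 0)" "(\<xi>, w)"] True w by (simp add: dist_Pair_Pair)
      then show ?thesis by (simp add: dist_norm)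
    next
      case False
      have "norm (\<xi> \<odot> w) \<ge> R"
      proof (rule ccontr)
        assume "\<not> norm (\<xi> \<odot> w) \<ge> R"
        then have "norm (\<xi> \<odot> w) \<le> R" by simp
        have "norm \<xi> = norm (\<xi> \<odot> w \<odot> (- w))" by (simp add: hmult_inverse)
        also have "\<dots> \<le> norm (\<xi> \<odot> w) + norm w + 2 * norm (\<xi> \<odot> w) * norm w"
          using norm_hmult_le[of "\<xi> \<odot> w" "- w"] by simp
        also have "\<dots> \<le> R + 1 + 2 * R * 1"
          using w \<open>norm (\<xi> \<odot> w) \<le> R\<close> R(1) by (intro add_mono mult_mono mult_left_mono) auto
        finally show False using False by (simp add: R1_def)
      qed
      moreover have "norm \<xi> \<ge> R" using False R(1) by (simp add: R1_def)
      ultimately have "norm (apply_bcontfun f (\<xi> \<odot> w)) + norm (apply_bcontfun f \<xi>) < e / 2 + e / 2"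
        using R(2) by (intro add_strict_mono) auto
      then show ?thesis using norm_triangle_ineq4[of "apply_bcontfun f (\<xi> \<odot> w)" "apply_bcontfun f \<xi>"] by simp
    qed
  qed
qed

text \<open>
  Chebyshev's inequality in deterministic form: this makes second moments of the translation the only
  information needed about its law.
\<close>

lemma C0_quadratic_modulus:
  fixes f :: "'d::finite heis \<Rightarrow>\<^sub>C 'k::real_normed_vector"
  assumes f: "f \<in> C0" and e: "e > 0"
  obtains C where "C \<ge> 0"
    "\<And>\<xi> w. norm (apply_bcontfun f (\<xi> \<odot> w) - apply_bcontfun f \<xi>) \<le> e + C * (norm w)\<^sup>2"
proof -
  obtain \<delta> where \<delta>: "\<delta> > 0" "\<And>\<xi> w. norm w < \<delta> \<Longrightarrow> norm (apply_bcontfun f (\<xi> \<odot> w) - apply_bcontfun f \<xi>) \<le> e"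
    using C0_left_uniform[OF f e] by metis
  show ?thesis
  proof (rule that[of "2 * norm f / \<delta>\<^sup>2"])
    show "2 * norm f / \<delta>\<^sup>2 \<ge> 0" by simp
    fix \<xi> w
    show "norm (apply_bcontfun f (\<xi> \<odot> w) - apply_bcontfun f \<xi>) \<le> e + 2 * norm f / \<delta>\<^sup>2 * (norm w)\<^sup>2"
    proof (cases "norm w < \<delta>")
      case True
      have "0 \<le> 2 * norm f / \<delta>\<^sup>2 * (norm w)\<^sup>2" by simp
      then show ?thesis using \<delta>(2)[OF True, of \<xi>] by linarith
    next
      case False
      then have "\<delta>\<^sup>2 \<le> (norm w)\<^sup>2" using \<delta>(1) by (intro power_mono) auto
      then have "1 \<le> (norm w)\<^sup>2 / \<delta>\<^sup>2" using \<delta>(1) by simp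
      then have "2 * norm f * 1 \<le> 2 * norm f * ((norm w)\<^sup>2 / \<delta>\<^sup>2)" by (intro mult_left_mono) auto
      moreover have "norm (apply_bcontfun f (\<xi> \<odot> w) - apply_bcontfun f \<xi>) \<le> norm f + norm f"
        using norm_triangle_ineq4 norm_bounded add_mono order_trans by meson
      ultimately show ?thesis using e by simp
    qed
  qed
qed

lemma borel_measurable_hmult [measurable (raw)]:
  fixes Y Z :: "'w \<Rightarrow> 'd::finite heis"
  assumes "Y \<in> borel_measurable M" "Z \<in> borel_measurable M"
  shows "(\<lambda>\<omega>. Y \<omega> \<odot> Z \<omega>) \<in> borel_measurable M"
  by (rule borel_measurable_continuous_Pair[OF assms]) (intro continuous_intros)

lemma borel_measurable_bcontfun:
  fixes f :: "'a::metric_space \<Rightarrow>\<^sub>C 'b::metric_space"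
  assumes "Y \<in> borel_measurable M"
  shows "(\<lambda>\<omega>. apply_bcontfun f (Y \<omega>)) \<in> borel_measurable M"
  using measurable_compose[OF assms borel_measurable_continuous_onI[OF continuous_on_apply_bcontfun]] .

context prob_space
begin

lemma integrable_bcontfun:
  fixes f :: "'b::metric_space \<Rightarrow>\<^sub>C 'k::euclidean_space"
  assumes "Y \<in> borel_measurable M"
  shows "integrable M (\<lambda>\<omega>. apply_bcontfun f (Y \<omega>))"
  by (rule integrable_const_bound[where B = "norm f"]) (auto simp: norm_bounded borel_measurable_bcontfun[OF assms])

lemma linear_heis_semigroup:
  fixes W :: "real \<Rightarrow> 'a \<Rightarrow> 'd::finite heis"
  assumes W: "W t \<in> borel_measurable M"
  shows "linear (heis_semigroup M W t :: ('d heis \<Rightarrow>\<^sub>C 'k::euclidean_space) \<Rightarrow> _)"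
  by (intro linearI bcontfun_eqI)
    (simp_all add: heis_semigroup_apply[where W = W, OF prob_space_axioms W]
      Bochner_Integration.integral_add[OF integrable_bcontfun integrable_bcontfun] W borel_measurable_hmult)

lemma norm_heis_semigroup_le:
  fixes f :: "'d::finite heis \<Rightarrow>\<^sub>C 'k::euclidean_space"
  assumes W: "W t \<in> borel_measurable M"
  shows "norm (heis_semigroup M W t f) \<le> norm f"
proof (rule norm_bound)
  fix \<xi>
  have "norm (apply_bcontfun (heis_semigroup M W t f) \<xi>) \<le> (\<integral>\<omega>. norm (apply_bcontfun f (\<xi> \<odot> W t \<omega>)) \<partial>M)"
    unfolding heis_semigroup_apply[where W = W, OF prob_space_axioms W] by (rule integral_norm_bound)
  also have "\<dots> \<le> (\<integral>\<omega>. norm f \<partial>M)"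
    by (intro integral_mono integrable_norm integrable_bcontfun borel_measurable_hmult W norm_bounded) auto
  finally show "norm (apply_bcontfun (heis_semigroup M W t f) \<xi>) \<le> norm f" by (simp add: prob_space)
qed

lemma heis_semigroup_C0:
  fixes f :: "'d::finite heis \<Rightarrow>\<^sub>C 'k::euclidean_space"
  assumes W: "W t \<in> borel_measurable M" and f: "f \<in> C0"
  shows "heis_semigroup M W t f \<in> C0"
proof (rule ccontr)
  note app = heis_semigroup_apply[where W = W, OF prob_space_axioms W]
  assume "heis_semigroup M W t f \<notin> C0"
  then obtain e where e: "e > 0" "\<And>b. \<exists>x. norm x \<ge> b \<and> dist (apply_bcontfun (heis_semigroup M W t f) x) 0 \<ge> e"
    unfolding C0_def Lim_at_infinity by (force simp: not_less)
  then have "\<forall>n. \<exists>x. norm x \<ge> real n \<and> dist (apply_bcontfun (heis_semigroup M W t f) x) 0 \<ge> e" by blast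
  then obtain X where X: "\<And>n. norm (X n) \<ge> real n" "\<And>n. dist (apply_bcontfun (heis_semigroup M W t f) (X n)) 0 \<ge> e"
    unfolding choice_iff by blast
  have "(\<lambda>n. \<integral>\<omega>. apply_bcontfun f (X n \<odot> W t \<omega>) \<partial>M) \<longlonglongrightarrow> (\<integral>\<omega>. 0 \<partial>M)"
  proof (rule integral_dominated_convergence[where w = "\<lambda>_. norm f"])
    show "AE \<omega> in M. (\<lambda>n. apply_bcontfun f (X n \<odot> W t \<omega>)) \<longlonglongrightarrow> 0"
    proof (rule AE_I2)
      fix \<omega>
      define w where "w = W t \<omega>"
      have "filterlim (\<lambda>n. norm (X n \<odot> w)) at_top sequentially"
      proof (rule filterlim_at_top_mono)
        have "filterlim (\<lambda>n. (- norm w + real n) * (1 / (1 + 2 * norm w))) at_top sequentially"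
          by (intro filterlim_at_top_mult_tendsto_pos[OF tendsto_const] filterlim_tendsto_add_at_top[OF tendsto_const]
             filterlim_real_sequentially) (simp add: add_pos_nonneg)
        then show "filterlim (\<lambda>n. (real n - norm w) / (1 + 2 * norm w)) at_top sequentially" by simp
        have "(real n - norm w) / (1 + 2 * norm w) \<le> norm (X n \<odot> w)" for n
        proof -
          have "real n \<le> norm (X n \<odot> w \<odot> (- w))" using X(1) by (simp add: hmult_inverse)
          also have "\<dots> \<le> norm (X n \<odot> w) + norm w + 2 * norm (X n \<odot> w) * norm w"
            using norm_hmult_le[of "X n \<odot> w" "- w"] by simp
          finally show ?thesis by (simp add: divide_le_eq add_pos_nonneg algebra_simps)
        qed
        then show "eventually (\<lambda>n. (real n - norm w) / (1 + 2 * norm w) \<le> norm (X n \<odot> w)) sequentially" by simp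
      qed
      then have "filterlim (\<lambda>n. X n \<odot> w) at_infinity sequentially"
        by (rule filterlim_norm_at_top_imp_at_infinity)
      moreover have "(apply_bcontfun f \<longlongrightarrow> 0) at_infinity" using f by (simp add: C0_def)
      ultimately show "(\<lambda>n. apply_bcontfun f (X n \<odot> W t \<omega>)) \<longlonglongrightarrow> 0"
        unfolding w_def by (rule filterlim_compose[rotated])
    qed
  qed (auto simp: norm_bounded intro!: borel_measurable_bcontfun borel_measurable_hmult W)
  then have "(\<lambda>n. apply_bcontfun (heis_semigroup M W t f) (X n)) \<longlonglongrightarrow> 0" by (simp add: app)
  from tendstoD[OF this e(1)] have "eventually (\<lambda>n. False) sequentially"
  proof (rule eventually_mono)
    show False if "dist (apply_bcontfun (heis_semigroup M W t f) (X n)) 0 < e" for n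
      using that X(2)[of n] by simp
  qed
  then show False by simp
qed

lemma norm_average_diff_le:
  fixes f :: "'d::finite heis \<Rightarrow>\<^sub>C 'k::euclidean_space"
  assumes mod: "\<And>\<xi> w. norm (apply_bcontfun f (\<xi> \<odot> w) - apply_bcontfun f \<xi>) \<le> e + C * (norm w)\<^sup>2"
    and C: "C \<ge> 0" and e: "e \<ge> 0" and \<eta>: "\<eta> \<ge> 0"
    and [measurable]: "Y \<in> borel_measurable M" "Z \<in> borel_measurable M" "D \<in> borel_measurable M"
    and YZ: "AE \<omega> in M. Y \<omega> = Z \<omega> \<odot> D \<omega>"
    and D: "(\<integral>\<^sup>+\<omega>. ennreal ((norm (D \<omega>))\<^sup>2) \<partial>M) \<le> ennreal \<eta>"
  shows "norm ((\<integral>\<omega>. apply_bcontfun f (\<xi> \<odot> Y \<omega>) \<partial>M) - (\<integral>\<omega>. apply_bcontfun f (\<xi> \<odot> Z \<omega>) \<partial>M)) \<le> e + C * \<eta>"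
proof -
  have meas [measurable]: "(\<lambda>\<omega>. apply_bcontfun f (\<xi> \<odot> V \<omega>)) \<in> borel_measurable M" if [measurable]: "V \<in> borel_measurable M" for V
    by (rule borel_measurable_bcontfun) simp
  have int: "integrable M (\<lambda>\<omega>. apply_bcontfun f (\<xi> \<odot> V \<omega>))" if [measurable]: "V \<in> borel_measurable M" for V
    by (rule integrable_bcontfun) simp
  have "(\<integral>\<omega>. apply_bcontfun f (\<xi> \<odot> Y \<omega>) \<partial>M) - (\<integral>\<omega>. apply_bcontfun f (\<xi> \<odot> Z \<omega>) \<partial>M)
      = (\<integral>\<omega>. apply_bcontfun f (\<xi> \<odot> Y \<omega>) - apply_bcontfun f (\<xi> \<odot> Z \<omega>) \<partial>M)"
    by (simp add: int)
  also have "ennreal (norm \<dots>) \<le> (\<integral>\<^sup>+\<omega>. norm (apply_bcontfun f (\<xi> \<odot> Y \<omega>) - apply_bcontfun f (\<xi> \<odot> Z \<omega>)) \<partial>M)"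
    by (intro integral_norm_bound_ennreal Bochner_Integration.integrable_diff int) simp_all
  also have "\<dots> \<le> (\<integral>\<^sup>+\<omega>. ennreal e + ennreal C * ennreal ((norm (D \<omega>))\<^sup>2) \<partial>M)"
    using YZ
  proof (intro nn_integral_mono_AE, eventually_elim)
    case (elim \<omega>)
    show ?case
      using mod[of "\<xi> \<odot> Z \<omega>" "D \<omega>"] C e
      by (simp add: elim hmult_assoc ennreal_mult[symmetric] ennreal_plus[symmetric] del: ennreal_plus)
  qed
  also have "\<dots> = ennreal e + ennreal C * (\<integral>\<^sup>+\<omega>. ennreal ((norm (D \<omega>))\<^sup>2) \<partial>M)"
    by (simp add: nn_integral_add nn_integral_cmult emeasure_space_1)
  also have "\<dots> \<le> ennreal e + ennreal C * ennreal \<eta>" by (intro add_left_mono mult_left_mono D) simp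
  also have "\<dots> = ennreal (e + C * \<eta>)" using C e \<eta> by (simp add: ennreal_mult ennreal_plus)
  finally show ?thesis using C e \<eta> by (subst (asm) ennreal_le_iff) auto
qed

end

lemma bmult_C0: "f \<in> C0 \<Longrightarrow> bmult c f \<in> C0"
  unfolding C0_def
proof (clarsimp simp: bmult_apply[abs_def])
  assume "(apply_bcontfun f \<longlongrightarrow> 0) at_infinity"
  then have "((\<lambda>x. norm c * norm (apply_bcontfun f x)) \<longlongrightarrow> 0) at_infinity"
    by (intro tendsto_mult_right_zero tendsto_norm_zero)
  then show "((\<lambda>x. apply_bcontfun c x *\<^sub>R apply_bcontfun f x) \<longlongrightarrow> 0) at_infinity"
    by (rule Lim_null_comparison[rotated])
      (auto intro!: always_eventually mult_right_mono norm_bounded[of c, simplified real_norm_def])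
qed

lemma linear_bmult: "linear (bmult c)"
  by (intro linearI bcontfun_eqI) (simp_all add: bmult_apply scaleR_add_right)

lemma norm_bmult_le: "norm (bmult c f) \<le> norm c * norm f"
  by (rule norm_bound) (auto simp: bmult_apply intro!: mult_mono norm_bounded norm_bounded[of c, simplified real_norm_def])

lemma closed_C0: "closed (C0 :: ('a::{real_normed_vector} \<Rightarrow>\<^sub>C 'b::{real_normed_vector}) set)"
proof -
  have "f \<in> C0" if *: "\<And>e. e > 0 \<Longrightarrow> \<exists>g\<in>C0. dist g f < e" for f :: "'a \<Rightarrow>\<^sub>C 'b"
    unfolding C0_def mem_Collect_eq tendsto_iff
  proof (intro allI impI)
    fix e :: real assume "e > 0"
    then have "e / 2 > 0" by simp
    from *[OF this] obtain g where g: "g \<in> C0" "dist g f < e / 2" by blast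
    have "eventually (\<lambda>x. dist (apply_bcontfun g x) 0 < e / 2) at_infinity"
      using g(1) tendstoD[OF _ \<open>e / 2 > 0\<close>, of "apply_bcontfun g" 0] by (simp add: C0_def)
    then show "eventually (\<lambda>x. dist (apply_bcontfun f x) 0 < e) at_infinity"
    proof eventually_elim
      case (elim x)
      then show ?case
        using dist_bounded[of g x f] g(2) dist_triangle[of "apply_bcontfun f x" 0 "apply_bcontfun g x"]
        by (simp add: dist_commute)
    qed
  qed
  then show ?thesis
    unfolding closed_limpt by (metis islimpt_approachable)
qed

lemma subspace_C0: "subspace (C0 :: ('a::{real_normed_vector} \<Rightarrow>\<^sub>C 'b::{real_normed_vector}) set)"
  by (auto simp: subspace_def C0_def intro!: tendsto_add_zero tendsto_eq_intros)

section \<open>The Ito isometry and Riemann sums\<close>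

text \<open>
  Cauchy--Schwarz in the weak form \<open>\<bar>a b\<bar> \<le> a\<^sup>2 + b\<^sup>2\<close>.
\<close>

lemma (in finite_measure) integrable_mult_squares:
  fixes f g :: "'a \<Rightarrow> real"
  assumes [measurable]: "f \<in> borel_measurable M" "g \<in> borel_measurable M"
    and "integrable M (\<lambda>x. (f x)\<^sup>2)" "integrable M (\<lambda>x. (g x)\<^sup>2)"
  shows "integrable M (\<lambda>x. f x * g x)"
proof (rule Bochner_Integration.integrable_bound)
  show "integrable M (\<lambda>x. (f x)\<^sup>2 + (g x)\<^sup>2)" using assms by simp
  have "\<bar>a * b\<bar> \<le> a\<^sup>2 + b\<^sup>2" for a b :: real
    using sum_squares_bound[of "\<bar>a\<bar>" "\<bar>b\<bar>"] mult_nonneg_nonneg[of "\<bar>a\<bar>" "\<bar>b\<bar>"]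
    unfolding abs_mult power2_abs by linarith
  then show "AE x in M. norm (f x * g x) \<le> norm ((f x)\<^sup>2 + (g x)\<^sup>2)" by simp
qed simp

lemma integral_double_sum:
  fixes f :: "_ \<Rightarrow> _ \<Rightarrow> _ \<Rightarrow> real"
  assumes "\<And>k l. k \<in> K \<Longrightarrow> l \<in> K \<Longrightarrow> integrable M (f k l)"
  shows "(\<integral>x. (\<Sum>k\<in>K. \<Sum>l\<in>K. f k l x) \<partial>M) = (\<Sum>k\<in>K. \<Sum>l\<in>K. \<integral>x. f k l x \<partial>M)"
proof -
  have "(\<integral>x. (\<Sum>k\<in>K. \<Sum>l\<in>K. f k l x) \<partial>M) = (\<Sum>k\<in>K. \<integral>x. (\<Sum>l\<in>K. f k l x) \<partial>M)"
    by (intro Bochner_Integration.integral_sum Bochner_Integration.integrable_sum assms)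
  also have "\<dots> = (\<Sum>k\<in>K. \<Sum>l\<in>K. \<integral>x. f k l x \<partial>M)"
    by (intro sum.cong refl Bochner_Integration.integral_sum assms)
  finally show ?thesis .
qed

text \<open>
  What the Ito isometry needs of a scalar Brownian motion: increments that are independent of the past,
  centred, and with variance proportional to time. For a coordinate of a
  standard Brownian motion, \<open>v\<close> is the second moment of a standard Gaussian coordinate.
\<close>

locale filtered_brownian = prob_space M for M :: "'w measure" +
  fixes F :: "real \<Rightarrow> 'w measure" and X :: "real \<Rightarrow> 'w \<Rightarrow> real" and v :: real
  assumes space_F: "\<And>s. space (F s) = space M"
    and sets_F: "\<And>s. 0 \<le> s \<Longrightarrow> sets (F s) \<subseteq> sets M"
    and F_mono: "\<And>s t. 0 \<le> s \<Longrightarrow> s \<le> t \<Longrightarrow> sets (F s) \<subseteq> sets (F t)"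
    and adapted: "\<And>t. 0 \<le> t \<Longrightarrow> X t \<in> borel_measurable (F t)"
    and indep: "\<And>s t Y. 0 \<le> s \<Longrightarrow> s \<le> t \<Longrightarrow> Y \<in> borel_measurable (F s) \<Longrightarrow>
          indep_var borel (Y :: 'w \<Rightarrow> real) borel (\<lambda>\<omega>. X t \<omega> - X s \<omega>)"
    and increment_mean: "\<And>s t. 0 \<le> s \<Longrightarrow> s \<le> t \<Longrightarrow> expectation (\<lambda>\<omega>. X t \<omega> - X s \<omega>) = 0"
    and increment_sq_integrable: "\<And>s t. 0 \<le> s \<Longrightarrow> s \<le> t \<Longrightarrow> integrable M (\<lambda>\<omega>. (X t \<omega> - X s \<omega>)\<^sup>2)"
    and increment_sq: "\<And>s t. 0 \<le> s \<Longrightarrow> s \<le> t \<Longrightarrow> expectation (\<lambda>\<omega>. (X t \<omega> - X s \<omega>)\<^sup>2) = v * (t - s)"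
    and start: "AE \<omega> in M. X 0 \<omega> = 0"
    and paths: "AE \<omega> in M. continuous_on {0..} (\<lambda>t. X t \<omega>)"
begin

abbreviation inc :: "real \<Rightarrow> real \<Rightarrow> 'w \<Rightarrow> real" where
  "inc s t \<omega> \<equiv> X t \<omega> - X s \<omega>"

lemma v_nonneg: "v \<ge> 0"
  using increment_sq[of 0 1] Bochner_Integration.integral_nonneg[of M "\<lambda>\<omega>. (inc 0 1 \<omega>)\<^sup>2"] by simp

lemma measurable_F_mono: "Y \<in> borel_measurable (F s) \<Longrightarrow> 0 \<le> s \<Longrightarrow> s \<le> t \<Longrightarrow> Y \<in> borel_measurable (F t)"
  using measurable_from_subalg[of "F t" "F s"] F_mono by (auto simp: subalgebra_def space_F)

lemma measurable_F: "Y \<in> borel_measurable (F s) \<Longrightarrow> 0 \<le> s \<Longrightarrow> Y \<in> borel_measurable M"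
  using measurable_from_subalg[of M "F s"] sets_F by (auto simp: subalgebra_def space_F)

lemma measurable_X: "0 \<le> t \<Longrightarrow> X t \<in> borel_measurable M"
  using measurable_F[OF adapted] by simp

lemma measurable_inc_F: "0 \<le> s \<Longrightarrow> s \<le> t \<Longrightarrow> inc s t \<in> borel_measurable (F t)"
  using measurable_F_mono[OF adapted, of s t] adapted[of t] by simp

lemma increment_integrable: "0 \<le> s \<Longrightarrow> s \<le> t \<Longrightarrow> integrable M (inc s t)"
  by (rule square_integrable_imp_integrable[OF _ increment_sq_integrable])
    (simp_all add: borel_measurable_diff measurable_X)

lemma mult_increment:
  assumes "0 \<le> s" "s \<le> t" "\<rho> \<in> borel_measurable (F s)" "integrable M \<rho>"
  shows "integrable M (\<lambda>\<omega>. \<rho> \<omega> * inc s t \<omega>)" "expectation (\<lambda>\<omega>. \<rho> \<omega> * inc s t \<omega>) = 0"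
  using indep_var_integrable[OF indep[OF assms(1-3)] assms(4) increment_integrable[OF assms(1,2)]]
    indep_var_lebesgue_integral[OF indep[OF assms(1-3)] assms(4) increment_integrable[OF assms(1,2)]]
  by (simp_all add: increment_mean assms)

lemma mult_increment_sq:
  assumes "0 \<le> s" "s \<le> t" "\<rho> \<in> borel_measurable (F s)" "integrable M \<rho>"
  shows "integrable M (\<lambda>\<omega>. \<rho> \<omega> * (inc s t \<omega>)\<^sup>2)"
    "expectation (\<lambda>\<omega>. \<rho> \<omega> * (inc s t \<omega>)\<^sup>2) = v * expectation \<rho> * (t - s)"
proof -
  have "indep_var borel (id \<circ> \<rho>) borel ((\<lambda>x. x\<^sup>2) \<circ> inc s t)"
    by (rule indep_var_compose[OF indep[OF assms(1-3)]]) simp_all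
  then have ind: "indep_var borel \<rho> borel (\<lambda>\<omega>. (inc s t \<omega>)\<^sup>2)" by (simp add: comp_def)
  show "integrable M (\<lambda>\<omega>. \<rho> \<omega> * (inc s t \<omega>)\<^sup>2)"
    "expectation (\<lambda>\<omega>. \<rho> \<omega> * (inc s t \<omega>)\<^sup>2) = v * expectation \<rho> * (t - s)"
    using indep_var_integrable[OF ind assms(4) increment_sq_integrable[OF assms(1,2)]]
      indep_var_lebesgue_integral[OF ind assms(4) increment_sq_integrable[OF assms(1,2)]]
    by (simp_all add: increment_sq assms)
qed

text \<open>
  Over the longer interval the increment splits at the end of the shorter one. The square of the shorter
  increment contributes its variance, and the remaining increment is centred and independent of everything before it.
\<close>

lemma mult_increments_common_start:
  assumes "0 \<le> c" "c \<le> p" "c \<le> q" "\<rho> \<in> borel_measurable (F c)" "integrable M \<rho>"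
  shows "integrable M (\<lambda>\<omega>. \<rho> \<omega> * inc c p \<omega> * inc c q \<omega>) \<and>
    expectation (\<lambda>\<omega>. \<rho> \<omega> * inc c p \<omega> * inc c q \<omega>) = v * expectation \<rho> * (min p q - c)"
  using assms(2,3)
proof (induction p q rule: linorder_wlog)
  case (le p q)
  have *: "\<rho> \<omega> * inc c p \<omega> * inc c q \<omega> = \<rho> \<omega> * (inc c p \<omega>)\<^sup>2 + \<rho> \<omega> * inc c p \<omega> * inc p q \<omega>" for \<omega>
    by (simp add: power2_eq_square algebra_simps)
  have 1: "(\<lambda>\<omega>. \<rho> \<omega> * inc c p \<omega>) \<in> borel_measurable (F p)"
    using measurable_F_mono[OF assms(4,1) le(2)] measurable_inc_F[OF assms(1) le(2)] by simp
  have p: "0 \<le> p" using assms(1) le by simp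
  note 2 = mult_increment[OF p le(1) 1 mult_increment(1)[OF assms(1) le(2) assms(4,5)]]
  note 3 = mult_increment_sq[OF assms(1) le(2) assms(4,5)]
  show ?case unfolding * using 2 3 le by simp
next
  case (sym p q)
  have swap: "\<rho> \<omega> * inc c p \<omega> * inc c q \<omega> = \<rho> \<omega> * inc c q \<omega> * inc c p \<omega>" for \<omega>
    by (simp only: mult_ac)
  have min: "min p q = min q p" by (rule min.commute)
  show ?case unfolding swap min by (rule sym.IH[OF sym.prems(2,1)])
qed

definition L2F :: "real \<Rightarrow> ('w \<Rightarrow> real) \<Rightarrow> bool" where
  "L2F a \<phi> \<longleftrightarrow> \<phi> \<in> borel_measurable (F a) \<and> integrable M (\<lambda>\<omega>. (\<phi> \<omega>)\<^sup>2)"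

lemma L2F_mult_integrable: "L2F a \<phi> \<Longrightarrow> L2F c \<psi> \<Longrightarrow> 0 \<le> a \<Longrightarrow> 0 \<le> c \<Longrightarrow> integrable M (\<lambda>\<omega>. \<phi> \<omega> * \<psi> \<omega>)"
  by (rule integrable_mult_squares) (auto simp: L2F_def intro: measurable_F)

lemma L2F_mult_increment:
  assumes "L2F a \<phi>" "0 \<le> a" "a \<le> b"
  shows "L2F b (\<lambda>\<omega>. \<phi> \<omega> * inc a b \<omega>)"
  unfolding L2F_def power_mult_distrib
proof
  show "(\<lambda>\<omega>. \<phi> \<omega> * inc a b \<omega>) \<in> borel_measurable (F b)"
    by (intro borel_measurable_times measurable_F_mono[of \<phi> a b] measurable_inc_F)
      (use assms in \<open>simp_all add: L2F_def\<close>)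
  show "integrable M (\<lambda>\<omega>. (\<phi> \<omega>)\<^sup>2 * (inc a b \<omega>)\<^sup>2)"
    using assms by (intro mult_increment_sq(1)) (auto simp: L2F_def)
qed

lemma L2F_mono: "L2F a \<phi> \<Longrightarrow> 0 \<le> a \<Longrightarrow> a \<le> b \<Longrightarrow> L2F b \<phi>"
  by (auto simp: L2F_def intro: measurable_F_mono)

definition overlap :: "real \<Rightarrow> real \<Rightarrow> real \<Rightarrow> real \<Rightarrow> real" where
  "overlap a b c d = max 0 (min b d - max a c)"

text \<open>
  Integrals over disjoint intervals are orthogonal, because the later increment is centred given
  the past. Splitting the earlier interval at the start of the later one reduces the general case to that and to a
  common start.
\<close>

lemma product_of_increments:
  assumes "L2F a \<phi>" "L2F c \<psi>" "0 \<le> a" "a \<le> b" "0 \<le> c" "c \<le> d"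
  shows "integrable M (\<lambda>\<omega>. (\<phi> \<omega> * inc a b \<omega>) * (\<psi> \<omega> * inc c d \<omega>)) \<and>
    expectation (\<lambda>\<omega>. (\<phi> \<omega> * inc a b \<omega>) * (\<psi> \<omega> * inc c d \<omega>)) =
      v * (expectation (\<lambda>\<omega>. \<phi> \<omega> * \<psi> \<omega>) * overlap a b c d)"
proof -
  have disjoint: "integrable M (\<lambda>\<omega>. (\<phi> \<omega> * inc a b \<omega>) * (\<psi> \<omega> * inc c d \<omega>)) \<and>
      expectation (\<lambda>\<omega>. (\<phi> \<omega> * inc a b \<omega>) * (\<psi> \<omega> * inc c d \<omega>)) = 0"
    if "L2F a \<phi>" "L2F c \<psi>" "0 \<le> a" "a \<le> b" "b \<le> c" "c \<le> d" for a b c d \<phi> \<psi>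
  proof -
    have c: "0 \<le> c" "0 \<le> b" using that by auto
    have 1: "L2F c (\<lambda>\<omega>. \<phi> \<omega> * inc a b \<omega>)" using L2F_mono[OF L2F_mult_increment] that c by blast
    note 2 = L2F_mult_integrable[OF 1 that(2) c(1) c(1)]
    have "(\<lambda>\<omega>. (\<phi> \<omega> * inc a b \<omega>) * \<psi> \<omega>) \<in> borel_measurable (F c)"
      using 1 that(2) by (auto simp: L2F_def intro: borel_measurable_times)
    from mult_increment[OF c(1) that(6) this 2] show ?thesis by (simp add: mult.assoc)
  qed
  have ordered: "integrable M (\<lambda>\<omega>. (\<phi> \<omega> * inc a b \<omega>) * (\<psi> \<omega> * inc c d \<omega>)) \<and>
    expectation (\<lambda>\<omega>. (\<phi> \<omega> * inc a b \<omega>) * (\<psi> \<omega> * inc c d \<omega>)) =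
      v * (expectation (\<lambda>\<omega>. \<phi> \<omega> * \<psi> \<omega>) * overlap a b c d)"
    if "L2F a \<phi>" "L2F c \<psi>" "0 \<le> a" "a \<le> b" "a \<le> c" "c \<le> d" for a b c d \<phi> \<psi>
  proof (cases "b \<le> c")
    case True
    then have "overlap a b c d = 0" by (simp add: overlap_def)
    then show ?thesis using disjoint[OF that(1-4) True that(6)] by simp
  next
    case False
    have c: "0 \<le> c" "c \<le> b" using that False by auto
    \<comment> \<open>The interval from \<open>a\<close> to \<open>b\<close> is split at \<open>c\<close>.\<close>
    have *: "(\<phi> \<omega> * inc a b \<omega>) * (\<psi> \<omega> * inc c d \<omega>) =
       (\<phi> \<omega> * inc a c \<omega>) * (\<psi> \<omega> * inc c d \<omega>) + (\<phi> \<omega> * \<psi> \<omega>) * inc c b \<omega> * inc c d \<omega>" for \<omega>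
      by (simp add: algebra_simps)
    note 1 = disjoint[OF that(1,2,3,5) order_refl that(6)]
    have "(\<lambda>\<omega>. \<phi> \<omega> * \<psi> \<omega>) \<in> borel_measurable (F c)"
      using L2F_mono[OF that(1,3,5)] that(2) by (auto simp: L2F_def intro: borel_measurable_times)
    note 2 = mult_increments_common_start[OF c that(6) this L2F_mult_integrable[OF that(1,2,3) c(1)]]
    have "overlap a b c d = min b d - c" using that c by (auto simp: overlap_def)
    then show ?thesis unfolding * using 1 2 by simp
  qed
  show ?thesis
  proof (cases "a \<le> c")
    case True then show ?thesis using ordered assms by blast
  next
    case False
    have "overlap a b c d = overlap c d a b" by (simp add: overlap_def min.commute max.commute)
    then show ?thesis using ordered[of c \<psi> a \<phi> d b] assms False by (simp add: mult.commute)
  qed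
qed

text \<open>
  The intervals are arbitrary: by bilinearity the isometry reduces to \<open>product_of_increments\<close>, because the integral of
  a product of two indicators is the length of the overlap. A difference of step processes over
  two partitions is thereby covered without passing to a common refinement.
\<close>

theorem ito_isometry:
  assumes K: "finite K" and \<phi>: "\<And>k. k \<in> K \<Longrightarrow> L2F (a k) (\<phi> k)"
    and ab: "\<And>k. k \<in> K \<Longrightarrow> 0 \<le> a k" "\<And>k. k \<in> K \<Longrightarrow> a k \<le> b k"
  shows "(\<integral>\<^sup>+\<omega>. ennreal ((\<Sum>k\<in>K. \<phi> k \<omega> * inc (a k) (b k) \<omega>)\<^sup>2) \<partial>M) =
    ennreal v * (\<integral>\<^sup>+\<omega>. (\<integral>\<^sup>+r. ennreal ((\<Sum>k\<in>K. \<phi> k \<omega> * indicator {a k<..b k} r)\<^sup>2) \<partial>lborel) \<partial>M)"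
proof -
  let ?o = "\<lambda>k l. overlap (a k) (b k) (a l) (b l)"
  let ?q = "\<lambda>\<omega>. \<Sum>k\<in>K. \<Sum>l\<in>K. \<phi> k \<omega> * \<phi> l \<omega> * ?o k l"
  have ind: "integrable lborel (\<lambda>r. indicator {a k<..b k} r * indicator {a l<..b l} r :: real)"
    "(\<integral>r. indicator {a k<..b k} r * indicator {a l<..b l} r \<partial>lborel) = ?o k l" for k l
  proof -
    have *: "(\<lambda>r. indicator {a k<..b k} r * indicator {a l<..b l} r :: real) = indicator {max (a k) (a l)<..min (b k) (b l)}"
      by (auto simp: indicator_def fun_eq_iff)
    show "integrable lborel (\<lambda>r. indicator {a k<..b k} r * indicator {a l<..b l} r :: real)"
      unfolding * by (cases "max (a k) (a l) \<le> min (b k) (b l)") (auto intro!: integrable_real_indicator)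
    show "(\<integral>r. indicator {a k<..b k} r * indicator {a l<..b l} r \<partial>lborel) = ?o k l"
      unfolding * by (cases "max (a k) (a l) \<le> min (b k) (b l)") (auto simp: overlap_def)
  qed
  have inner: "(\<integral>\<^sup>+r. ennreal ((\<Sum>k\<in>K. \<phi> k \<omega> * indicator {a k<..b k} r)\<^sup>2) \<partial>lborel) = ennreal (?q \<omega>) \<and> ?q \<omega> \<ge> 0" for \<omega>
  proof -
    have sq: "(\<Sum>k\<in>K. \<phi> k \<omega> * indicator {a k<..b k} r)\<^sup>2 =
        (\<Sum>k\<in>K. \<Sum>l\<in>K. (\<phi> k \<omega> * \<phi> l \<omega>) * (indicator {a k<..b k} r * indicator {a l<..b l} r))" for r
      by (simp add: power2_eq_square sum_product mult_ac)
    have int: "integrable lborel (\<lambda>r. (\<Sum>k\<in>K. \<phi> k \<omega> * indicator {a k<..b k} r)\<^sup>2)"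
      unfolding sq by (intro Bochner_Integration.integrable_sum integrable_mult_right ind)
    have val: "(\<integral>r. (\<Sum>k\<in>K. \<phi> k \<omega> * indicator {a k<..b k} r)\<^sup>2 \<partial>lborel) = ?q \<omega>"
      unfolding sq by (subst integral_double_sum) (simp_all add: ind)
    show ?thesis
      using nn_integral_eq_integral[OF int] Bochner_Integration.integral_nonneg[of lborel "\<lambda>r. (\<Sum>k\<in>K. \<phi> k \<omega> * indicator {a k<..b k} r)\<^sup>2"]
      by (simp add: val)
  qed
  have prod_int: "integrable M (\<lambda>\<omega>. \<phi> k \<omega> * \<phi> l \<omega>)" if "k \<in> K" "l \<in> K" for k l
    using L2F_mult_integrable[OF \<phi> \<phi>] ab that by blast
  have q_int: "integrable M ?q"
    by (intro Bochner_Integration.integrable_sum integrable_mult_left prod_int)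
  have q_val: "expectation ?q = (\<Sum>k\<in>K. \<Sum>l\<in>K. expectation (\<lambda>\<omega>. \<phi> k \<omega> * \<phi> l \<omega>) * ?o k l)"
    by (subst integral_double_sum) (simp_all add: prod_int)
  have sq: "(\<Sum>k\<in>K. \<phi> k \<omega> * inc (a k) (b k) \<omega>)\<^sup>2 =
      (\<Sum>k\<in>K. \<Sum>l\<in>K. (\<phi> k \<omega> * inc (a k) (b k) \<omega>) * (\<phi> l \<omega> * inc (a l) (b l) \<omega>))" for \<omega>
    by (simp add: power2_eq_square sum_product)
  have pr: "integrable M (\<lambda>\<omega>. (\<phi> k \<omega> * inc (a k) (b k) \<omega>) * (\<phi> l \<omega> * inc (a l) (b l) \<omega>))"
    "expectation (\<lambda>\<omega>. (\<phi> k \<omega> * inc (a k) (b k) \<omega>) * (\<phi> l \<omega> * inc (a l) (b l) \<omega>)) = v * (expectation (\<lambda>\<omega>. \<phi> k \<omega> * \<phi> l \<omega>) * ?o k l)"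
    if "k \<in> K" "l \<in> K" for k l
    using product_of_increments[OF \<phi> \<phi>] ab that by blast+
  have s_int: "integrable M (\<lambda>\<omega>. (\<Sum>k\<in>K. \<phi> k \<omega> * inc (a k) (b k) \<omega>)\<^sup>2)"
    unfolding sq by (intro Bochner_Integration.integrable_sum pr)
  have "expectation (\<lambda>\<omega>. (\<Sum>k\<in>K. \<phi> k \<omega> * inc (a k) (b k) \<omega>)\<^sup>2) =
      (\<Sum>k\<in>K. \<Sum>l\<in>K. v * (expectation (\<lambda>\<omega>. \<phi> k \<omega> * \<phi> l \<omega>) * ?o k l))"
    unfolding sq
    by (subst integral_double_sum) (simp_all add: pr cong: sum.cong)
  also have "\<dots> = v * expectation ?q" by (simp add: q_val sum_distrib_left)
  finally have val: "expectation (\<lambda>\<omega>. (\<Sum>k\<in>K. \<phi> k \<omega> * inc (a k) (b k) \<omega>)\<^sup>2) = v * expectation ?q" .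
  have "(\<integral>\<^sup>+\<omega>. ennreal ((\<Sum>k\<in>K. \<phi> k \<omega> * inc (a k) (b k) \<omega>)\<^sup>2) \<partial>M) = ennreal (v * expectation ?q)"
    using nn_integral_eq_integral[OF s_int] by (simp add: val)
  also have "\<dots> = ennreal v * ennreal (expectation ?q)"
    using v_nonneg by (rule ennreal_mult) (use inner in \<open>auto intro!: Bochner_Integration.integral_nonneg\<close>)
  also have "ennreal (expectation ?q) = (\<integral>\<^sup>+\<omega>. ennreal (?q \<omega>) \<partial>M)"
    using nn_integral_eq_integral[OF q_int] inner by simp
  finally show ?thesis using inner by simp
qed

text \<open>
  Paths are only almost surely continuous, so joint measurability, which Tonelli's theorem requires, holds
  after setting the exceptional paths to \<open>0\<close>. The result is then a pointwise limit of processes that are piecewise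
  constant in time.
\<close>

lemma measurable_modification:
  obtains X' where "(\<lambda>x. X' (snd x) (fst x)) \<in> borel_measurable (M \<Otimes>\<^sub>M lborel)"
    "AE \<omega> in M. \<forall>r\<ge>0. X' r \<omega> = X r \<omega>"
proof -
  obtain N where N: "{\<omega>\<in>space M. \<not> continuous_on {0..} (\<lambda>t. X t \<omega>)} \<subseteq> N" "N \<in> null_sets M"
    using AE_E[OF paths] by (metis null_setsI)
  define X' where "X' r \<omega> = (if \<omega> \<in> N then 0 else X (max 0 r) \<omega>)" for r \<omega>
  have meas: "X' r \<in> borel_measurable M" for r
    unfolding X'_def using N(2) measurable_X[of "max 0 r"] by (intro measurable_If_set) auto
  define g where "g = (\<lambda>n r. real_of_int \<lfloor>r * real (Suc n)\<rfloor> / real (Suc n))"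
  have g: "(\<lambda>n. g n r) \<longlonglongrightarrow> r" for r
  proof -
    have "norm (g n r - r) \<le> inverse (real (Suc n))" for n
    proof -
      have "g n r - r = (real_of_int \<lfloor>r * real (Suc n)\<rfloor> - r * real (Suc n)) / real (Suc n)"
        by (simp add: g_def diff_divide_distrib del: of_nat_Suc)
      also have "norm \<dots> \<le> 1 / real (Suc n)"
        unfolding real_norm_def abs_divide abs_of_nat by (intro divide_right_mono) linarith+
      finally show ?thesis by (simp add: inverse_eq_divide)
    qed
    then have "(\<lambda>n. g n r - r) \<longlonglongrightarrow> 0"
      by (intro Lim_null_comparison[OF always_eventually LIMSEQ_inverse_real_of_nat]) auto
    then show ?thesis by (simp add: LIM_zero_iff)
  qed
  have "(\<lambda>x. X' (snd x) (fst x)) \<in> borel_measurable (M \<Otimes>\<^sub>M lborel)"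
  proof (rule borel_measurable_LIMSEQ_metric)
    fix n
    have fl: "(\<lambda>x. \<lfloor>snd x * real (Suc n)\<rfloor>) \<in> measurable (M \<Otimes>\<^sub>M lborel) (count_space UNIV)"
      by measurable
    show "(\<lambda>x. X' (g n (snd x)) (fst x)) \<in> borel_measurable (M \<Otimes>\<^sub>M lborel)"
      unfolding g_def
      by (rule measurable_compose_countable'[OF _ fl, of "\<lambda>i x. X' (real_of_int i / real (Suc n)) (fst x)"])
        (auto intro: measurable_compose[OF measurable_fst meas])
  next
    fix x :: "'w \<times> real" assume "x \<in> space (M \<Otimes>\<^sub>M lborel)"
    then have x: "fst x \<in> space M" by (auto simp: space_pair_measure)
    show "(\<lambda>n. X' (g n (snd x)) (fst x)) \<longlonglongrightarrow> X' (snd x) (fst x)"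
    proof (cases "fst x \<in> N")
      case False
      then have "continuous_on {0..} (\<lambda>t. X t (fst x))" using N(1) x by blast
      moreover have "(\<lambda>n. max 0 (g n (snd x))) \<longlonglongrightarrow> max 0 (snd x)" by (intro tendsto_intros g)
      ultimately have "(\<lambda>n. X (max 0 (g n (snd x))) (fst x)) \<longlonglongrightarrow> X (max 0 (snd x)) (fst x)"
        by (rule continuous_on_tendsto_compose) auto
      then show ?thesis using False by (simp add: X'_def)
    qed (simp add: X'_def)
  qed
  moreover have "AE \<omega> in M. \<forall>r\<ge>0. X' r \<omega> = X r \<omega>"
    using AE_not_in[OF N(2)] by eventually_elim (simp add: X'_def)
  ultimately show ?thesis by (rule that)
qed

lemma L2F_X:
  assumes "0 \<le> t" shows "L2F t (X t)"
  unfolding L2F_def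
proof
  show "X t \<in> borel_measurable (F t)" by (rule adapted[OF assms])
  have [measurable]: "X t \<in> borel_measurable M" "X 0 \<in> borel_measurable M" using assms by (auto intro: measurable_X)
  have "integrable M (\<lambda>\<omega>. (X t \<omega>)\<^sup>2) \<longleftrightarrow> integrable M (\<lambda>\<omega>. (inc 0 t \<omega>)\<^sup>2)"
    by (rule integrable_cong_AE) (use start in auto)
  then show "integrable M (\<lambda>\<omega>. (X t \<omega>)\<^sup>2)" using increment_sq_integrable[of 0 t] assms by simp
qed

lemma nn_integral_increment_sq:
  "0 \<le> s \<Longrightarrow> s \<le> t \<Longrightarrow> (\<integral>\<^sup>+\<omega>. ennreal ((inc s t \<omega>)\<^sup>2) \<partial>M) = ennreal (v * (t - s))"
  using nn_integral_eq_integral[OF increment_sq_integrable] by (simp add: increment_sq)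

end

lemma partition_mono:
  fixes p :: "nat \<Rightarrow> real"
  assumes "\<And>i. i < N \<Longrightarrow> p i \<le> p (Suc i)" "i \<le> j" "j \<le> N"
  shows "p i \<le> p j"
  using assms(2,3)
proof (induction j rule: dec_induct)
  case (step j)
  then show ?case using assms(1)[of j] by simp
qed simp

lemma ennreal_square_add_le: "ennreal ((x + y)\<^sup>2) \<le> 2 * ennreal (x\<^sup>2) + 2 * ennreal (y\<^sup>2)" for x y :: real
proof -
  have "(x + y)\<^sup>2 \<le> 2 * x\<^sup>2 + 2 * y\<^sup>2" using sum_squares_bound[of x y] by (simp add: power2_sum)
  then have "ennreal ((x + y)\<^sup>2) \<le> ennreal (2 * x\<^sup>2 + 2 * y\<^sup>2)" by (intro ennreal_leI)
  also have "\<dots> = 2 * ennreal (x\<^sup>2) + 2 * ennreal (y\<^sup>2)" by (simp add: ennreal_mult ennreal_plus)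
  finally show ?thesis .
qed

lemma (in filtered_brownian) step_process_error:
  fixes p :: "nat \<Rightarrow> real"
  assumes p0: "p 0 = 0" and pN: "p N = t" and p_mono: "\<And>i. i < N \<Longrightarrow> p i \<le> p (Suc i)"
    and mesh: "\<And>i. i < N \<Longrightarrow> p (Suc i) - p i \<le> h" and r: "r \<in> {0..t}"
  shows "(\<integral>\<^sup>+\<omega>. ennreal ((X r \<omega> - (\<Sum>i<N. X (p i) \<omega> * indicator {p i<..p (Suc i)} r))\<^sup>2) \<partial>M) \<le> ennreal (v * h)"
proof -
  have p_le: "p i \<le> p j" if "i \<le> j" "j \<le> N" for i j using partition_mono[of N p] p_mono that by blast
  show ?thesis
  proof (cases "r = 0")
    case True
    have "(\<Sum>i<N. X (p i) \<omega> * indicator {p i<..p (Suc i)} r) = 0" for \<omega>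
      using p_le[of 0] p0 True by (intro sum.neutral) (auto simp: indicator_def not_less)
    moreover have "(\<integral>\<^sup>+\<omega>. ennreal ((X r \<omega> - 0)\<^sup>2) \<partial>M) = (\<integral>\<^sup>+\<omega>. 0 \<partial>M)"
      by (rule nn_integral_cong_AE) (use start True in auto)
    ultimately show ?thesis by simp
  next
    case False
    then have r0: "0 < r" "r \<le> t" using r by auto
    \<comment> \<open>The step just before index \<open>j\<close> is the one that contains \<open>r\<close>; all other indicators vanish at \<open>r\<close>.\<close>
    define j where "j = (LEAST j. r \<le> p j)"
    have j: "r \<le> p j" unfolding j_def by (rule LeastI[of _ N]) (use pN r0 in simp)
    have j_least: "p k < r" if "k < j" for k
      using not_less_Least[of k "\<lambda>j. r \<le> p j"] that by (simp add: j_def)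
    have "j \<le> N" unfolding j_def by (rule Least_le) (use pN r0 in simp)
    moreover have "j \<noteq> 0" using j p0 r0 by (intro notI) simp
    ultimately obtain i where i: "j = Suc i" "i < N" by (metis Suc_le_lessD not0_implies_Suc)
    have ri: "p i < r" "r \<le> p (Suc i)" using j j_least[of i] i by auto
    have p_nonneg: "0 \<le> p i" using p_le[of 0 i] p0 i by simp
    have "(\<Sum>k<N. X (p k) \<omega> * indicator {p k<..p (Suc k)} r) = (\<Sum>k<N. if k = i then X (p i) \<omega> else 0)" for \<omega>
    proof (rule sum.cong[OF refl])
      fix k assume k: "k \<in> {..<N}"
      consider "k < i" | "k = i" | "i < k" by linarith
      then show "X (p k) \<omega> * indicator {p k<..p (Suc k)} r = (if k = i then X (p i) \<omega> else 0)"
      proof cases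
        case 1 then show ?thesis using p_le[of "Suc k" i] i ri by (auto simp: indicator_def)
      next
        case 2 then show ?thesis using ri by (auto simp: indicator_def)
      next
        case 3 then show ?thesis using p_le[of "Suc i" k] k ri by (auto simp: indicator_def)
      qed
    qed
    then have "(\<Sum>k<N. X (p k) \<omega> * indicator {p k<..p (Suc k)} r) = X (p i) \<omega>" for \<omega>
      using i by simp
    then have "(\<integral>\<^sup>+\<omega>. ennreal ((X r \<omega> - (\<Sum>i<N. X (p i) \<omega> * indicator {p i<..p (Suc i)} r))\<^sup>2) \<partial>M) = ennreal (v * (r - p i))"
      using nn_integral_increment_sq[of "p i" r] p_nonneg ri by simp
    also have "\<dots> \<le> ennreal (v * h)"
      using v_nonneg ri mesh[OF i(2)] by (intro ennreal_leI mult_left_mono) auto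
    finally show ?thesis .
  qed
qed

text \<open>
  The Ito integral \<open>J\<close> is an \<open>L\<^sup>2\<close>-limit of integrals of some bounded simple processes, whereas the
  Riemann sum is the integral of an unbounded step process. The isometry, applied to the difference of the
  two, bounds their \<open>L\<^sup>2\<close>-distance through \<open>H\<close>: the simple processes approach \<open>H\<close> by definition, and the
  step process is within \<open>vH h\<close> of \<open>H\<close> at each time, in mean square, by \<open>step_process_error\<close>.
\<close>

lemma (in filtered_brownian) ito_riemann_sum_error:
  fixes p :: "nat \<Rightarrow> real"
  assumes H: "filtered_brownian M F H vH"
    and ito: "has_ito_integral M F X H t J"
    and p0: "p 0 = 0" and pN: "p N = t" and p_mono: "\<And>i. i < N \<Longrightarrow> p i \<le> p (Suc i)"
    and mesh: "\<And>i. i < N \<Longrightarrow> p (Suc i) - p i \<le> h" and h: "h \<ge> 0"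
  shows "(\<integral>\<^sup>+\<omega>. ennreal ((J \<omega> - (\<Sum>i<N. H (p i) \<omega> * (X (p (Suc i)) \<omega> - X (p i) \<omega>)))\<^sup>2) \<partial>M)
    \<le> ennreal (4 * v * (vH * h * t))"
proof -
  interpret H: filtered_brownian M F H vH by (rule H)
  note sum_mult_indicator [simp del]
  have p_le: "p i \<le> p j" if "i \<le> j" "j \<le> N" for i j using partition_mono[of N p] p_mono that by blast
  have p_range: "0 \<le> p i" "p i \<le> t" if "i \<le> N" for i using p_le[of 0 i] p_le[of i N] p0 pN that by auto
  have t: "t \<ge> 0" using p_range[of N] pN by simp
  obtain n \<tau> \<phi> where J [measurable]: "J \<in> borel_measurable M" and sdata: "\<And>k. simple_data F t (n k) (\<tau> k) (\<phi> k)"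
    and limH: "(\<lambda>k. \<integral>\<^sup>+\<omega>. (\<integral>\<^sup>+r\<in>{0..t}.
               ennreal ((simple_process (n k) (\<tau> k) (\<phi> k) r \<omega> - H r \<omega>)\<^sup>2) \<partial>lborel) \<partial>M) \<longlonglongrightarrow> 0"
    and limJ: "(\<lambda>k. \<integral>\<^sup>+\<omega>. ennreal ((simple_integral X (n k) (\<tau> k) (\<phi> k) \<omega> - J \<omega>)\<^sup>2) \<partial>M) \<longlonglongrightarrow> 0"
    using ito unfolding has_ito_integral_def
    by (elim conjE exE, intro that) (assumption | erule spec)+
  have \<tau>: "0 \<le> \<tau> k i" "\<tau> k i \<le> t" if "i \<le> n k" for k i
    using partition_mono[of "n k" "\<tau> k" 0 i] partition_mono[of "n k" "\<tau> k" i "n k"] sdata[of k] that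
    by (auto simp: simple_data_def)
  have \<tau>_mono: "\<tau> k i \<le> \<tau> k (Suc i)" if "i < n k" for k i using sdata[of k] that by (auto simp: simple_data_def)
  have \<phi>_meas: "\<phi> k i \<in> borel_measurable (F (\<tau> k i))" if "i < n k" for k i
    using sdata[of k] that by (auto simp: simple_data_def)
  have \<phi>_L2: "L2F (\<tau> k i) (\<phi> k i)" if i: "i < n k" for k i
  proof -
    obtain C where C: "\<And>\<omega>. \<omega> \<in> space M \<Longrightarrow> \<bar>\<phi> k i \<omega>\<bar> \<le> C"
      using sdata[of k] i unfolding simple_data_def space_F by blast
    have "\<phi> k i \<in> borel_measurable M" using measurable_F[OF \<phi>_meas] \<tau> i by simp
    then have "integrable M (\<lambda>\<omega>. (\<phi> k i \<omega>)\<^sup>2)"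
      using C by (intro integrable_const_bound[where B = "C\<^sup>2"]) (auto intro!: AE_I2 abs_le_square_iff[THEN iffD1] order_trans[OF _ abs_ge_self])
    then show ?thesis using \<phi>_meas[OF i] by (simp add: L2F_def)
  qed
  let ?R = "\<lambda>\<omega>. \<Sum>i<N. H (p i) \<omega> * inc (p i) (p (Suc i)) \<omega>"
  let ?P = "\<lambda>r \<omega>. \<Sum>i<N. H (p i) \<omega> * indicator {p i<..p (Suc i)} r"
  let ?S = "\<lambda>k. simple_process (n k) (\<tau> k) (\<phi> k)"
  let ?I = "\<lambda>k. simple_integral X (n k) (\<tau> k) (\<phi> k)"
  obtain H' where H' [measurable]: "(\<lambda>x. H' (snd x) (fst x)) \<in> borel_measurable (M \<Otimes>\<^sub>M lborel)"
    and H'_eq: "AE \<omega> in M. \<forall>r\<ge>0. H' r \<omega> = H r \<omega>"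
    using H.measurable_modification .
  define E where "E k = (\<integral>\<^sup>+\<omega>. (\<integral>\<^sup>+r\<in>{0..t}. ennreal ((?S k r \<omega> - H r \<omega>)\<^sup>2) \<partial>lborel) \<partial>M)" for k
  have [measurable]: "H (p i) \<in> borel_measurable M" "X (p i) \<in> borel_measurable M" if "i < Suc N" for i
    using that p_range by (auto intro: measurable_X H.measurable_X)
  have P_meas [measurable]: "(\<lambda>x. ?P (snd x) (fst x)) \<in> borel_measurable (M \<Otimes>\<^sub>M lborel)"
    by (intro borel_measurable_sum) measurable
  have R_meas [measurable]: "?R \<in> borel_measurable M"
    by (intro borel_measurable_sum borel_measurable_times) measurable
  have S_meas [measurable]: "(\<lambda>x. ?S k (snd x) (fst x)) \<in> borel_measurable (M \<Otimes>\<^sub>M lborel)" for k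
  proof -
    have [measurable]: "\<phi> k i \<in> borel_measurable M" if "i < n k" for i
      using measurable_F[OF \<phi>_meas] \<tau> that by simp
    show ?thesis unfolding simple_process_def by (intro borel_measurable_sum) measurable
  qed
  have I_meas [measurable]: "?I k \<in> borel_measurable M" for k
    unfolding simple_integral_def
    by (intro borel_measurable_sum borel_measurable_times borel_measurable_diff measurable_F[OF \<phi>_meas] measurable_X)
      (use \<tau> in auto)
  have isometry: "(\<integral>\<^sup>+\<omega>. ennreal ((?I k \<omega> - ?R \<omega>)\<^sup>2) \<partial>M) =
      ennreal v * (\<integral>\<^sup>+\<omega>. (\<integral>\<^sup>+r\<in>{0..t}. ennreal ((?S k r \<omega> - ?P r \<omega>)\<^sup>2) \<partial>lborel) \<partial>M)" for k
  proof -
    \<comment> \<open>The difference of the two step processes is one step process, indexed by the disjoint sum of the index sets.\<close>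
    let ?K = "{..<n k} <+> {..<N}"
    let ?\<psi> = "case_sum (\<phi> k) (\<lambda>i \<omega>. - H (p i) \<omega>)"
    let ?a = "case_sum (\<tau> k) p" and ?b = "case_sum (\<lambda>i. \<tau> k (Suc i)) (\<lambda>i. p (Suc i))"
    have "(\<integral>\<^sup>+\<omega>. ennreal ((\<Sum>l\<in>?K. ?\<psi> l \<omega> * inc (?a l) (?b l) \<omega>)\<^sup>2) \<partial>M) =
      ennreal v * (\<integral>\<^sup>+\<omega>. (\<integral>\<^sup>+r. ennreal ((\<Sum>l\<in>?K. ?\<psi> l \<omega> * indicator {?a l<..?b l} r)\<^sup>2) \<partial>lborel) \<partial>M)"
    proof (rule ito_isometry)
      show "L2F (?a l) (?\<psi> l)" if "l \<in> ?K" for l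
        using that \<phi>_L2 H.L2F_X[of "p _"] p_range by (auto simp: L2F_def H.L2F_def)
    qed (use \<tau> \<tau>_mono p_range p_mono in auto)
    moreover have "(\<Sum>l\<in>?K. ?\<psi> l \<omega> * inc (?a l) (?b l) \<omega>) = ?I k \<omega> - ?R \<omega>" for \<omega>
      by (simp add: sum.Plus simple_integral_def comp_def sum_negf)
    moreover have "(\<Sum>l\<in>?K. ?\<psi> l \<omega> * indicator {?a l<..?b l} r) = ?S k r \<omega> - ?P r \<omega>" for r \<omega>
      by (subst sum.Plus) (simp_all only: finite_lessThan simple_process_def comp_def sum.case
          mult_minus_left sum_negf diff_conv_add_uminus)
    moreover have "ennreal ((?S k r \<omega> - ?P r \<omega>)\<^sup>2) = ennreal ((?S k r \<omega> - ?P r \<omega>)\<^sup>2) * indicator {0..t} r" for r \<omega>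
    proof (cases "r \<in> {0..t}")
      case False
      then have "?S k r \<omega> = 0" "?P r \<omega> = 0"
        using \<tau> p_range unfolding simple_process_def
        by (auto intro!: sum.neutral simp: indicator_def) (meson Suc_leI less_imp_le not_le order_trans order_less_le_trans)+
      then show ?thesis by simp
    qed simp
    ultimately show ?thesis by simp
  qed
  have G: "(\<integral>\<^sup>+\<omega>. (\<integral>\<^sup>+r\<in>{0..t}. ennreal ((H' r \<omega> - ?P r \<omega>)\<^sup>2) \<partial>lborel) \<partial>M) \<le> ennreal (vH * h * t)"
  proof -
    interpret P: pair_sigma_finite M lborel ..
    have "(\<integral>\<^sup>+\<omega>. (\<integral>\<^sup>+r\<in>{0..t}. ennreal ((H' r \<omega> - ?P r \<omega>)\<^sup>2) \<partial>lborel) \<partial>M) =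
        (\<integral>\<^sup>+r. (\<integral>\<^sup>+\<omega>. ennreal ((H' r \<omega> - ?P r \<omega>)\<^sup>2) * indicator {0..t} r \<partial>M) \<partial>lborel)"
      by (rule P.Fubini'[symmetric]) (simp add: case_prod_beta)
    also have "\<dots> \<le> (\<integral>\<^sup>+r. ennreal (vH * h) * indicator {0..t} r \<partial>lborel)"
    proof (rule nn_integral_mono)
      fix r
      show "(\<integral>\<^sup>+\<omega>. ennreal ((H' r \<omega> - ?P r \<omega>)\<^sup>2) * indicator {0..t} r \<partial>M) \<le> ennreal (vH * h) * indicator {0..t} r"
      proof (cases "r \<in> {0..t}")
        case True
        have "(\<integral>\<^sup>+\<omega>. ennreal ((H' r \<omega> - ?P r \<omega>)\<^sup>2) \<partial>M) = (\<integral>\<^sup>+\<omega>. ennreal ((H r \<omega> - ?P r \<omega>)\<^sup>2) \<partial>M)"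
          by (rule nn_integral_cong_AE) (use H'_eq True in auto)
        also have "\<dots> \<le> ennreal (vH * h)"
          using H.step_process_error[OF p0 pN p_mono mesh True] by simp
        finally show ?thesis using True by simp
      qed simp
    qed
    also have "\<dots> = ennreal (vH * h) * ennreal t"
      using t by (simp add: nn_integral_cmult_indicator)
    finally show ?thesis using t h H.v_nonneg by (simp add: ennreal_mult[symmetric])
  qed
  have D: "(\<integral>\<^sup>+\<omega>. (\<integral>\<^sup>+r\<in>{0..t}. ennreal ((?S k r \<omega> - ?P r \<omega>)\<^sup>2) \<partial>lborel) \<partial>M) \<le> 2 * E k + 2 * ennreal (vH * h * t)" for k
  proof -
    let ?A = "\<lambda>\<omega> r. ennreal ((?S k r \<omega> - H' r \<omega>)\<^sup>2) * indicator {0..t} r"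
    let ?B = "\<lambda>\<omega> r. ennreal ((H' r \<omega> - ?P r \<omega>)\<^sup>2) * indicator {0..t} r"
    have "(\<integral>\<^sup>+\<omega>. (\<integral>\<^sup>+r\<in>{0..t}. ennreal ((?S k r \<omega> - ?P r \<omega>)\<^sup>2) \<partial>lborel) \<partial>M) \<le>
       (\<integral>\<^sup>+\<omega>. (\<integral>\<^sup>+r. 2 * ?A \<omega> r + 2 * ?B \<omega> r \<partial>lborel) \<partial>M)"
    proof (intro nn_integral_mono)
      fix \<omega> r
      show "ennreal ((?S k r \<omega> - ?P r \<omega>)\<^sup>2) * indicator {0..t} r \<le> 2 * ?A \<omega> r + 2 * ?B \<omega> r"
        using ennreal_square_add_le[of "?S k r \<omega> - H' r \<omega>" "H' r \<omega> - ?P r \<omega>"] by (auto simp: indicator_def)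
    qed
    also have "\<dots> = (\<integral>\<^sup>+x. 2 * ?A (fst x) (snd x) + 2 * ?B (fst x) (snd x) \<partial>(M \<Otimes>\<^sub>M lborel))"
      by (subst lborel.nn_integral_fst[symmetric]) simp_all
    also have "\<dots> = 2 * (\<integral>\<^sup>+x. ?A (fst x) (snd x) \<partial>(M \<Otimes>\<^sub>M lborel)) + 2 * (\<integral>\<^sup>+x. ?B (fst x) (snd x) \<partial>(M \<Otimes>\<^sub>M lborel))"
      by (simp add: nn_integral_add nn_integral_cmult)
    also have "(\<integral>\<^sup>+x. ?A (fst x) (snd x) \<partial>(M \<Otimes>\<^sub>M lborel)) = (\<integral>\<^sup>+\<omega>. (\<integral>\<^sup>+r. ?A \<omega> r \<partial>lborel) \<partial>M)"
      by (subst lborel.nn_integral_fst[symmetric]) simp_all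
    also have "\<dots> = E k"
      unfolding E_def using H'_eq
      by (intro nn_integral_cong_AE, eventually_elim) (auto intro!: nn_integral_cong simp: indicator_def)
    also have "(\<integral>\<^sup>+x. ?B (fst x) (snd x) \<partial>(M \<Otimes>\<^sub>M lborel)) = (\<integral>\<^sup>+\<omega>. (\<integral>\<^sup>+r. ?B \<omega> r \<partial>lborel) \<partial>M)"
      by (subst lborel.nn_integral_fst[symmetric]) simp_all
    finally show ?thesis using G by (meson add_left_mono mult_left_mono order_trans zero_le)
  qed
  define a where "a k = (\<integral>\<^sup>+\<omega>. ennreal ((?I k \<omega> - J \<omega>)\<^sup>2) \<partial>M)" for k
  have bound: "(\<integral>\<^sup>+\<omega>. ennreal ((J \<omega> - ?R \<omega>)\<^sup>2) \<partial>M) \<le> 2 * a k + 2 * (ennreal v * (2 * E k + 2 * ennreal (vH * h * t)))" for k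
  proof -
    have "(\<integral>\<^sup>+\<omega>. ennreal ((J \<omega> - ?R \<omega>)\<^sup>2) \<partial>M) \<le> (\<integral>\<^sup>+\<omega>. 2 * ennreal ((?I k \<omega> - J \<omega>)\<^sup>2) + 2 * ennreal ((?I k \<omega> - ?R \<omega>)\<^sup>2) \<partial>M)"
    proof (rule nn_integral_mono)
      fix \<omega>
      show "ennreal ((J \<omega> - ?R \<omega>)\<^sup>2) \<le> 2 * ennreal ((?I k \<omega> - J \<omega>)\<^sup>2) + 2 * ennreal ((?I k \<omega> - ?R \<omega>)\<^sup>2)"
        using ennreal_square_add_le[of "J \<omega> - ?I k \<omega>" "?I k \<omega> - ?R \<omega>"] by (simp add: power2_commute[of "J \<omega>"])
    qed
    also have "\<dots> = 2 * a k + 2 * (\<integral>\<^sup>+\<omega>. ennreal ((?I k \<omega> - ?R \<omega>)\<^sup>2) \<partial>M)"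
      unfolding a_def by (simp add: nn_integral_add nn_integral_cmult)
    also have "\<dots> \<le> 2 * a k + 2 * (ennreal v * (2 * E k + 2 * ennreal (vH * h * t)))"
      unfolding isometry by (intro add_left_mono mult_left_mono D) simp_all
    finally show ?thesis .
  qed
  have "(\<lambda>k. 2 * a k + 2 * (ennreal v * (2 * E k + 2 * ennreal (vH * h * t)))) \<longlonglongrightarrow>
      2 * 0 + 2 * (ennreal v * (2 * 0 + 2 * ennreal (vH * h * t)))"
    using limH limJ unfolding a_def E_def
    by (intro tendsto_add ennreal_tendsto_cmult tendsto_const) auto
  from LIMSEQ_le_const[OF this] bound
  have "(\<integral>\<^sup>+\<omega>. ennreal ((J \<omega> - ?R \<omega>)\<^sup>2) \<partial>M) \<le> 2 * (ennreal v * (2 * ennreal (vH * h * t)))" by auto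
  also have "\<dots> = ennreal (4 * v * (vH * h * t))"
    using v_nonneg H.v_nonneg h t by (simp add: ennreal_mult[symmetric] ennreal_numeral[symmetric] del: ennreal_numeral)
  finally show ?thesis .
qed

section \<open>The standard Gaussian measure\<close>

lemma sets_std_gaussian [simp, measurable_cong]: "sets std_gaussian = sets borel"
  by (simp add: std_gaussian_def)

lemma space_std_gaussian [simp]: "space std_gaussian = UNIV"
  by (simp add: std_gaussian_def)

lemma nn_integral_lborel_scale:
  fixes f :: "'e::euclidean_space \<Rightarrow> ennreal"
  assumes [measurable]: "f \<in> borel_measurable borel" and c: "c \<noteq> 0"
  shows "(\<integral>\<^sup>+x. f x \<partial>lborel) = ennreal (\<bar>c\<bar> ^ DIM('e)) * (\<integral>\<^sup>+x. f (c *\<^sub>R x) \<partial>lborel)"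
  by (subst lborel_affine[OF c, of 0]) (simp add: nn_integral_density nn_integral_distr nn_integral_cmult)

text \<open>
  The factor \<open>(norm x)\<^sup>2\<close> is absorbed into \<open>4 exp((norm x)\<^sup>2 / 4)\<close>, and dilation by \<open>sqrt 2\<close> turns the remaining
  exponential into the Gaussian density, whose total mass is given.
\<close>

lemma std_gaussian_second_moment_finite:
  assumes "prob_space (std_gaussian :: 'e::euclidean_space measure)"
  shows "(\<integral>\<^sup>+x. ennreal ((norm x)\<^sup>2) \<partial>(std_gaussian :: 'e measure)) < \<infinity>"
proof -
  define k :: real where "k = (2 * pi) powr (- (DIM('e) / 2))"
  have k: "k > 0" by (simp add: k_def)
  have "1 = (\<integral>\<^sup>+x. 1 \<partial>(std_gaussian :: 'e measure))"
    using prob_space.emeasure_space_1[OF assms] by simp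
  also have "\<dots> = (\<integral>\<^sup>+x. ennreal k * ennreal (exp (- (norm x)\<^sup>2 / 2)) \<partial>(lborel :: 'e measure))"
    unfolding std_gaussian_def k_def[symmetric] by (subst nn_integral_density) (simp_all add: ennreal_mult k less_imp_le)
  also have "\<dots> = ennreal k * (\<integral>\<^sup>+x. ennreal (exp (- (norm x)\<^sup>2 / 2)) \<partial>(lborel :: 'e measure))"
    by (simp add: nn_integral_cmult)
  finally have total: "(\<integral>\<^sup>+x. ennreal (exp (- (norm x)\<^sup>2 / 2)) \<partial>(lborel :: 'e measure)) < \<infinity>"
    using k by (auto simp: less_top[symmetric] ennreal_mult_top)
  have "(\<integral>\<^sup>+x. ennreal ((norm x)\<^sup>2) \<partial>(std_gaussian :: 'e measure)) =
      (\<integral>\<^sup>+x. ennreal (k * exp (- (norm x)\<^sup>2 / 2)) * ennreal ((norm x)\<^sup>2) \<partial>(lborel :: 'e measure))"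
    unfolding std_gaussian_def k_def[symmetric] by (subst nn_integral_density) simp_all
  also have "\<dots> \<le> (\<integral>\<^sup>+x. ennreal (4 * k) * ennreal (exp (- (norm x)\<^sup>2 / 4)) \<partial>(lborel :: 'e measure))"
  proof (rule nn_integral_mono)
    fix x :: 'e
    let ?u = "(norm x)\<^sup>2 / 4"
    have "?u \<le> exp ?u" using exp_ge_add_one_self[of ?u] by linarith
    then have "exp (- (norm x)\<^sup>2 / 2) * (norm x)\<^sup>2 \<le> exp (- (norm x)\<^sup>2 / 2) * (4 * exp ?u)"
      by (intro mult_left_mono) auto
    also have "\<dots> = 4 * exp (- (norm x)\<^sup>2 / 4)"
      by (simp add: exp_add[symmetric] field_simps)
    finally have "k * exp (- (norm x)\<^sup>2 / 2) * (norm x)\<^sup>2 \<le> 4 * k * exp (- (norm x)\<^sup>2 / 4)"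
      using k mult_left_mono[of _ _ k] by (simp add: mult_ac)
    then show "ennreal (k * exp (- (norm x)\<^sup>2 / 2)) * ennreal ((norm x)\<^sup>2) \<le> ennreal (4 * k) * ennreal (exp (- (norm x)\<^sup>2 / 4))"
      using k by (simp add: ennreal_mult[symmetric])
  qed
  also have "\<dots> = ennreal (4 * k) * (\<integral>\<^sup>+x. ennreal (exp (- (norm x)\<^sup>2 / 4)) \<partial>(lborel :: 'e measure))"
    by (simp add: nn_integral_cmult)
  also have "(\<integral>\<^sup>+x. ennreal (exp (- (norm x)\<^sup>2 / 4)) \<partial>(lborel :: 'e measure)) =
      ennreal (\<bar>sqrt 2\<bar> ^ DIM('e)) * (\<integral>\<^sup>+x. ennreal (exp (- (norm x)\<^sup>2 / 2)) \<partial>(lborel :: 'e measure))"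
    by (subst nn_integral_lborel_scale[of _ "sqrt 2"]) (simp_all add: power_mult_distrib)
  also have "ennreal (4 * k) * \<dots> < \<infinity>"
    using total by (simp add: ennreal_mult_eq_top_iff less_top[symmetric])
  finally show ?thesis .
qed

lemma std_gaussian_uminus: "distr std_gaussian borel uminus = (std_gaussian :: 'e::euclidean_space measure)"
proof -
  have l: "(lborel :: 'e measure) = distr lborel borel uminus"
    using lborel_affine[of "-1" "0 :: 'e"] by (simp add: density_1)
  show ?thesis
    unfolding std_gaussian_def
    by (subst (2) l) (simp add: density_distr)
qed

lemma std_gaussian_component_mean:
  "(\<integral>x. x $ j \<partial>(std_gaussian :: (real^'d::finite) measure)) = 0"
proof -
  have "(\<integral>x. x $ j \<partial>(std_gaussian :: (real^'d) measure)) = (\<integral>x. x $ j \<partial>(distr std_gaussian borel uminus :: (real^'d) measure))"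
    by (simp add: std_gaussian_uminus)
  also have "\<dots> = (\<integral>x. - (x $ j) \<partial>(std_gaussian :: (real^'d) measure))"
    by (subst integral_distr) simp_all
  finally show ?thesis by simp
qed

lemma std_gaussian_component_sq_integrable:
  assumes "prob_space (std_gaussian :: (real^'d::finite) measure)"
  shows "integrable (std_gaussian :: (real^'d) measure) (\<lambda>x. (x $ j)\<^sup>2)"
proof (rule integrableI_bounded)
  have "(\<integral>\<^sup>+x. ennreal (norm ((x $ j)\<^sup>2)) \<partial>(std_gaussian :: (real^'d) measure)) \<le>
      (\<integral>\<^sup>+x. ennreal ((norm x)\<^sup>2) \<partial>(std_gaussian :: (real^'d) measure))"
    by (intro nn_integral_mono ennreal_leI) (simp add: abs_le_square_iff[symmetric] component_le_norm_cart)
  then show "(\<integral>\<^sup>+x. ennreal (norm ((x $ j)\<^sup>2)) \<partial>(std_gaussian :: (real^'d) measure)) < \<infinity>"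
    using std_gaussian_second_moment_finite[OF assms] by (rule le_less_trans)
qed simp

lemma std_gaussian_pair:
  assumes "prob_space (std_gaussian :: (real^'d::finite) measure)"
  shows "(std_gaussian :: ((real^'d) \<times> (real^'d)) measure) = std_gaussian \<Otimes>\<^sub>M std_gaussian"
proof -
  let ?g = "\<lambda>x :: real^'d. ennreal ((2 * pi) powr (- (DIM(real^'d) / 2)) * exp (- (norm x)\<^sup>2 / 2))"
  interpret G: prob_space "density lborel ?g" using assms by (simp add: std_gaussian_def)
  have "density lborel ?g \<Otimes>\<^sub>M density lborel ?g = density (lborel \<Otimes>\<^sub>M lborel) (\<lambda>(x, y). ?g x * ?g y)"
    by (rule pair_measure_density[OF _ _ lborel.sigma_finite_measure_axioms G.sigma_finite_measure_axioms]) simp_all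
  also have "\<dots> = density lborel (\<lambda>(x, y). ?g x * ?g y)" by (simp add: lborel_prod)
  also have "(\<lambda>(x, y). ?g x * ?g y) = (\<lambda>p. ennreal ((2 * pi) powr (- (DIM((real^'d) \<times> (real^'d)) / 2)) * exp (- (norm p)\<^sup>2 / 2)))"
  proof (rule ext, clarify)
    fix x y :: "real^'d"
    have "(norm (x, y))\<^sup>2 = (norm x)\<^sup>2 + (norm y)\<^sup>2" by (simp add: norm_Pair)
    then have "exp (- (norm (x, y))\<^sup>2 / 2) = exp (- (norm x)\<^sup>2 / 2) * exp (- (norm y)\<^sup>2 / 2)"
      by (simp add: exp_add[symmetric] add_divide_distrib)
    moreover have "(2 * pi) powr (- (DIM((real^'d) \<times> (real^'d)) / 2)) =
        (2 * pi) powr (- (DIM(real^'d) / 2)) * (2 * pi) powr (- (DIM(real^'d) / 2))"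
      by (simp add: powr_add[symmetric])
    ultimately show "?g x * ?g y = ennreal ((2 * pi) powr (- (DIM((real^'d) \<times> (real^'d)) / 2)) * exp (- (norm (x, y))\<^sup>2 / 2))"
      by (simp add: ennreal_mult[symmetric] mult_ac)
  qed
  finally show ?thesis by (simp add: std_gaussian_def)
qed

section \<open>Independence and laws of Brownian increments\<close>

lemma generated_algebra_space [simp]: "space (generated_algebra M X I) = space M"
  by (simp add: generated_algebra_def space_measure_of_conv)

lemma sets_generated_algebra:
  "sets (generated_algebra M X I) = sigma_sets (space M) (\<Union>r\<in>I. {X r -` E \<inter> space M | E. E \<in> sets borel})"
  unfolding generated_algebra_def by (rule sets_measure_of) auto

lemma measurable_generated_algebra:
  "r \<in> I \<Longrightarrow> X r \<in> borel_measurable (generated_algebra M X I)"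
  by (rule measurableI) (auto simp: sets_generated_algebra intro!: sigma_sets.Basic)

lemma generated_algebra_least:
  assumes "space N = space M" "\<And>r. r \<in> I \<Longrightarrow> X r \<in> borel_measurable N"
  shows "sets (generated_algebra M X I) \<subseteq> sets N"
proof -
  have "sigma_sets (space N) (\<Union>r\<in>I. {X r -` E \<inter> space M | E. E \<in> sets borel}) \<subseteq> sets N"
    by (rule sets.sigma_sets_subset) (use measurable_sets[OF assms(2)] assms(1) in auto)
  then show ?thesis by (simp add: sets_generated_algebra assms)
qed

text \<open>
  Both families \<open>A1\<close>, \<open>D1\<close> are events of the first component and \<open>A2\<close>, \<open>D2\<close> of the second. Independence across
  components factors the probability of a fourfold intersection, independence within each component factors it
  further, and regrouping gives independence of the joint past from the joint increment.
\<close>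

lemma (in prob_space) indep_setI_Times:
  assumes ind: "indep_set U1 U2"
    and sub: "A1 \<subseteq> U1" "D1 \<subseteq> U1" "A2 \<subseteq> U2" "D2 \<subseteq> U2"
    and U1: "\<And>a d. a \<in> A1 \<Longrightarrow> d \<in> D1 \<Longrightarrow> a \<inter> d \<in> U1" and U2: "\<And>a d. a \<in> A2 \<Longrightarrow> d \<in> D2 \<Longrightarrow> a \<inter> d \<in> U2"
    and 1: "indep_set A1 D1" and 2: "indep_set A2 D2"
  shows "indep_set {a \<inter> b | a b. a \<in> A1 \<and> b \<in> A2} {a \<inter> b | a b. a \<in> D1 \<and> b \<in> D2}"
proof -
  have ev: "U1 \<subseteq> events" "U2 \<subseteq> events" using ind by (auto simp: indep_sets2_eq)
  show ?thesis
    unfolding indep_sets2_eq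
  proof (intro conjI ballI)
    show "{a \<inter> b | a b. a \<in> A1 \<and> b \<in> A2} \<subseteq> events" "{a \<inter> b | a b. a \<in> D1 \<and> b \<in> D2} \<subseteq> events"
      using ev sub by (blast intro: sets.Int)+
    fix x y assume "x \<in> {a \<inter> b | a b. a \<in> A1 \<and> b \<in> A2}" "y \<in> {a \<inter> b | a b. a \<in> D1 \<and> b \<in> D2}"
    then obtain a1 a2 d1 d2 where m: "a1 \<in> A1" "a2 \<in> A2" "d1 \<in> D1" "d2 \<in> D2" and xy: "x = a1 \<inter> a2" "y = d1 \<inter> d2"
      by blast
    have "x \<inter> y = (a1 \<inter> d1) \<inter> (a2 \<inter> d2)" by (auto simp: xy)
    then have "prob (x \<inter> y) = prob (a1 \<inter> d1) * prob (a2 \<inter> d2)"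
      using indep_setD[OF ind U1[OF m(1,3)] U2[OF m(2,4)]] by simp
    also have "\<dots> = (prob a1 * prob a2) * (prob d1 * prob d2)"
      using indep_setD[OF 1 m(1,3)] indep_setD[OF 2 m(2,4)] by simp
    also have "prob a1 * prob a2 = prob x" unfolding xy using indep_setD[OF ind, of a1 a2] m sub by (metis subsetD)
    also have "prob d1 * prob d2 = prob y" unfolding xy using indep_setD[OF ind, of d1 d2] m sub by (metis subsetD)
    finally show "prob (x \<inter> y) = prob x * prob y" .
  qed
qed

lemma (in prob_space) indep_var_measurable:
  assumes ind: "indep_set (sets N1) (sets N2)" and sp: "space N1 = space M" "space N2 = space M"
    and X: "X \<in> borel_measurable N1" and Y: "Y \<in> borel_measurable N2"
  shows "indep_var borel X borel Y"
proof -
  note I = ind[unfolded indep_sets2_eq]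
  have ev: "sets N1 \<subseteq> events" "sets N2 \<subseteq> events" using I by auto
  have sub: "sigma_sets (space M) {X -` E \<inter> space M | E. E \<in> sets borel} \<subseteq> sets N1"
    "sigma_sets (space M) {Y -` E \<inter> space M | E. E \<in> sets borel} \<subseteq> sets N2"
    using sets.sigma_sets_subset[of "{X -` E \<inter> space M | E. E \<in> sets borel}" N1] measurable_sets[OF X]
      sets.sigma_sets_subset[of "{Y -` E \<inter> space M | E. E \<in> sets borel}" N2] measurable_sets[OF Y] sp by auto
  have "X \<in> borel_measurable M" "Y \<in> borel_measurable M"
    using measurable_from_subalg[OF _ X, of M] measurable_from_subalg[OF _ Y, of M] ev sp
    by (auto simp: subalgebra_def)
  then show ?thesis
    unfolding indep_var_eq indep_sets2_eq
  proof (intro conjI ballI)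
    fix a b assume "a \<in> sigma_sets (space M) {X -` E \<inter> space M | E. E \<in> sets borel}"
      "b \<in> sigma_sets (space M) {Y -` E \<inter> space M | E. E \<in> sets borel}"
    then have "a \<in> sets N1" "b \<in> sets N2" using sub by auto
    then show "prob (a \<inter> b) = prob a * prob b" using I by blast
  qed (use order_trans[OF sub(1) ev(1)] order_trans[OF sub(2) ev(2)] in auto)
qed

lemma Int_stable_inter_sets: "Int_stable {a \<inter> b | a b. a \<in> sets N1 \<and> b \<in> sets N2}"
proof (rule Int_stableI)
  fix x y assume "x \<in> {a \<inter> b | a b. a \<in> sets N1 \<and> b \<in> sets N2}" "y \<in> {a \<inter> b | a b. a \<in> sets N1 \<and> b \<in> sets N2}"
  then obtain a b a' b' where xy: "x = a \<inter> b" "y = a' \<inter> b'"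
    and m: "a \<in> sets N1" "a' \<in> sets N1" "b \<in> sets N2" "b' \<in> sets N2" by blast
  have "x \<inter> y = (a \<inter> a') \<inter> (b \<inter> b')" by (auto simp: xy)
  then show "x \<inter> y \<in> {a \<inter> b | a b. a \<in> sets N1 \<and> b \<in> sets N2}"
    using sets.Int[OF m(1,2)] sets.Int[OF m(3,4)] by blast
qed

text \<open>
  The intersections form a generating system of the joint past, and of the joint increment, that is closed
  under intersection; independence therefore only has to be checked on it.
\<close>

lemma borel_measurable_Pair_inter_sets:
  fixes X :: "'w \<Rightarrow> 'e::second_countable_topology" and Y :: "'w \<Rightarrow> 'f::second_countable_topology"
  assumes sp: "space N1 = \<Omega>" "space N2 = \<Omega>" and X: "X \<in> borel_measurable N1" and Y: "Y \<in> borel_measurable N2"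
  shows "(\<lambda>\<omega>. (X \<omega>, Y \<omega>)) \<in> borel_measurable (sigma \<Omega> {a \<inter> b | a b. a \<in> sets N1 \<and> b \<in> sets N2})"
    (is "_ \<in> borel_measurable (sigma \<Omega> ?P)")
proof (rule borel_measurable_Pair)
  have P: "?P \<subseteq> Pow \<Omega>" using sets.sets_into_space[of _ N1] sp by auto
  have top: "\<Omega> \<in> sets N1" "\<Omega> \<in> sets N2" using sets.top[of N1] sets.top[of N2] sp by simp_all
  have mem: "c \<in> sets (sigma \<Omega> ?P)" if "c \<in> sets N1 \<or> c \<in> sets N2" for c
  proof -
    have "c \<subseteq> \<Omega>" using that sets.sets_into_space[of c N1] sets.sets_into_space[of c N2] sp by auto
    then have "c = c \<inter> \<Omega>" "c = \<Omega> \<inter> c" by auto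
    then have "c \<in> ?P" using that top by blast
    then show ?thesis unfolding sets_measure_of[OF P] by (rule sigma_sets.Basic)
  qed
  show "X \<in> borel_measurable (sigma \<Omega> ?P)"
    using measurable_sets[OF X] sp mem[OF disjI1] by (intro measurableI) (simp_all only: space_measure_of[OF P] space_borel UNIV_I)
  show "Y \<in> borel_measurable (sigma \<Omega> ?P)"
    using measurable_sets[OF Y] sp mem[OF disjI2] by (intro measurableI) (simp_all only: space_measure_of[OF P] space_borel UNIV_I)
qed

locale horizontal_brownian =
  fixes M :: "'w measure" and B1 B2 :: "real \<Rightarrow> 'w \<Rightarrow> real^'d::finite" and A :: "real \<Rightarrow> 'w \<Rightarrow> real"
  assumes horizontal: "horizontal_BM M B1 B2 A"
begin

sublocale prob_space M
  using horizontal by (simp add: horizontal_BM_def)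

definition Z :: "real \<Rightarrow> 'w \<Rightarrow> (real^'d) \<times> (real^'d)" where
  "Z r \<omega> = (B1 r \<omega>, B2 r \<omega>)"

definition F :: "real \<Rightarrow> 'w measure" where
  "F s = generated_algebra M Z {0..s}"

lemma BM: "standard_BM M B1" "standard_BM M B2"
  using horizontal by (simp_all add: horizontal_BM_def)

lemma measurable_B [measurable]:
  "0 \<le> t \<Longrightarrow> B1 t \<in> borel_measurable M" "0 \<le> t \<Longrightarrow> B2 t \<in> borel_measurable M"
  using BM by (simp_all add: standard_BM_def)

lemma measurable_A [measurable]: "0 \<le> t \<Longrightarrow> A t \<in> borel_measurable M"
  using horizontal by (simp add: horizontal_BM_def)

lemma measurable_Z [measurable]: "0 \<le> t \<Longrightarrow> Z t \<in> borel_measurable M"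
  unfolding Z_def by (intro borel_measurable_Pair measurable_B)

lemma space_F [simp]: "space (F s) = space M"
  by (simp add: F_def)

lemma sets_F: "sets (F s) \<subseteq> sets M"
  unfolding F_def by (rule generated_algebra_least) auto

lemma F_mono: "s \<le> t \<Longrightarrow> sets (F s) \<subseteq> sets (F t)"
  unfolding F_def by (rule generated_algebra_least) (auto intro: measurable_generated_algebra)

lemma Z_adapted: "0 \<le> r \<Longrightarrow> r \<le> s \<Longrightarrow> Z r \<in> borel_measurable (F s)"
  unfolding F_def by (rule measurable_generated_algebra) simp

text \<open>
  The hypotheses speak of each component and its own past. The Ito integrals live in the joint
  filtration, so they require the increment of the pair to be independent of the past of the pair.
\<close>

lemma increments_indep_set:
  assumes s: "0 \<le> s" and st: "s \<le> t"
  shows "indep_set (sets (F s)) {(\<lambda>\<omega>. Z t \<omega> - Z s \<omega>) -` E \<inter> space M | E. E \<in> sets borel}"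
proof -
  have t: "0 \<le> t" using s st by simp
  let ?G1 = "generated_algebra M B1" and ?G2 = "generated_algebra M B2"
  let ?V1 = "vimage_algebra (space M) (\<lambda>\<omega>. B1 t \<omega> - B1 s \<omega>) borel"
  let ?V2 = "vimage_algebra (space M) (\<lambda>\<omega>. B2 t \<omega> - B2 s \<omega>) borel"
  let ?P = "{a \<inter> b | a b. a \<in> sets (?G1 {0..s}) \<and> b \<in> sets (?G2 {0..s})}"
  let ?Q = "{a \<inter> b | a b. a \<in> sets ?V1 \<and> b \<in> sets ?V2}"
  have V_sub: "sets ?V1 \<subseteq> sets (?G1 {0..})" "sets ?V2 \<subseteq> sets (?G2 {0..})"
  proof -
    have *: "(\<lambda>\<omega>. B1 t \<omega> - B1 s \<omega>) \<in> borel_measurable (?G1 {0..})" "(\<lambda>\<omega>. B2 t \<omega> - B2 s \<omega>) \<in> borel_measurable (?G2 {0..})"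
      using s t by (auto intro!: borel_measurable_diff measurable_generated_algebra)
    show "sets ?V1 \<subseteq> sets (?G1 {0..})" "sets ?V2 \<subseteq> sets (?G2 {0..})"
      using measurable_sets[OF *(1)] measurable_sets[OF *(2)] by (auto simp: sets_vimage_algebra2)
  qed
  have G_sub: "sets (?G1 {0..s}) \<subseteq> sets (?G1 {0..})" "sets (?G2 {0..s}) \<subseteq> sets (?G2 {0..})"
    by (intro generated_algebra_least generated_algebra_space[symmetric] measurable_generated_algebra; simp)+
  have "indep_set (sets (?G1 {0..})) (sets (?G2 {0..}))"
    using horizontal by (simp add: horizontal_BM_def)
  then have PQ: "indep_set ?P ?Q"
  proof (rule indep_setI_Times)
    show "indep_set (sets (?G1 {0..s})) (sets ?V1)" "indep_set (sets (?G2 {0..s})) (sets ?V2)"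
      using BM s st by (simp_all add: standard_BM_def sets_vimage_algebra2)
    show "a \<inter> d \<in> sets (?G1 {0..})" if "a \<in> sets (?G1 {0..s})" "d \<in> sets ?V1" for a d
      using subsetD[OF G_sub(1) that(1)] subsetD[OF V_sub(1) that(2)] by (rule sets.Int)
    show "a \<inter> d \<in> sets (?G2 {0..})" if "a \<in> sets (?G2 {0..s})" "d \<in> sets ?V2" for a d
      using subsetD[OF G_sub(2) that(1)] subsetD[OF V_sub(2) that(2)] by (rule sets.Int)
  qed (fact V_sub G_sub)+
  have *: "indep_set (sigma_sets (space M) ?P) (sigma_sets (space M) ?Q)"
    by (rule indep_set_sigma_sets[OF PQ Int_stable_inter_sets Int_stable_inter_sets])
  note PQ' = PQ[unfolded indep_sets2_eq]
  have P: "?P \<subseteq> Pow (space M)" by (rule order_trans[OF conjunct1[OF PQ'] sets.space_closed])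
  have Q: "?Q \<subseteq> Pow (space M)" by (rule order_trans[OF conjunct1[OF conjunct2[OF PQ']] sets.space_closed])
  have "sets (F s) \<subseteq> sets (sigma (space M) ?P)"
    unfolding F_def Z_def
    by (intro generated_algebra_least borel_measurable_Pair_inter_sets measurable_generated_algebra)
      (simp_all add: space_measure_of[OF P])
  then have F_sub: "sets (F s) \<subseteq> sigma_sets (space M) ?P" unfolding sets_measure_of[OF P] .
  have "(\<lambda>\<omega>. (B1 t \<omega> - B1 s \<omega>, B2 t \<omega> - B2 s \<omega>)) \<in> borel_measurable (sigma (space M) ?Q)"
    by (intro borel_measurable_Pair_inter_sets measurable_vimage_algebra1) simp_all
  then have "(\<lambda>\<omega>. Z t \<omega> - Z s \<omega>) \<in> borel_measurable (sigma (space M) ?Q)"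
    by (simp add: Z_def)
  from measurable_sets[OF this] have D_sub: "{(\<lambda>\<omega>. Z t \<omega> - Z s \<omega>) -` E \<inter> space M | E. E \<in> sets borel} \<subseteq> sigma_sets (space M) ?Q"
    unfolding sets_measure_of[OF Q] space_measure_of[OF Q] by blast
  note I = *[unfolded indep_sets2_eq]
  show ?thesis
    unfolding indep_sets2_eq
  proof (intro conjI ballI)
    show "sets (F s) \<subseteq> events" by (rule sets_F)
    show "{(\<lambda>\<omega>. Z t \<omega> - Z s \<omega>) -` E \<inter> space M | E. E \<in> sets borel} \<subseteq> events"
      by (rule order_trans[OF D_sub conjunct1[OF conjunct2[OF I]]])
    show "prob (a \<inter> b) = prob a * prob b"
      if "a \<in> sets (F s)" "b \<in> {(\<lambda>\<omega>. Z t \<omega> - Z s \<omega>) -` E \<inter> space M | E. E \<in> sets borel}" for a b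
      using bspec[OF bspec[OF conjunct2[OF conjunct2[OF I]] subsetD[OF F_sub that(1)]] subsetD[OF D_sub that(2)]] .
  qed
qed

text \<open>
  The map \<open>g\<close> serves to bring the increment to the type of \<open>Y\<close>, by taking a coordinate or by embedding
  it into the group.
\<close>

lemma increments_indep_var:
  fixes Y :: "'w \<Rightarrow> 'e::topological_space" and g :: "(real^'d) \<times> (real^'d) \<Rightarrow> 'e"
  assumes s: "0 \<le> s" and st: "s \<le> t" and Y: "Y \<in> borel_measurable (F s)" and g: "g \<in> borel_measurable borel"
  shows "indep_var borel Y borel (\<lambda>\<omega>. g (Z t \<omega> - Z s \<omega>))"
proof -
  let ?N = "vimage_algebra (space M) (\<lambda>\<omega>. Z t \<omega> - Z s \<omega>) borel"
  have ind: "indep_set (sets (F s)) (sets ?N)"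
    using increments_indep_set[OF s st] by (simp add: sets_vimage_algebra2)
  have "(\<lambda>\<omega>. Z t \<omega> - Z s \<omega>) \<in> borel_measurable ?N"
    by (rule measurable_vimage_algebra1) simp
  then show ?thesis
    using indep_var_measurable[OF ind _ _ Y measurable_compose[OF _ g]] by simp
qed

lemma increment_law:
  assumes "0 \<le> s" "s \<le> t"
  shows "distr M borel (\<lambda>\<omega>. B1 t \<omega> - B1 s \<omega>) = distr std_gaussian borel (\<lambda>x. sqrt (t - s) *\<^sub>R x)"
    "distr M borel (\<lambda>\<omega>. B2 t \<omega> - B2 s \<omega>) = distr std_gaussian borel (\<lambda>x. sqrt (t - s) *\<^sub>R x)"
  using BM assms by (simp_all add: standard_BM_def)

text \<open>
  The total mass of the Gaussian density is read off from the law of a Brownian increment over a unit interval.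
\<close>

lemma prob_space_gaussian: "prob_space (std_gaussian :: (real^'d) measure)"
proof (rule prob_spaceI)
  have "emeasure (distr M borel (\<lambda>\<omega>. B1 1 \<omega> - B1 0 \<omega>)) UNIV = 1"
    by (simp add: emeasure_distr emeasure_space_1)
  then show "emeasure (std_gaussian :: (real^'d) measure) (space std_gaussian) = 1"
    unfolding increment_law(1)[of 0 1, simplified] by (simp add: emeasure_distr)
qed

lemma prob_space_gaussian_pair: "prob_space (std_gaussian :: ((real^'d) \<times> (real^'d)) measure)"
proof -
  interpret G: prob_space "std_gaussian :: (real^'d) measure" by (rule prob_space_gaussian)
  interpret GG: pair_prob_space "std_gaussian :: (real^'d) measure" "std_gaussian :: (real^'d) measure" ..
  show ?thesis unfolding std_gaussian_pair[OF prob_space_gaussian] by (rule GG.prob_space_axioms)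
qed

lemma joint_increment_law:
  assumes "0 \<le> s" "s \<le> t"
  shows "distr M borel (\<lambda>\<omega>. Z t \<omega> - Z s \<omega>) = distr std_gaussian borel (\<lambda>\<zeta>. sqrt (t - s) *\<^sub>R \<zeta>)"
proof -
  interpret G: prob_space "std_gaussian :: (real^'d) measure" by (rule prob_space_gaussian)
  interpret D: prob_space "distr (std_gaussian :: (real^'d) measure) borel (\<lambda>x. sqrt (t - s) *\<^sub>R x)"
    by (rule G.prob_space_distr) simp
  have t: "0 \<le> t" using assms by simp
  have "indep_set (sets (generated_algebra M B1 {0..})) (sets (generated_algebra M B2 {0..}))"
    using horizontal by (simp add: horizontal_BM_def)
  then have "indep_var borel (\<lambda>\<omega>. B1 t \<omega> - B1 s \<omega>) borel (\<lambda>\<omega>. B2 t \<omega> - B2 s \<omega>)"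
    by (rule indep_var_measurable)
      (use assms t in \<open>auto intro!: borel_measurable_diff measurable_generated_algebra\<close>)
  then have "distr M (borel \<Otimes>\<^sub>M borel) (\<lambda>\<omega>. (B1 t \<omega> - B1 s \<omega>, B2 t \<omega> - B2 s \<omega>)) =
      distr std_gaussian borel (\<lambda>x. sqrt (t - s) *\<^sub>R x) \<Otimes>\<^sub>M distr std_gaussian borel (\<lambda>x. sqrt (t - s) *\<^sub>R x)"
    unfolding indep_var_distribution_eq increment_law[OF assms] by simp
  also have "\<dots> = distr (std_gaussian \<Otimes>\<^sub>M std_gaussian) (borel \<Otimes>\<^sub>M borel) (\<lambda>(x, y). (sqrt (t - s) *\<^sub>R x, sqrt (t - s) *\<^sub>R y))"
    by (rule pair_measure_distr) (simp_all add: D.sigma_finite_measure_axioms)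
  finally show ?thesis
    by (simp add: Z_def borel_prod std_gaussian_pair[OF prob_space_gaussian] split_beta' scaleR_prod_def)
qed

definition coord_variance :: "'d \<Rightarrow> real" where
  "coord_variance j = (\<integral>x. (x $ j)\<^sup>2 \<partial>(std_gaussian :: (real^'d) measure))"

lemma component_filtered_brownian:
  assumes B: "standard_BM M B" and pr: "\<And>r \<omega>. B r \<omega> = pr (Z r \<omega>)" "bounded_linear pr"
  shows "filtered_brownian M F (\<lambda>r \<omega>. B r \<omega> $ j) (coord_variance j)"
proof (unfold_locales)
  have prc: "continuous_on UNIV (\<lambda>z. pr z $ j)"
    by (intro continuous_intros bounded_linear.continuous_on[OF pr(2)])
  have meas: "B r \<in> borel_measurable M" if "0 \<le> r" for r using B that by (simp add: standard_BM_def)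
  have law: "distr M borel (\<lambda>\<omega>. B t \<omega> - B s \<omega>) = distr std_gaussian borel (\<lambda>x. sqrt (t - s) *\<^sub>R x)"
    if "0 \<le> s" "s \<le> t" for s t using B that by (simp add: standard_BM_def)
  have diff: "(\<lambda>\<omega>. B t \<omega> - B s \<omega>) \<in> borel_measurable M" if "0 \<le> s" "s \<le> t" for s t
    using meas that by simp
  have transfer: "integrable M (\<lambda>\<omega>. f ((B t \<omega> - B s \<omega>) $ j)) \<longleftrightarrow> integrable (std_gaussian :: (real^'d) measure) (\<lambda>x. f (sqrt (t - s) * x $ j))"
    "(\<integral>\<omega>. f ((B t \<omega> - B s \<omega>) $ j) \<partial>M) = (\<integral>x. f (sqrt (t - s) * x $ j) \<partial>(std_gaussian :: (real^'d) measure))"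
    if st: "0 \<le> s" "s \<le> t" and [measurable]: "f \<in> borel_measurable borel" for s t and f :: "real \<Rightarrow> real"
  proof -
    have f: "(\<lambda>x :: real^'d. f (x $ j)) \<in> borel_measurable borel" by simp
    show "integrable M (\<lambda>\<omega>. f ((B t \<omega> - B s \<omega>) $ j)) \<longleftrightarrow> integrable (std_gaussian :: (real^'d) measure) (\<lambda>x. f (sqrt (t - s) * x $ j))"
      using integrable_distr_eq[OF diff[OF st] f] integrable_distr_eq[of "\<lambda>x. sqrt (t - s) *\<^sub>R x" "std_gaussian :: (real^'d) measure" borel, OF _ f]
      unfolding law[OF st] by simp
    show "(\<integral>\<omega>. f ((B t \<omega> - B s \<omega>) $ j) \<partial>M) = (\<integral>x. f (sqrt (t - s) * x $ j) \<partial>(std_gaussian :: (real^'d) measure))"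
      using integral_distr[OF diff[OF st] f] integral_distr[of "\<lambda>x. sqrt (t - s) *\<^sub>R x" "std_gaussian :: (real^'d) measure" borel, OF _ f]
      unfolding law[OF st] by simp
  qed
  show "space (F s) = space M" for s by simp
  show "sets (F s) \<subseteq> sets M" for s by (rule sets_F)
  show "sets (F s) \<subseteq> sets (F t)" if "s \<le> t" for s t using that by (rule F_mono)
  show "(\<lambda>\<omega>. B t \<omega> $ j) \<in> borel_measurable (F t)" if "0 \<le> t" for t
    unfolding pr(1) using measurable_compose[OF Z_adapted[OF that order_refl] borel_measurable_continuous_onI[OF prc]] .
  show "indep_var borel Y borel (\<lambda>\<omega>. B t \<omega> $ j - B s \<omega> $ j)"
    if "0 \<le> s" "s \<le> t" "Y \<in> borel_measurable (F s)" for s t and Y :: "'w \<Rightarrow> real"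
    using increments_indep_var[OF that borel_measurable_continuous_onI[OF prc]]
    by (simp add: pr(1) linear_diff[OF bounded_linear.linear[OF pr(2)]])
  fix s t :: real assume st: "0 \<le> s" "s \<le> t"
  show "expectation (\<lambda>\<omega>. B t \<omega> $ j - B s \<omega> $ j) = 0"
    using transfer(2)[OF st, of "\<lambda>x. x"] by (simp add: std_gaussian_component_mean)
  show "integrable M (\<lambda>\<omega>. (B t \<omega> $ j - B s \<omega> $ j)\<^sup>2)"
    using transfer(1)[OF st, of "\<lambda>x. x\<^sup>2"] st
    by (simp add: power_mult_distrib std_gaussian_component_sq_integrable[OF prob_space_gaussian])
  show "expectation (\<lambda>\<omega>. (B t \<omega> $ j - B s \<omega> $ j)\<^sup>2) = coord_variance j * (t - s)"
    using transfer(2)[OF st, of "\<lambda>x. x\<^sup>2"] st by (simp add: power_mult_distrib coord_variance_def)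
next
  have *: "AE \<omega> in M. B 0 \<omega> = 0 \<and> continuous_on {0..} (\<lambda>t. B t \<omega>)"
    using B by (simp add: standard_BM_def)
  show "AE \<omega> in M. B 0 \<omega> $ j = 0" "AE \<omega> in M. continuous_on {0..} (\<lambda>t. B t \<omega> $ j)"
    by (rule eventually_mono[OF *]; auto intro: continuous_on_component)+
qed

lemma components:
  "filtered_brownian M F (\<lambda>r \<omega>. B1 r \<omega> $ j) (coord_variance j)" "filtered_brownian M F (\<lambda>r \<omega>. B2 r \<omega> $ j) (coord_variance j)"
  by (rule component_filtered_brownian[OF BM(1), of fst], simp_all add: Z_def bounded_linear_fst)
    (rule component_filtered_brownian[OF BM(2), of snd], simp_all add: Z_def bounded_linear_snd)

end

section \<open>Products of Gaussian averages as Riemann sums\<close>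

definition gaussian_average :: "real \<Rightarrow> ('d::finite heis \<Rightarrow>\<^sub>C 'k::euclidean_space) \<Rightarrow> ('d heis \<Rightarrow>\<^sub>C 'k)" where
  "gaussian_average = heis_semigroup std_gaussian (\<lambda>\<tau> \<zeta>. (sqrt \<tau> *\<^sub>R \<zeta>, 0))"

lemma measurable_horizontal_dilation [measurable]:
  "(\<lambda>\<zeta>. (sqrt \<tau> *\<^sub>R \<zeta>, 0) :: 'd::finite heis) \<in> borel_measurable std_gaussian"
  by (intro borel_measurable_Pair) simp_all

lemma gaussian_average_apply:
  assumes "prob_space (std_gaussian :: ((real^'d::finite) \<times> (real^'d)) measure)"
  shows "apply_bcontfun (gaussian_average \<tau> f) (\<xi> :: 'd heis) =
    (\<integral>\<zeta>. apply_bcontfun f (\<xi> \<odot> (sqrt \<tau> *\<^sub>R \<zeta>, 0)) \<partial>std_gaussian)"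
  unfolding gaussian_average_def
  by (rule heis_semigroup_apply[OF assms]) simp

lemma S_op_eq_gaussian_average:
  fixes f :: "'d::finite heis \<Rightarrow>\<^sub>C 'k::euclidean_space"
  assumes "prob_space (std_gaussian :: ((real^'d) \<times> (real^'d)) measure)"
  shows "S_op (apply_bcontfun c) \<tau> (apply_bcontfun f) = apply_bcontfun (gaussian_average \<tau> f + \<tau> *\<^sub>R bmult c f)"
  by (rule ext) (auto simp: S_op_def gaussian_average_apply[OF assms] bmult_apply hmult_def sympl_scaleR_right)

lemma S_op_power_eq:
  fixes f :: "'d::finite heis \<Rightarrow>\<^sub>C 'k::euclidean_space"
  assumes "prob_space (std_gaussian :: ((real^'d) \<times> (real^'d)) measure)"
  shows "(S_op (apply_bcontfun c) \<tau> ^^ n) (apply_bcontfun f) =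
    apply_bcontfun (((\<lambda>h. gaussian_average \<tau> h + \<tau> *\<^sub>R bmult c h) ^^ n) f)"
  by (induction n) (simp_all only: funpow.simps comp_def id_def S_op_eq_gaussian_average[OF assms])

primrec gaussian_product :: "(nat \<Rightarrow> real) \<Rightarrow> nat \<Rightarrow> ('d::finite heis \<Rightarrow>\<^sub>C 'k::euclidean_space) \<Rightarrow> ('d heis \<Rightarrow>\<^sub>C 'k)" where
  "gaussian_product \<sigma> 0 f = f"
| "gaussian_product \<sigma> (Suc k) f = gaussian_product \<sigma> k (gaussian_average (\<sigma> k) f)"

lemma gaussian_product_const: "gaussian_product (\<lambda>_. \<tau>) k f = (gaussian_average \<tau> ^^ k) f"
  by (induction k arbitrary: f) (simp_all add: funpow_swap1)

lemma gaussian_product_cong: "(\<And>i. i < k \<Longrightarrow> \<sigma> i = \<sigma>' i) \<Longrightarrow> gaussian_product \<sigma> k f = gaussian_product \<sigma>' k f"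
  by (induction k arbitrary: f) simp_all

lemma gaussian_product_add: "gaussian_product \<sigma> (n + m) f = gaussian_product \<sigma> n (gaussian_product (\<lambda>i. \<sigma> (n + i)) m f)"
  by (induction m arbitrary: f) simp_all

context horizontal_brownian
begin

definition time :: "(nat \<Rightarrow> real) \<Rightarrow> nat \<Rightarrow> real" where
  "time \<sigma> k = (\<Sum>i<k. \<sigma> i)"

lemma time_simps [simp]: "time \<sigma> 0 = 0" "time \<sigma> (Suc k) = time \<sigma> k + \<sigma> k"
  by (simp_all add: time_def)

lemma time_add: "time \<sigma> (n + m) = time \<sigma> n + time (\<lambda>i. \<sigma> (n + i)) m"
  by (induction m) simp_all

text \<open>
  The group product of the horizontal Brownian increments with step lengths \<open>\<sigma>\<close> (see \<open>walk_Suc\<close>). Its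
  central coordinate is the left-endpoint Riemann sum of the area integral.
\<close>

definition walk :: "(nat \<Rightarrow> real) \<Rightarrow> nat \<Rightarrow> 'w \<Rightarrow> 'd heis" where
  "walk \<sigma> k \<omega> = (Z (time \<sigma> k) \<omega>, \<Sum>i<k. Z (time \<sigma> i) \<omega> \<bullet>\<^sub>\<sigma> (Z (time \<sigma> (Suc i)) \<omega> - Z (time \<sigma> i) \<omega>))"

lemma walk_Suc: "walk \<sigma> (Suc k) \<omega> = walk \<sigma> k \<omega> \<odot> (Z (time \<sigma> (Suc k)) \<omega> - Z (time \<sigma> k) \<omega>, 0)"
  by (simp add: walk_def hmult_def)

lemma time_nonneg: "(\<And>i. \<sigma> i \<ge> 0) \<Longrightarrow> time \<sigma> k \<ge> 0"
  unfolding time_def by (rule sum_nonneg) simp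

lemma time_mono: "(\<And>i. \<sigma> i \<ge> 0) \<Longrightarrow> i \<le> k \<Longrightarrow> time \<sigma> i \<le> time \<sigma> k"
  unfolding time_def by (rule sum_mono2) auto

lemma borel_measurable_sympl:
  fixes f g :: "'a \<Rightarrow> (real^'d) \<times> (real^'d)"
  assumes "f \<in> borel_measurable N" "g \<in> borel_measurable N"
  shows "(\<lambda>\<omega>. f \<omega> \<bullet>\<^sub>\<sigma> g \<omega>) \<in> borel_measurable N"
  by (rule borel_measurable_continuous_Pair[OF assms]) (auto simp: sympl_def intro!: continuous_intros)

lemma walk_adapted:
  assumes \<sigma>: "\<And>i. \<sigma> i \<ge> 0"
  shows "walk \<sigma> k \<in> borel_measurable (F (time \<sigma> k))"
proof -
  have "Z (time \<sigma> i) \<in> borel_measurable (F (time \<sigma> k))" if "i \<le> k" for i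
    using that by (intro Z_adapted time_nonneg time_mono \<sigma>)
  then show ?thesis
    unfolding walk_def
    by (intro borel_measurable_Pair borel_measurable_sum borel_measurable_sympl borel_measurable_diff)
      (auto simp del: time_simps)
qed

lemma walk_measurable: "(\<And>i. \<sigma> i \<ge> 0) \<Longrightarrow> walk \<sigma> k \<in> borel_measurable M"
  using measurable_from_subalg[OF _ walk_adapted, of M] sets_F by (auto simp: subalgebra_def)

lemma Z_start: "AE \<omega> in M. Z 0 \<omega> = 0"
proof -
  have "AE \<omega> in M. B1 0 \<omega> = 0" "AE \<omega> in M. B2 0 \<omega> = 0" using BM by (auto simp: standard_BM_def)
  then show ?thesis by eventually_elim (simp add: Z_def zero_prod_def)
qed

text \<open>
  Conditioning on the past: the joint law of \<open>Y\<close> and the increment is a product, and the increment has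
  the law over which \<open>gaussian_average\<close> integrates.
\<close>

lemma average_over_increment:
  fixes f :: "'d heis \<Rightarrow>\<^sub>C 'k::euclidean_space"
  assumes s: "0 \<le> s" and \<tau>: "0 \<le> \<tau>" and Y: "Y \<in> borel_measurable (F s)"
  shows "(\<integral>\<omega>. apply_bcontfun f (Y \<omega> \<odot> (Z (s + \<tau>) \<omega> - Z s \<omega>, 0)) \<partial>M) =
    (\<integral>\<omega>. apply_bcontfun (gaussian_average \<tau> f) (Y \<omega>) \<partial>M)"
proof -
  let ?D = "\<lambda>\<omega>. (Z (s + \<tau>) \<omega> - Z s \<omega>, 0) :: 'd heis"
  let ?g = "\<lambda>z. (z, 0) :: 'd heis"
  have st: "s \<le> s + \<tau>" using \<tau> by simp
  have g: "?g \<in> borel_measurable borel" by (intro borel_measurable_Pair) simp_all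
  have YM [measurable]: "Y \<in> borel_measurable M"
    using measurable_from_subalg[OF _ Y, of M] sets_F by (auto simp: subalgebra_def)
  have inc [measurable]: "(\<lambda>\<omega>. Z (s + \<tau>) \<omega> - Z s \<omega>) \<in> borel_measurable M" using s \<tau> by simp
  have DM [measurable]: "?D \<in> borel_measurable M" by (intro borel_measurable_Pair inc) simp
  interpret Y: prob_space "distr M borel Y" by (rule prob_space_distr) simp
  interpret D: prob_space "distr M borel ?D" by (rule prob_space_distr) simp
  interpret YD: pair_prob_space "distr M borel Y" "distr M borel ?D" ..
  let ?h = "\<lambda>p :: 'd heis \<times> 'd heis. apply_bcontfun f (fst p \<odot> snd p)"
  have h: "?h \<in> borel_measurable (borel \<Otimes>\<^sub>M borel)"
    by (intro borel_measurable_bcontfun borel_measurable_hmult) simp_all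
  have h_int: "integrable (distr M borel Y \<Otimes>\<^sub>M distr M borel ?D) ?h"
    by (rule YD.integrable_const_bound[where B = "norm f"]) (use h in \<open>auto simp: norm_bounded cong: measurable_cong_sets\<close>)
  have law: "distr M borel ?D = distr std_gaussian borel (\<lambda>\<zeta>. (sqrt \<tau> *\<^sub>R \<zeta>, 0))"
  proof -
    have "distr M borel ?D = distr (distr M borel (\<lambda>\<omega>. Z (s + \<tau>) \<omega> - Z s \<omega>)) borel ?g"
      using distr_distr[OF g inc] by (simp add: comp_def)
    also have "\<dots> = distr (distr std_gaussian borel (\<lambda>\<zeta>. sqrt \<tau> *\<^sub>R \<zeta>)) borel ?g"
      using joint_increment_law[OF s st] by simp
    also have "\<dots> = distr std_gaussian borel (\<lambda>\<zeta>. (sqrt \<tau> *\<^sub>R \<zeta>, 0))"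
      by (subst distr_distr[OF g]) (simp_all add: comp_def)
    finally show ?thesis .
  qed
  have "(\<integral>\<omega>. apply_bcontfun f (Y \<omega> \<odot> ?D \<omega>) \<partial>M) = (\<integral>p. ?h p \<partial>(distr M (borel \<Otimes>\<^sub>M borel) (\<lambda>\<omega>. (Y \<omega>, ?D \<omega>))))"
    by (subst integral_distr[OF _ h]) simp_all
  also have "distr M (borel \<Otimes>\<^sub>M borel) (\<lambda>\<omega>. (Y \<omega>, ?D \<omega>)) = distr M borel Y \<Otimes>\<^sub>M distr M borel ?D"
    using increments_indep_var[OF s st Y g] by (simp add: indep_var_distribution_eq)
  also have "(\<integral>p. ?h p \<partial>\<dots>) = (\<integral>y. (\<integral>d. ?h (y, d) \<partial>distr M borel ?D) \<partial>distr M borel Y)"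
    by (rule YD.integral_fst'[OF h_int, symmetric])
  also have "\<dots> = (\<integral>y. apply_bcontfun (gaussian_average \<tau> f) y \<partial>distr M borel Y)"
  proof (rule Bochner_Integration.integral_cong[OF refl])
    fix y
    have "(\<lambda>d. apply_bcontfun f (y \<odot> d)) \<in> borel_measurable borel"
      by (intro borel_measurable_bcontfun borel_measurable_hmult) simp_all
    then show "(\<integral>d. ?h (y, d) \<partial>distr M borel ?D) = apply_bcontfun (gaussian_average \<tau> f) y"
      unfolding law gaussian_average_apply[OF prob_space_gaussian_pair]
      by (subst integral_distr) simp_all
  qed
  also have "\<dots> = (\<integral>\<omega>. apply_bcontfun (gaussian_average \<tau> f) (Y \<omega>) \<partial>M)"
    by (rule integral_distr[OF YM borel_measurable_bcontfun]) simp
  finally show ?thesis .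
qed

text \<open>
  The last increment is integrated out first, which is why the product applies the average with the last step
  length to \<open>f\<close> first.
\<close>

lemma gaussian_product_walk:
  fixes f :: "'d heis \<Rightarrow>\<^sub>C 'k::euclidean_space"
  assumes \<sigma>: "\<And>i. \<sigma> i \<ge> 0"
  shows "apply_bcontfun (gaussian_product \<sigma> k f) \<xi> = (\<integral>\<omega>. apply_bcontfun f (\<xi> \<odot> walk \<sigma> k \<omega>) \<partial>M)"
proof (induction k arbitrary: f)
  case 0
  have "(\<integral>\<omega>. apply_bcontfun f (\<xi> \<odot> walk \<sigma> 0 \<omega>) \<partial>M) = (\<integral>\<omega>. apply_bcontfun f \<xi> \<partial>M)"
  proof (rule integral_cong_AE)
    show "AE \<omega> in M. apply_bcontfun f (\<xi> \<odot> walk \<sigma> 0 \<omega>) = apply_bcontfun f \<xi>"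
      using Z_start by eventually_elim (simp add: walk_def zero_prod_def[symmetric])
  qed (intro borel_measurable_bcontfun borel_measurable_hmult walk_measurable \<sigma> borel_measurable_const)+
  then show ?case by (simp add: prob_space)
next
  case (Suc k)
  have "(\<lambda>\<omega>. \<xi> \<odot> walk \<sigma> k \<omega>) \<in> borel_measurable (F (time \<sigma> k))"
    by (intro borel_measurable_hmult walk_adapted \<sigma>) simp
  from average_over_increment[OF time_nonneg[OF \<sigma>] \<sigma>[of k] this, of f] show ?case
    by (simp add: Suc walk_Suc hmult_assoc del: time_simps(1))
qed

text \<open>
  The factor \<open>16 = 2 * 2 * 4\<close> collects the constant \<open>4\<close> of \<open>ito_riemann_sum_error\<close>, the two Ito integrals for
  each coordinate, and \<open>(x + y)\<^sup>2 \<le> 2 x\<^sup>2 + 2 y\<^sup>2\<close>; the factor \<open>CARD('d)\<close> comes from squaring the sum over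
  the coordinates.
\<close>

definition area_constant :: real where
  "area_constant = real CARD('d) * (\<Sum>j\<in>UNIV. 16 * (coord_variance j)\<^sup>2)"

lemma area_constant_nonneg: "area_constant \<ge> 0"
  unfolding area_constant_def by (intro mult_nonneg_nonneg sum_nonneg) auto

text \<open>
  Coordinatewise, the area integral and its Riemann sum are sums of the two Ito integrals and of their Riemann
  sums, so \<open>ito_riemann_sum_error\<close> applies to each of the \<open>2 d\<close> terms.
\<close>

lemma area_error:
  assumes \<sigma>: "\<And>i. \<sigma> i \<ge> 0" and h: "\<And>i. i < N \<Longrightarrow> \<sigma> i \<le> h" "h \<ge> 0"
  shows "(\<integral>\<^sup>+\<omega>. ennreal ((A (time \<sigma> N) \<omega> - snd (walk \<sigma> N \<omega>))\<^sup>2) \<partial>M) \<le> ennreal (area_constant * h * time \<sigma> N)"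
proof -
  let ?t = "time \<sigma> N" and ?p = "time \<sigma>"
  have t: "?t \<ge> 0" by (intro time_nonneg \<sigma>)
  have F_eq: "(\<lambda>s. generated_algebra M (\<lambda>r \<omega>. (B1 r \<omega>, B2 r \<omega>)) {0..s}) = F"
    by (simp add: F_def[abs_def] Z_def[abs_def])
  obtain J1 J2 where
    J1: "\<And>j. has_ito_integral M F (\<lambda>r \<omega>. B1 r \<omega> $ j) (\<lambda>r \<omega>. B2 r \<omega> $ j) ?t (J1 j)" and
    J2: "\<And>j. has_ito_integral M F (\<lambda>r \<omega>. B2 r \<omega> $ j) (\<lambda>r \<omega>. B1 r \<omega> $ j) ?t (J2 j)" and
    A: "AE \<omega> in M. A ?t \<omega> = (\<Sum>j\<in>UNIV. J1 j \<omega> - J2 j \<omega>)"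
    using horizontal t unfolding horizontal_BM_def Let_def F_eq by blast
  have [measurable]: "J1 j \<in> borel_measurable M" "J2 j \<in> borel_measurable M" for j
    using J1 J2 by (simp_all add: has_ito_integral_def)
  define R1 where "R1 j \<omega> = (\<Sum>i<N. B2 (?p i) \<omega> $ j * (B1 (?p (Suc i)) \<omega> $ j - B1 (?p i) \<omega> $ j))" for j \<omega>
  define R2 where "R2 j \<omega> = (\<Sum>i<N. B1 (?p i) \<omega> $ j * (B2 (?p (Suc i)) \<omega> $ j - B2 (?p i) \<omega> $ j))" for j \<omega>
  have p_nonneg: "?p i \<ge> 0" for i by (intro time_nonneg \<sigma>)
  have comp [measurable]: "(\<lambda>\<omega>. B1 (?p i) \<omega> $ j) \<in> borel_measurable M" "(\<lambda>\<omega>. B2 (?p i) \<omega> $ j) \<in> borel_measurable M" for i j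
    using filtered_brownian.measurable_X[OF components(1) p_nonneg] filtered_brownian.measurable_X[OF components(2) p_nonneg] by auto
  have [measurable]: "R1 j \<in> borel_measurable M" "R2 j \<in> borel_measurable M" for j
    unfolding R1_def R2_def by (intro borel_measurable_sum borel_measurable_times borel_measurable_diff comp)+
  have e1: "(\<integral>\<^sup>+\<omega>. ennreal ((J1 j \<omega> - R1 j \<omega>)\<^sup>2) \<partial>M) \<le> ennreal (4 * coord_variance j * (coord_variance j * h * ?t))" for j
    unfolding R1_def
    by (rule filtered_brownian.ito_riemann_sum_error[OF components(1) components(2) J1]) (use \<sigma> h in auto)
  have e2: "(\<integral>\<^sup>+\<omega>. ennreal ((J2 j \<omega> - R2 j \<omega>)\<^sup>2) \<partial>M) \<le> ennreal (4 * coord_variance j * (coord_variance j * h * ?t))" for j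
    unfolding R2_def
    by (rule filtered_brownian.ito_riemann_sum_error[OF components(2) components(1) J2]) (use \<sigma> h in auto)
  have area: "snd (walk \<sigma> N \<omega>) = (\<Sum>j\<in>UNIV. R1 j \<omega> - R2 j \<omega>)" for \<omega>
  proof -
    have "Z (?p i) \<omega> \<bullet>\<^sub>\<sigma> (Z (?p (Suc i)) \<omega> - Z (?p i) \<omega>) =
        (\<Sum>j\<in>UNIV. B2 (?p i) \<omega> $ j * (B1 (?p (Suc i)) \<omega> $ j - B1 (?p i) \<omega> $ j) - B1 (?p i) \<omega> $ j * (B2 (?p (Suc i)) \<omega> $ j - B2 (?p i) \<omega> $ j))" for i
      by (simp add: sympl_def Z_def inner_vec_def sum_subtractf mult.commute del: time_simps)
    then have "snd (walk \<sigma> N \<omega>) = (\<Sum>i<N. \<Sum>j\<in>UNIV. B2 (?p i) \<omega> $ j * (B1 (?p (Suc i)) \<omega> $ j - B1 (?p i) \<omega> $ j) - B1 (?p i) \<omega> $ j * (B2 (?p (Suc i)) \<omega> $ j - B2 (?p i) \<omega> $ j))"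
      by (simp add: walk_def del: time_simps)
    also have "\<dots> = (\<Sum>j\<in>UNIV. R1 j \<omega> - R2 j \<omega>)"
      by (subst sum.swap) (simp add: R1_def R2_def sum_subtractf del: time_simps)
    finally show ?thesis .
  qed
  let ?c = "ennreal (real CARD('d))"
  have "(\<integral>\<^sup>+\<omega>. ennreal ((A ?t \<omega> - snd (walk \<sigma> N \<omega>))\<^sup>2) \<partial>M) \<le>
      (\<integral>\<^sup>+\<omega>. ?c * (\<Sum>j\<in>UNIV. 2 * ennreal ((J1 j \<omega> - R1 j \<omega>)\<^sup>2) + 2 * ennreal ((J2 j \<omega> - R2 j \<omega>)\<^sup>2)) \<partial>M)"
    using A
  proof (intro nn_integral_mono_AE, eventually_elim)
    case (elim \<omega>)
    let ?a = "\<lambda>j. J1 j \<omega> - R1 j \<omega>" and ?b = "\<lambda>j. R2 j \<omega> - J2 j \<omega>"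
    have "A ?t \<omega> - snd (walk \<sigma> N \<omega>) = (\<Sum>j\<in>UNIV. ?a j + ?b j)"
      unfolding elim area by (simp add: sum_subtractf[symmetric] algebra_simps)
    then have "(A ?t \<omega> - snd (walk \<sigma> N \<omega>))\<^sup>2 \<le> real CARD('d) * (\<Sum>j\<in>UNIV. (?a j + ?b j)\<^sup>2)"
      using sum_squared_le_sum_of_squares[of "\<lambda>j. ?a j + ?b j" UNIV] by (simp add: mult.commute)
    then have "ennreal ((A ?t \<omega> - snd (walk \<sigma> N \<omega>))\<^sup>2) \<le> ?c * (\<Sum>j\<in>UNIV. ennreal ((?a j + ?b j)\<^sup>2))"
      by (simp add: ennreal_mult[symmetric] sum_nonneg)
    also have "\<dots> \<le> ?c * (\<Sum>j\<in>UNIV. 2 * ennreal ((?a j)\<^sup>2) + 2 * ennreal ((?b j)\<^sup>2))"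
      by (intro mult_left_mono sum_mono ennreal_square_add_le) simp
    finally show ?case by (simp add: power2_commute[of "R2 _ _"])
  qed
  also have "\<dots> = ?c * (\<Sum>j\<in>UNIV. 2 * (\<integral>\<^sup>+\<omega>. ennreal ((J1 j \<omega> - R1 j \<omega>)\<^sup>2) \<partial>M) + 2 * (\<integral>\<^sup>+\<omega>. ennreal ((J2 j \<omega> - R2 j \<omega>)\<^sup>2) \<partial>M))"
    by (simp add: nn_integral_cmult nn_integral_sum nn_integral_add)
  also have "\<dots> \<le> ?c * (\<Sum>j\<in>UNIV. 2 * ennreal (4 * coord_variance j * (coord_variance j * h * ?t)) + 2 * ennreal (4 * coord_variance j * (coord_variance j * h * ?t)))"
    by (intro mult_left_mono sum_mono add_mono e1 e2) simp_all
  also have "\<dots> = ?c * (\<Sum>j\<in>UNIV. ennreal (16 * (coord_variance j)\<^sup>2 * (h * ?t)))"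
  proof -
    have "2 * ennreal (4 * coord_variance j * (coord_variance j * h * ?t)) + 2 * ennreal (4 * coord_variance j * (coord_variance j * h * ?t)) = ennreal (16 * (coord_variance j)\<^sup>2 * (h * ?t))" for j
    proof -
      have nn: "0 \<le> 4 * coord_variance j * (coord_variance j * h * ?t)"
        using filtered_brownian.v_nonneg[OF components(1)] h t by simp
      have "2 * x + 2 * x = 4 * x" for x :: ennreal
        using distrib_right[of 2 2 x] by simp
      then have "2 * ennreal (4 * coord_variance j * (coord_variance j * h * ?t)) + 2 * ennreal (4 * coord_variance j * (coord_variance j * h * ?t)) = ennreal (4 * (4 * coord_variance j * (coord_variance j * h * ?t)))"
        by (simp only: ennreal_mult[OF zero_le_numeral nn] ennreal_numeral)
      then show ?thesis by (simp add: power2_eq_square mult_ac)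
    qed
    then show ?thesis by simp
  qed
  also have "\<dots> = ennreal (real CARD('d) * (\<Sum>j\<in>UNIV. 16 * (coord_variance j)\<^sup>2 * (h * ?t)))"
  proof -
    have nn: "0 \<le> 16 * (coord_variance j)\<^sup>2 * (h * ?t)" for j using h t by simp
    show ?thesis
      unfolding sum_ennreal[OF nn] by (rule ennreal_mult[symmetric]) (auto intro: sum_nonneg nn)
  qed
  also have "real CARD('d) * (\<Sum>j\<in>UNIV. 16 * (coord_variance j)\<^sup>2 * (h * ?t)) = area_constant * h * ?t"
    unfolding area_constant_def sum_distrib_right[symmetric] by (simp only: mult.assoc)
  finally show ?thesis .
qed

section \<open>The semigroup of horizontal Brownian motion\<close>

abbreviation W :: "real \<Rightarrow> 'w \<Rightarrow> 'd heis" where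
  "W \<equiv> heis_process B1 B2 A"

lemma measurable_W: "0 \<le> t \<Longrightarrow> W t \<in> borel_measurable M"
  unfolding heis_process_def[abs_def] by (intro borel_measurable_Pair measurable_B measurable_A)

text \<open>
  \<open>W(t)\<close> and \<open>walk\<close> have the same horizontal coordinate, so they differ by right translation by a central
  element, and \<open>area_error\<close> bounds its second moment.
\<close>

lemma gaussian_product_close:
  fixes f :: "'d heis \<Rightarrow>\<^sub>C 'k::euclidean_space"
  assumes mod: "\<And>\<xi> w. norm (apply_bcontfun f (\<xi> \<odot> w) - apply_bcontfun f \<xi>) \<le> e + C * (norm w)\<^sup>2"
    and C: "C \<ge> 0" and e: "e \<ge> 0"
    and \<sigma>: "\<And>i. \<sigma> i \<ge> 0" and h: "\<And>i. i < N \<Longrightarrow> \<sigma> i \<le> h" "h \<ge> 0"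
  shows "norm (gaussian_product \<sigma> N f - heis_semigroup M W (time \<sigma> N) f) \<le> e + C * (area_constant * h * time \<sigma> N)"
proof (rule norm_bound)
  fix \<xi>
  let ?t = "time \<sigma> N"
  have t: "?t \<ge> 0" by (intro time_nonneg \<sigma>)
  let ?D = "\<lambda>\<omega>. (0, A ?t \<omega> - snd (walk \<sigma> N \<omega>)) :: 'd heis"
  have snd_walk: "(\<lambda>\<omega>. snd (walk \<sigma> N \<omega>)) \<in> borel_measurable M"
    by (rule measurable_compose[OF walk_measurable[OF \<sigma>] borel_measurable_continuous_onI]) (intro continuous_intros)
  have "norm ((\<integral>\<omega>. apply_bcontfun f (\<xi> \<odot> W ?t \<omega>) \<partial>M) - (\<integral>\<omega>. apply_bcontfun f (\<xi> \<odot> walk \<sigma> N \<omega>) \<partial>M)) \<le> e + C * (area_constant * h * ?t)"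
  proof (rule norm_average_diff_le[OF mod C e])
    show "?D \<in> borel_measurable M"
      by (intro borel_measurable_Pair borel_measurable_diff measurable_A t snd_walk) simp
    show "AE \<omega> in M. W ?t \<omega> = walk \<sigma> N \<omega> \<odot> ?D \<omega>"
      by (simp add: heis_process_def walk_def Z_def hmult_def)
    show "(\<integral>\<^sup>+\<omega>. ennreal ((norm (?D \<omega>))\<^sup>2) \<partial>M) \<le> ennreal (area_constant * h * ?t)"
      using area_error[OF \<sigma> h] by (simp add: norm_Pair)
    show "0 \<le> area_constant * h * ?t" using area_constant_nonneg h t by simp
  qed (intro measurable_W t walk_measurable \<sigma>)+
  then show "norm (apply_bcontfun (gaussian_product \<sigma> N f - heis_semigroup M W ?t f) \<xi>) \<le> e + C * (area_constant * h * ?t)"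
    by (simp add: gaussian_product_walk[OF \<sigma>] heis_semigroup_apply[where W = W, OF prob_space_axioms measurable_W[OF t]] norm_minus_commute)
qed

lemma time_const: "time (\<lambda>_. \<tau>) k = real k * \<tau>"
  by (simp add: time_def)

lemma gaussian_power_close:
  fixes f :: "'d heis \<Rightarrow>\<^sub>C 'k::euclidean_space"
  assumes mod: "\<And>\<xi> w. norm (apply_bcontfun f (\<xi> \<odot> w) - apply_bcontfun f \<xi>) \<le> e + C * (norm w)\<^sup>2"
    and C: "C \<ge> 0" and e: "e \<ge> 0" and \<tau>: "\<tau> \<ge> 0"
  shows "norm ((gaussian_average \<tau> ^^ k) f - heis_semigroup M W (real k * \<tau>) f) \<le> e + C * (area_constant * \<tau> * (real k * \<tau>))"
  using gaussian_product_close[OF mod C e, of "\<lambda>_. \<tau>" k \<tau>] \<tau>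
  by (simp add: gaussian_product_const time_const)

lemma gaussian_power_approximates:
  fixes f :: "'d heis \<Rightarrow>\<^sub>C 'k::euclidean_space"
  assumes f: "f \<in> C0" and N: "N \<ge> 0" and e: "e > 0"
  shows "eventually (\<lambda>\<tau>. \<forall>m. real m * \<tau> \<le> N \<longrightarrow>
    norm ((gaussian_average \<tau> ^^ m) f - heis_semigroup M W (real m * \<tau>) f) \<le> e) (at_right 0)"
proof -
  have e2: "e / 2 > 0" using e by simp
  obtain C where C: "C \<ge> 0" "\<And>\<xi> w. norm (apply_bcontfun f (\<xi> \<odot> w) - apply_bcontfun f \<xi>) \<le> e / 2 + C * (norm w)\<^sup>2"
    using C0_quadratic_modulus[OF f e2] by metis
  have "((\<lambda>\<tau>. C * (area_constant * \<tau> * N)) \<longlongrightarrow> C * (area_constant * 0 * N)) (at_right 0)"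
    by (intro tendsto_intros)
  then have "eventually (\<lambda>\<tau>. C * (area_constant * \<tau> * N) < e / 2) (at_right 0)"
    using e2 by (intro order_tendstoD(2)[of _ "C * (area_constant * 0 * N)"]) auto
  with eventually_at_right_less[of 0] show ?thesis
  proof eventually_elim
    case (elim \<tau>)
    show ?case
    proof (intro allI impI)
      fix m assume m: "real m * \<tau> \<le> N"
      have "norm ((gaussian_average \<tau> ^^ m) f - heis_semigroup M W (real m * \<tau>) f) \<le> e / 2 + C * (area_constant * \<tau> * (real m * \<tau>))"
        by (rule gaussian_power_close[OF C(2,1)]) (use e elim in auto)
      also have "C * (area_constant * \<tau> * (real m * \<tau>)) \<le> C * (area_constant * \<tau> * N)"
        using m C(1) area_constant_nonneg elim by (intro mult_left_mono) auto
      finally show "norm ((gaussian_average \<tau> ^^ m) f - heis_semigroup M W (real m * \<tau>) f) \<le> e"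
        using elim(2) by simp
    qed
  qed
qed

lemma linear_gaussian_average: "linear (gaussian_average \<tau> :: ('d heis \<Rightarrow>\<^sub>C 'k::euclidean_space) \<Rightarrow> _)"
  unfolding gaussian_average_def
  by (rule prob_space.linear_heis_semigroup[OF prob_space_gaussian_pair]) simp

lemma norm_gaussian_average_le: "norm (gaussian_average \<tau> f) \<le> norm (f :: 'd heis \<Rightarrow>\<^sub>C 'k::euclidean_space)"
  unfolding gaussian_average_def
  by (rule prob_space.norm_heis_semigroup_le[OF prob_space_gaussian_pair]) simp

lemma gaussian_average_0: "gaussian_average 0 f = (f :: 'd heis \<Rightarrow>\<^sub>C 'k::euclidean_space)"
  by (rule bcontfun_eqI) (simp add: gaussian_average_apply[OF prob_space_gaussian_pair] zero_prod_def[symmetric]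
      prob_space.prob_space[OF prob_space_gaussian_pair, simplified])

lemma gaussian_average_tendsto:
  fixes f :: "'d heis \<Rightarrow>\<^sub>C 'k::euclidean_space"
  assumes f: "f \<in> C0"
  shows "((\<lambda>\<tau>. gaussian_average \<tau> f) \<longlongrightarrow> f) (at_right 0)"
  unfolding tendsto_iff
proof (intro allI impI)
  fix e :: real assume e: "e > 0"
  then have e2: "e / 2 > 0" by simp
  obtain C where C: "C \<ge> 0" "\<And>\<xi> w. norm (apply_bcontfun f (\<xi> \<odot> w) - apply_bcontfun f \<xi>) \<le> e / 2 + C * (norm w)\<^sup>2"
    using C0_quadratic_modulus[OF f e2] by metis
  obtain m where m: "m \<ge> 0" "(\<integral>\<^sup>+\<zeta>. ennreal ((norm \<zeta>)\<^sup>2) \<partial>(std_gaussian :: ((real^'d) \<times> (real^'d)) measure)) = ennreal m"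
    using std_gaussian_second_moment_finite[OF prob_space_gaussian_pair] by (auto simp: less_top_ennreal)
  have "((\<lambda>\<tau>. C * (\<tau> * m)) \<longlongrightarrow> C * (0 * m)) (at_right 0)"
    by (intro tendsto_intros)
  then have "eventually (\<lambda>\<tau>. C * (\<tau> * m) < e / 2) (at_right 0)"
    using e2 by (intro order_tendstoD(2)[of _ "C * (0 * m)"]) auto
  with eventually_at_right_less[of 0] show "eventually (\<lambda>\<tau>. dist (gaussian_average \<tau> f) f < e) (at_right 0)"
  proof eventually_elim
    case (elim \<tau>)
    let ?D = "\<lambda>\<zeta>. (sqrt \<tau> *\<^sub>R \<zeta>, 0) :: 'd heis"
    have "norm (gaussian_average \<tau> f - f) \<le> e / 2 + C * (\<tau> * m)"
    proof (rule norm_bound)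
      fix \<xi> :: "'d heis"
      have "norm ((\<integral>\<zeta>. apply_bcontfun f (\<xi> \<odot> ?D \<zeta>) \<partial>std_gaussian) - (\<integral>\<zeta>. apply_bcontfun f (\<xi> \<odot> 0) \<partial>(std_gaussian :: ((real^'d) \<times> (real^'d)) measure))) \<le> e / 2 + C * (\<tau> * m)"
      proof (rule prob_space.norm_average_diff_le[where Y = ?D and Z = "\<lambda>_. 0" and D = ?D, OF prob_space_gaussian_pair C(2,1)])
        have "(\<integral>\<^sup>+\<zeta>. ennreal ((norm (?D \<zeta>))\<^sup>2) \<partial>std_gaussian) = (\<integral>\<^sup>+\<zeta>. ennreal \<tau> * ennreal ((norm \<zeta>)\<^sup>2) \<partial>(std_gaussian :: ((real^'d) \<times> (real^'d)) measure))"
          using elim by (simp add: norm_Pair power_mult_distrib ennreal_mult[symmetric])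
        also have "\<dots> = ennreal (\<tau> * m)"
          using elim m by (simp add: nn_integral_cmult ennreal_mult)
        finally show "(\<integral>\<^sup>+\<zeta>. ennreal ((norm (?D \<zeta>))\<^sup>2) \<partial>std_gaussian) \<le> ennreal (\<tau> * m)" by simp
      qed (use e elim m in auto)
      then show "norm (apply_bcontfun (gaussian_average \<tau> f - f) \<xi>) \<le> e / 2 + C * (\<tau> * m)"
        by (simp add: gaussian_average_apply[OF prob_space_gaussian_pair] prob_space.prob_space[OF prob_space_gaussian_pair, simplified])
    qed
    then show ?case using elim by (simp add: dist_norm)
  qed
qed

text \<open>
  The partition with \<open>k\<close> steps of length \<open>s / k\<close> followed by \<open>k\<close> steps of length \<open>t / k\<close> gives a Gaussian product
  close to \<open>V(s + t) f\<close>, while its two halves are close to \<open>V(s)\<close> and \<open>V(t)\<close>.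
\<close>

lemma heis_semigroup_add:
  fixes f :: "'d heis \<Rightarrow>\<^sub>C 'k::euclidean_space"
  assumes s: "s \<ge> 0" and t: "t \<ge> 0" and f: "f \<in> C0"
  shows "heis_semigroup M W (s + t) f = heis_semigroup M W s (heis_semigroup M W t f)"
proof -
  let ?V = "heis_semigroup M W :: real \<Rightarrow> ('d heis \<Rightarrow>\<^sub>C 'k) \<Rightarrow> _"
  have Vt: "?V t f \<in> C0" by (rule heis_semigroup_C0[where W = W, OF measurable_W[OF t] f])
  have "norm (?V (s + t) f - ?V s (?V t f)) \<le> e" if e: "e > 0" for e
  proof -
    \<comment> \<open>There are three comparisons, each with an error \<open>e / 6\<close> from the modulus of continuity and \<open>e / 6\<close> from the second moment.\<close>
    have e2: "e / 6 > 0" using e by simp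
    obtain C where C: "C \<ge> 0" "\<And>\<xi> w. norm (apply_bcontfun f (\<xi> \<odot> w) - apply_bcontfun f \<xi>) \<le> e / 6 + C * (norm w)\<^sup>2"
      using C0_quadratic_modulus[OF f e2] by metis
    obtain C' where C': "C' \<ge> 0" "\<And>\<xi> w. norm (apply_bcontfun (?V t f) (\<xi> \<odot> w) - apply_bcontfun (?V t f) \<xi>) \<le> e / 6 + C' * (norm w)\<^sup>2"
      using C0_quadratic_modulus[OF Vt e2] by metis
    define h where "h = (\<lambda>n. (s + t) / real (Suc n))"
    have "(\<lambda>n. (C + C') * (area_constant * h n * (s + t))) \<longlonglongrightarrow> (C + C') * (area_constant * 0 * (s + t))"
      unfolding h_def divide_inverse
      by (intro tendsto_intros tendsto_mult_right_zero LIMSEQ_inverse_real_of_nat)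
    then have "eventually (\<lambda>n. (C + C') * (area_constant * h n * (s + t)) < e / 6) sequentially"
      using e2 by (intro order_tendstoD(2)[of _ "(C + C') * (area_constant * 0 * (s + t))"]) auto
    then obtain n where n: "(C + C') * (area_constant * h n * (s + t)) < e / 6" by (auto simp: eventually_sequentially)
    define k where "k = Suc n"
    have hn: "0 \<le> h n" "s / real k \<le> h n" "t / real k \<le> h n"
      using s t unfolding h_def k_def by (auto intro!: divide_right_mono)
    have small: "C'' * (area_constant * a * b) \<le> e / 6" if "0 \<le> C''" "C'' \<le> C + C'" "0 \<le> a" "a \<le> h n" "0 \<le> b" "b \<le> s + t" for C'' a b
    proof -
      have "C'' * (area_constant * a * b) \<le> (C + C') * (area_constant * h n * (s + t))"
        using that area_constant_nonneg by (intro mult_mono) auto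
      then show ?thesis using n by simp
    qed
    define \<sigma> where "\<sigma> = (\<lambda>i. if i < k then s / real k else t / real k)"
    let ?U = "\<lambda>\<tau>. gaussian_average \<tau> ^^ k :: ('d heis \<Rightarrow>\<^sub>C 'k) \<Rightarrow> _"
    have time: "time \<sigma> (k + k) = s + t"
    proof -
      have "time \<sigma> k = (\<Sum>i<k. s / real k)" "time (\<lambda>i. \<sigma> (k + i)) k = (\<Sum>i<k. t / real k)"
        unfolding time_def by (auto intro!: sum.cong simp: \<sigma>_def)
      moreover have "real k \<noteq> 0" by (simp add: k_def)
      ultimately show ?thesis by (simp add: time_add)
    qed
    have prod: "gaussian_product \<sigma> (k + k) f = ?U (s / real k) (?U (t / real k) f)"
    proof -
      have "gaussian_product \<sigma> k g = ?U (s / real k) g" for g :: "'d heis \<Rightarrow>\<^sub>C 'k"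
        unfolding gaussian_product_const[symmetric] by (rule gaussian_product_cong) (simp add: \<sigma>_def)
      moreover have "gaussian_product (\<lambda>i. \<sigma> (k + i)) k f = ?U (t / real k) f"
        unfolding gaussian_product_const[symmetric] by (rule gaussian_product_cong) (simp add: \<sigma>_def)
      ultimately show ?thesis by (simp add: gaussian_product_add)
    qed
    have st: "s / real k \<ge> 0" "t / real k \<ge> 0" using s t by auto
    have 1: "norm (?U (s / real k) (?U (t / real k) f) - ?V (s + t) f) \<le> e / 6 + e / 6"
    proof -
      have "norm (gaussian_product \<sigma> (k + k) f - ?V (time \<sigma> (k + k)) f) \<le> e / 6 + C * (area_constant * h n * time \<sigma> (k + k))"
        by (rule gaussian_product_close[OF C(2,1)]) (use e hn st in \<open>auto simp: \<sigma>_def\<close>)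
      also have "\<dots> \<le> e / 6 + e / 6"
        using C C' hn s t unfolding time by (intro add_left_mono small) auto
      finally show ?thesis unfolding time prod .
    qed
    have U_lin: "linear (?U \<tau>)" for \<tau> by (intro linear_funpow linear_gaussian_average)
    have U_le: "norm (?U \<tau> g) \<le> norm g" for \<tau> and g :: "'d heis \<Rightarrow>\<^sub>C 'k"
    proof -
      have "norm ((gaussian_average \<tau> ^^ m) g) \<le> norm g" for m
        by (induction m) (auto intro: order_trans[OF norm_gaussian_average_le])
      then show ?thesis .
    qed
    have 2: "norm (?U (s / real k) (?U (t / real k) f) - ?U (s / real k) (?V t f)) \<le> e / 6 + e / 6"
    proof -
      have "norm (?U (s / real k) (?U (t / real k) f - ?V t f)) \<le> norm (?U (t / real k) f - ?V t f)" by (rule U_le)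
      also have "\<dots> \<le> e / 6 + C * (area_constant * (t / real k) * t)"
        using gaussian_power_close[OF C(2,1) _ st(2), of k] e by (simp add: k_def)
      also have "\<dots> \<le> e / 6 + e / 6"
        using C C' hn s t by (intro add_left_mono small) auto
      finally show ?thesis by (simp add: linear_diff[OF U_lin])
    qed
    have 3: "norm (?U (s / real k) (?V t f) - ?V s (?V t f)) \<le> e / 6 + e / 6"
    proof -
      have "norm (?U (s / real k) (?V t f) - ?V s (?V t f)) \<le> e / 6 + C' * (area_constant * (s / real k) * s)"
        using gaussian_power_close[OF C'(2,1) _ st(1), of k] e by (simp add: k_def)
      also have "\<dots> \<le> e / 6 + e / 6"
        using C C' hn s t by (intro add_left_mono small) auto
      finally show ?thesis .
    qed
    have "?V (s + t) f - ?V s (?V t f) = - (?U (s / real k) (?U (t / real k) f) - ?V (s + t) f) +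
      (?U (s / real k) (?U (t / real k) f) - ?U (s / real k) (?V t f)) + (?U (s / real k) (?V t f) - ?V s (?V t f))" by simp
    also have "norm \<dots> \<le> (e / 6 + e / 6) + (e / 6 + e / 6) + (e / 6 + e / 6)"
      by (intro norm_triangle_mono 2 3) (use 1 in \<open>simp only: norm_minus_cancel\<close>)
    also have "\<dots> = e" by simp
    finally show ?thesis .
  qed
  then have "norm (?V (s + t) f - ?V s (?V t f)) \<le> 0"
    by (rule field_le_epsilon) simp
  then show ?thesis by simp
qed

lemma heis_contraction_semigroup:
  "contraction_semigroup C0 (heis_semigroup M W :: real \<Rightarrow> ('d heis \<Rightarrow>\<^sub>C 'k::euclidean_space) \<Rightarrow> _)"
proof (rule contraction_semigroup.intro)
  show "closed (C0 :: ('d heis \<Rightarrow>\<^sub>C 'k) set)" by (rule closed_C0)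
  show "subspace (C0 :: ('d heis \<Rightarrow>\<^sub>C 'k) set)" by (rule subspace_C0)
  fix f :: "'d heis \<Rightarrow>\<^sub>C 'k" and s t :: real
  show "linear (heis_semigroup M W t :: ('d heis \<Rightarrow>\<^sub>C 'k) \<Rightarrow> _)" if "t \<ge> 0"
    by (rule linear_heis_semigroup[where W = W, OF measurable_W[OF that]])
  show "norm (heis_semigroup M W t f) \<le> norm f" if "t \<ge> 0"
    by (rule norm_heis_semigroup_le[where W = W, OF measurable_W[OF that]])
  show "heis_semigroup M W t f \<in> C0" if "t \<ge> 0" "f \<in> C0"
    by (rule heis_semigroup_C0[where W = W, OF measurable_W[OF that(1)] that(2)])
  show "heis_semigroup M W (s + t) f = heis_semigroup M W s (heis_semigroup M W t f)" if "s \<ge> 0" "t \<ge> 0" "f \<in> C0"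
    by (rule heis_semigroup_add[OF that])
  assume f: "f \<in> C0"
  show "heis_semigroup M W 0 f = f"
  proof -
    have "norm (f - heis_semigroup M W 0 f) \<le> 0"
    proof (rule field_le_epsilon)
      fix e :: real assume "e > 0"
      then obtain C where C: "C \<ge> 0" "\<And>\<xi> w. norm (apply_bcontfun f (\<xi> \<odot> w) - apply_bcontfun f \<xi>) \<le> e + C * (norm w)\<^sup>2"
        using C0_quadratic_modulus[OF f] by metis
      show "norm (f - heis_semigroup M W 0 f) \<le> 0 + e"
        using gaussian_power_close[OF C(2,1), of 0 0] \<open>e > 0\<close> by simp
    qed
    then show ?thesis by simp
  qed
  have "((\<lambda>\<tau>. gaussian_average \<tau> f - heis_semigroup M W \<tau> f) \<longlongrightarrow> 0) (at_right 0)"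
    unfolding tendsto_iff
  proof (intro allI impI)
    fix e :: real assume "e > 0"
    then have "e / 2 > 0" by simp
    from gaussian_power_approximates[OF f zero_le_one this] eventually_at_right_real[OF zero_less_one]
    show "eventually (\<lambda>\<tau>. dist (gaussian_average \<tau> f - heis_semigroup M W \<tau> f) 0 < e) (at_right 0)"
    proof eventually_elim
      case (elim \<tau>)
      then show ?case using spec[OF elim(1), of 1] \<open>e > 0\<close> by simp
    qed
  qed
  from tendsto_diff[OF gaussian_average_tendsto[OF f] this]
  show "((\<lambda>t. heis_semigroup M W t f) \<longlongrightarrow> f) (at_right 0)" by simp
qed

end

section \<open>The Cauchy problem\<close>

theorem theorem5:
  fixes M :: "'w measure"
    and B1 B2 :: "real \<Rightarrow> 'w \<Rightarrow> real^'d::finite"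
    and A :: "real \<Rightarrow> 'w \<Rightarrow> real"
    and c :: "'d heis \<Rightarrow>\<^sub>C real"
    and u0 :: "'d heis \<Rightarrow>\<^sub>C 'k::{real_normed_field, euclidean_space}"
  assumes "horizontal_BM M B1 B2 A"
    and "u0 \<in> dom_L M (heis_process B1 B2 A)"
  shows "\<exists>u. classical_solution (dom_L M (heis_process B1 B2 A))
               (op_Lc M (heis_process B1 B2 A) c) u0 u \<and>
             (\<forall>v. classical_solution (dom_L M (heis_process B1 B2 A))
               (op_Lc M (heis_process B1 B2 A) c) u0 v \<longrightarrow> (\<forall>t\<ge>0. v t = u t)) \<and>
             (\<forall>t\<ge>0. \<forall>x. (\<lambda>n. (S_op c (t / real n) ^^ n) u0 x) \<longlonglongrightarrow> u t x)"
proof -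
  interpret horizontal_brownian M B1 B2 A by standard (rule assms(1))
  let ?V = "heis_semigroup M W :: real \<Rightarrow> ('d heis \<Rightarrow>\<^sub>C 'k) \<Rightarrow> _"
  interpret V: contraction_semigroup C0 ?V by (rule heis_contraction_semigroup)
  interpret P: perturbed_semigroup C0 ?V "bmult c :: ('d heis \<Rightarrow>\<^sub>C 'k) \<Rightarrow> _" "norm c + 1"
  proof (intro perturbed_semigroup.intro perturbed_semigroup_axioms.intro V.contraction_semigroup_axioms linear_bmult bmult_C0)
    show "norm (bmult c f) \<le> (norm c + 1) * norm f" for f :: "'d heis \<Rightarrow>\<^sub>C 'k"
      by (rule order_trans[OF norm_bmult_le]) (auto intro!: mult_right_mono)
    show "norm c + 1 > 0" by (simp add: add_nonneg_pos)
  qed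
  have op: "op_Lc M W c = (\<lambda>f. generator ?V f + bmult c f)"
    by (simp add: op_Lc_def op_L_def fun_eq_iff)
  have u0: "u0 \<in> generator_domain C0 ?V" using assms(2) by (simp add: dom_L_def)
  then have u0_C0: "u0 \<in> C0" by (simp add: generator_domain_def)
  let ?u = "\<lambda>t. P.perturbed t u0"
  have sol: "classical_solution (dom_L M W) (op_Lc M W c) u0 ?u"
    unfolding op dom_L_def by (rule P.perturbed_classical_solution[OF u0])
  have unique: "v t = ?u t" if "classical_solution (dom_L M W) (op_Lc M W c) u0 v" "t \<ge> 0" for v t
    using P.classical_solution_unique[OF that(1)[unfolded op dom_L_def] sol[unfolded op dom_L_def] that(2)] .
  have lim: "(\<lambda>n. (S_op c (t / real n) ^^ n) u0 x) \<longlonglongrightarrow> apply_bcontfun (?u t) x" if t: "t \<ge> 0" for t x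
  proof (cases "t = 0")
    case True
    \<comment> \<open>The product formula concerns positive times; at time \<open>0\<close> every factor is the identity.\<close>
    have "((\<lambda>h. gaussian_average 0 h + 0 *\<^sub>R bmult c h) ^^ n) u0 = u0" for n
      by (induction n) (simp_all add: gaussian_average_0)
    then show ?thesis
      by (simp add: True S_op_power_eq[OF prob_space_gaussian_pair] P.perturbed_0[OF u0_C0] del: scale_zero_left)
  next
    case False
    have "(\<lambda>n. ((\<lambda>h. gaussian_average (t / real n) h + (t / real n) *\<^sub>R bmult c h) ^^ n) u0) \<longlonglongrightarrow> ?u t"
      by (rule P.perturbed_product_formula[OF linear_gaussian_average norm_gaussian_average_le gaussian_power_approximates u0_C0])
        (use False t in auto)
    then have lim: "(\<lambda>n. dist (((\<lambda>h. gaussian_average (t / real n) h + (t / real n) *\<^sub>R bmult c h) ^^ n) u0) (?u t)) \<longlonglongrightarrow> 0"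
      by (rule tendsto_dist_iff[THEN iffD1])
    show ?thesis
      unfolding S_op_power_eq[OF prob_space_gaussian_pair]
      by (rule tendsto_dist_iff[THEN iffD2], rule Lim_null_comparison[OF always_eventually lim]) (auto simp: dist_bounded)
  qed
  show ?thesis
    using sol unique lim by blast
qed

end
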